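(* Let $\kappa\ge 1$, $E_\kappa=\{0,1,\dots,\kappa\}$, and let $A$ be a probabilistic cellular automaton on $\mathbb{Z}$ with state set $E_\kappa$, neighbourhood $N(x)=(x,x+1)$ and transition matrix $T$ satisfying $$T_{(a,b),0}>0\quad\text{and}\quad T_{(0,0),c}>0\qquad\text{for all }a,b,c\in E_\kappa.$$ Consider $A$ as acting on probability laws on $E_\kappa^{\mathsf{HZ}}$ (horizontal zigzag), and let $\gamma$, $D^\gamma$, $U^\gamma$, $X$ be the objects built from $T$ in the context. Then $A$ admits as invariant distribution on $\mathsf{HZ}$ the law of some $(D,U)$-HZMC with $(DU)_{a,b}>0$ for all $a,b\in E_\kappa$ if and only if the following two conditions hold: (1) for all $a,b,c\in E_\kappa$, $$T_{(a,b),c}=\frac{T_{(0,0),0}\,T_{(a,b),0}\,T_{(a,0),c}\,T_{(0,b),c}}{T_{(a,0),0}\,T_{(0,b),0}\,T_{(0,0),c}};$$ (2) $D^\gamma U^\gamma=U^\gamma D^\gamma$. In this case the law of the $(D^\gamma,U^\gamma)$-HZMC is invariant under $A$, and the common invariant distribution of the Markov chains with Markov kernels $D^\gamma$, $U^\gamma$, $D^\gamma U^\gamma$ and $U^\gamma D^\gamma$ is $\rho=(\gamma_i\mu_i)_{0\le i\le\kappa}$, where $\mu={}^t(\mu_i)_{0\le i\le \kappa}$ is the Perron right eigenvector of $X$ normalised so that $\rho$ is a probability distribution. Moreover, when $\kappa=1$, condition (1) implies condition (2), so that the only condition is (1), which is then equivalent to $$T_{(0,0),0}T_{(1,1),0}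T_{(1,0),1}T_{(0,1),1}=T_{(1,1),1}T_{(0,0),1}T_{(0,1),0}T_{(1,0),0}.$$
   Context: A transition matrix is an array $T=(T_{(a,b),c})_{a,b,c\in E_\kappa}$ of non-negative numbers with $\sum_c T_{(a,b),c}=1$ for all $a,b$. The PCA with transition matrix $T$ on $\mathbb{Z}$ maps a (random) configuration $S_t\in E_\kappa^{\mathbb{Z}}$ to $S_{t+1}$ such that, conditionally on $S_t$ (and the past), the variables $S_{t+1}(x)$, $x\in\mathbb{Z}$, are independent and $S_{t+1}(x)=c$ with probability $T_{(S_t(x),S_t(x+1)),c}$. Action on the horizontal zigzag: a configuration on $\mathsf{HZ}$ is a pair $(S_0,S_1)\in E_\kappa^{\mathbb{Z}}\times E_\kappa^{\mathbb{Z}}$ of two consecutive lines. If $(S_0,S_1)$ has law $m$, the image of $m$ under $A$ is the law of $(S_1,S_2)$, where, conditionally on $(S_0,S_1)$, the $S_2(x)$ are independent with $S_2(x)=c$ with probability $T_{(S_1(x),S_1(x+1)),c}$. The law $m$ is invariant if it equals its image. A Markov kernel on $E_\kappa$ is a row-stochastic matrix indexed by $E_\kappa\times E_\kappa$. Given Markov kernels $D,U$ and a probability $\rho$ on $E_\kappa$ with $\rho=\rho DU$, a $(D,U)$-HZMC is a pair $(S_0,S_1)$ such that for all $i_0\in\mathbb{Z}$, $n\ge0$ and $a_i,b_i\in E_\kappa$, $$\mathbb{P}(S_0(i_0+i)=a_i,\ S_1(i_0+i)=b_i,\ 0\le i\le n)=\rho_{a_0}\Big(\prod_{i=0}^{n-1}D_{a_i,b_i}U_{b_i,a_{i+1}}\Big)D_{a_n,b_n}.$$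 For a primitive non-negative matrix (some power has all entries positive), the Perron eigenvalue is its eigenvalue of maximal modulus; the Perron left/right eigenvectors are the associated positive left/right eigenvectors, called stochastic when normalised to have sum 1. Let $\nu$ be the stochastic Perron left eigenvector of the stochastic matrix $Y=[T_{(i,i),j}]_{0\le i,j\le\kappa}$ (primitive under the assumption on $T$). Let $X$ be the matrix with entry, in row $d$ and column $a$, $$X_{d,a}=\frac{T_{(a,a),0}\,\nu_a}{T_{(a,d),0}},$$ and let $\gamma$ be the stochastic Perron left eigenvector of $X$. For a probability distribution $\eta$ on $E_\kappa$ with full support define the Markov kernels $$D^\eta_{a,c}=\frac{\sum_{\ell}\frac{\eta_\ell}{T_{(a,\ell),0}}T_{(a,\ell),c}}{\sum_{b'}\frac{\eta_{b'}}{T_{(a,b'),0}}},\qquad U^\eta_{c,b}=\frac{\frac{\eta_b}{T_{(0,b),0}}T_{(0,b),c}}{\sum_{b'}\frac{\eta_{b'}}{T_{(0,b'),0}}T_{(0,b'),c}},\qquad a,b,c\in E_\kappa,$$ with the convention that $U^\gamma_{c,b}=0$ when $T_{(a,b),c}=0$ for all $a\in E_\kappa$. *)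

theory Defs
  imports "HOL-Probability.Probability" "Jordan_Normal_Form.Spectral_Radius"
begin

unbundle no vec_syntax and no inner_syntax

text \<open>
  The state set \<open>{0, ..., \<kappa>}\<close> is the set of naturals \<^term>\<open>{..\<kappa>}\<close>. A transition array is a
  function \<open>T\<close>, with \<open>T a b c\<close> the probability of \<open>c\<close> given the neighbourhood \<open>(a, b)\<close>; only
  its values on \<^term>\<open>{..\<kappa>}\<close> matter. Matrices and vectors indexed by states are those of
  Jordan_Normal_Form, of dimension \<open>\<kappa> + 1\<close> and indexed from 0.
\<close>

section \<open>Perron eigenvectors\<close>

definition primitive_mat :: "real mat \<Rightarrow> bool" where
  "primitive_mat A \<longleftrightarrow> square_mat A \<and>
     (\<forall>i<dim_row A. \<forall>j<dim_row A. A $$ (i,j) \<ge> 0) \<and>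
     (\<exists>k. \<forall>i<dim_row A. \<forall>j<dim_row A. (A ^\<^sub>m k) $$ (i,j) > 0)"

text \<open>The maximality ranges over all complex eigenvalues. The sign of \<open>r\<close> is forced once a
  positive eigenvector is required below.\<close>

definition perron_eigenvalue :: "real mat \<Rightarrow> real \<Rightarrow> bool" where
  "perron_eigenvalue A r \<longleftrightarrow> eigenvalue A r \<and>
     (\<forall>z. eigenvalue (map_mat complex_of_real A) z \<longrightarrow> cmod z \<le> \<bar>r\<bar>)"

definition pos_vec :: "real vec \<Rightarrow> bool" where
  "pos_vec v \<longleftrightarrow> (\<forall>i<dim_vec v. v $ i > 0)"

definition perron_right_eigenvector :: "real mat \<Rightarrow> real vec \<Rightarrow> bool" where
  "perron_right_eigenvector A v \<longleftrightarrow> primitive_mat A \<and> pos_vec v \<and>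
     (\<exists>r. perron_eigenvalue A r \<and> eigenvector A v r)"

definition perron_left_eigenvector :: "real mat \<Rightarrow> real vec \<Rightarrow> bool" where
  "perron_left_eigenvector A v \<longleftrightarrow> primitive_mat A \<and> pos_vec v \<and>
     (\<exists>r. perron_eigenvalue A r \<and> eigenvector (transpose_mat A) v r)"

definition stochastic_perron_left :: "real mat \<Rightarrow> real vec" where
  "stochastic_perron_left A =
     (THE v. perron_left_eigenvector A v \<and> (\<Sum>i<dim_vec v. v $ i) = 1)"


section \<open>Probability vectors and Markov kernels\<close>

definition prob_vec :: "nat \<Rightarrow> real vec \<Rightarrow> bool" where
  "prob_vec \<kappa> p \<longleftrightarrow> p \<in> carrier_vec (\<kappa> + 1) \<and> (\<forall>i\<le>\<kappa>. p $ i \<ge> 0) \<and> (\<Sum>i\<le>\<kappa>. p $ i) = 1"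

definition markov_kernel :: "nat \<Rightarrow> real mat \<Rightarrow> bool" where
  "markov_kernel \<kappa> K \<longleftrightarrow> K \<in> carrier_mat (\<kappa> + 1) (\<kappa> + 1) \<and>
     (\<forall>a\<le>\<kappa>. (\<forall>b\<le>\<kappa>. K $$ (a,b) \<ge> 0) \<and> (\<Sum>b\<le>\<kappa>. K $$ (a,b)) = 1)"

text \<open>The row vector equation \<open>p = p K\<close> is written with the transposed matrix.\<close>

definition invariant_prob :: "nat \<Rightarrow> real mat \<Rightarrow> real vec \<Rightarrow> bool" where
  "invariant_prob \<kappa> K p \<longleftrightarrow> prob_vec \<kappa> p \<and> transpose_mat K *\<^sub>v p = p"


section \<open>Probabilistic cellular automata on the horizontal zigzag\<close>

definition transition_matrix :: "nat \<Rightarrow> (nat \<Rightarrow> nat \<Rightarrow> nat \<Rightarrow> real) \<Rightarrow> bool" where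
  "transition_matrix \<kappa> T \<longleftrightarrow>
     (\<forall>a\<le>\<kappa>. \<forall>b\<le>\<kappa>. (\<forall>c\<le>\<kappa>. T a b c \<ge> 0) \<and> (\<Sum>c\<le>\<kappa>. T a b c) = 1)"

definition line_space :: "nat \<Rightarrow> (int \<Rightarrow> nat) measure" where
  "line_space \<kappa> = (\<Pi>\<^sub>M x\<in>UNIV. count_space {..\<kappa>})"

definition hz_space :: "nat \<Rightarrow> ((int \<Rightarrow> nat) \<times> (int \<Rightarrow> nat)) measure" where
  "hz_space \<kappa> = line_space \<kappa> \<Otimes>\<^sub>M line_space \<kappa>"

text \<open>The conditional law of the next line given the current line \<open>S\<close>; independence of the
  sites is the infinite product measure.\<close>

definition pca_kernel ::
    "nat \<Rightarrow> (nat \<Rightarrow> nat \<Rightarrow> nat \<Rightarrow> real) \<Rightarrow> (int \<Rightarrow> nat) \<Rightarrow> (int \<Rightarrow> nat) measure" where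
  "pca_kernel \<kappa> T S =
     (\<Pi>\<^sub>M x\<in>UNIV. point_measure {..\<kappa>} (\<lambda>c. ennreal (T (S x) (S (x + 1)) c)))"

text \<open>For \<open>(S0, S1)\<close> of law \<open>m\<close>, the law of \<open>(S1, S2)\<close>.\<close>

definition pca_image ::
    "nat \<Rightarrow> (nat \<Rightarrow> nat \<Rightarrow> nat \<Rightarrow> real) \<Rightarrow> ((int \<Rightarrow> nat) \<times> (int \<Rightarrow> nat)) measure
      \<Rightarrow> ((int \<Rightarrow> nat) \<times> (int \<Rightarrow> nat)) measure" where
  "pca_image \<kappa> T m =
     m \<bind> (\<lambda>(S0, S1). distr (pca_kernel \<kappa> T S1) (hz_space \<kappa>) (\<lambda>S2. (S1, S2)))"

definition pca_invariant ::
    "nat \<Rightarrow> (nat \<Rightarrow> nat \<Rightarrow> nat \<Rightarrow> real) \<Rightarrow> ((int \<Rightarrow> nat) \<times> (int \<Rightarrow> nat)) measure \<Rightarrow> bool" where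
  "pca_invariant \<kappa> T m \<longleftrightarrow> m \<in> space (prob_algebra (hz_space \<kappa>)) \<and> pca_image \<kappa> T m = m"

definition hzmc_law ::
    "nat \<Rightarrow> real mat \<Rightarrow> real mat \<Rightarrow> real vec
      \<Rightarrow> ((int \<Rightarrow> nat) \<times> (int \<Rightarrow> nat)) measure \<Rightarrow> bool" where
  "hzmc_law \<kappa> D U \<rho> m \<longleftrightarrow>
     markov_kernel \<kappa> D \<and> markov_kernel \<kappa> U \<and> invariant_prob \<kappa> (D * U) \<rho> \<and>
     m \<in> space (prob_algebra (hz_space \<kappa>)) \<and>
     (\<forall>i0 n a b. (\<forall>i\<le>n. a i \<le> \<kappa> \<and> b i \<le> \<kappa>) \<longrightarrow>
        measure m {(S0, S1) \<in> space m.
            \<forall>i\<le>n. S0 (i0 + int i) = a i \<and> S1 (i0 + int i) = b i}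
        = \<rho> $ a 0 * (\<Prod>i<n. D $$ (a i, b i) * U $$ (b i, a (i + 1))) * D $$ (a n, b n))"

definition admits_invariant_hzmc :: "nat \<Rightarrow> (nat \<Rightarrow> nat \<Rightarrow> nat \<Rightarrow> real) \<Rightarrow> bool" where
  "admits_invariant_hzmc \<kappa> T \<longleftrightarrow>
     (\<exists>D U \<rho> m. hzmc_law \<kappa> D U \<rho> m \<and> (\<forall>a\<le>\<kappa>. \<forall>b\<le>\<kappa>. (D * U) $$ (a,b) > 0) \<and>
        pca_invariant \<kappa> T m)"


section \<open>The objects built from the transition matrix\<close>

definition Y_mat :: "nat \<Rightarrow> (nat \<Rightarrow> nat \<Rightarrow> nat \<Rightarrow> real) \<Rightarrow> real mat" where
  "Y_mat \<kappa> T = mat (\<kappa> + 1) (\<kappa> + 1) (\<lambda>(i, j). T i i j)"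

definition nu_vec :: "nat \<Rightarrow> (nat \<Rightarrow> nat \<Rightarrow> nat \<Rightarrow> real) \<Rightarrow> real vec" where
  "nu_vec \<kappa> T = stochastic_perron_left (Y_mat \<kappa> T)"

definition X_mat :: "nat \<Rightarrow> (nat \<Rightarrow> nat \<Rightarrow> nat \<Rightarrow> real) \<Rightarrow> real mat" where
  "X_mat \<kappa> T = mat (\<kappa> + 1) (\<kappa> + 1) (\<lambda>(d, a). T a a 0 * nu_vec \<kappa> T $ a / T a d 0)"

definition gamma_vec :: "nat \<Rightarrow> (nat \<Rightarrow> nat \<Rightarrow> nat \<Rightarrow> real) \<Rightarrow> real vec" where
  "gamma_vec \<kappa> T = stochastic_perron_left (X_mat \<kappa> T)"

definition D_mat :: "nat \<Rightarrow> (nat \<Rightarrow> nat \<Rightarrow> nat \<Rightarrow> real) \<Rightarrow> real vec \<Rightarrow> real mat" where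
  "D_mat \<kappa> T \<eta> = mat (\<kappa> + 1) (\<kappa> + 1) (\<lambda>(a, c).
     (\<Sum>l\<le>\<kappa>. \<eta> $ l / T a l 0 * T a l c) / (\<Sum>b'\<le>\<kappa>. \<eta> $ b' / T a b' 0))"

definition U_mat :: "nat \<Rightarrow> (nat \<Rightarrow> nat \<Rightarrow> nat \<Rightarrow> real) \<Rightarrow> real vec \<Rightarrow> real mat" where
  "U_mat \<kappa> T \<eta> = mat (\<kappa> + 1) (\<kappa> + 1) (\<lambda>(c, b).
     if \<forall>a\<le>\<kappa>. T a b c = 0 then 0
     else (\<eta> $ b / T 0 b 0 * T 0 b c) / (\<Sum>b'\<le>\<kappa>. \<eta> $ b' / T 0 b' 0 * T 0 b' c))"

definition rho_of :: "nat \<Rightarrow> real vec \<Rightarrow> real vec \<Rightarrow> real vec" where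
  "rho_of \<kappa> \<gamma> \<mu> = vec (\<kappa> + 1) (\<lambda>i. \<gamma> $ i * \<mu> $ i)"

definition mu_vec :: "nat \<Rightarrow> (nat \<Rightarrow> nat \<Rightarrow> nat \<Rightarrow> real) \<Rightarrow> real vec" where
  "mu_vec \<kappa> T = (THE \<mu>. perron_right_eigenvector (X_mat \<kappa> T) \<mu> \<and>
     prob_vec \<kappa> (rho_of \<kappa> (gamma_vec \<kappa> T) \<mu>))"

definition product_condition :: "nat \<Rightarrow> (nat \<Rightarrow> nat \<Rightarrow> nat \<Rightarrow> real) \<Rightarrow> bool" where
  "product_condition \<kappa> T \<longleftrightarrow> (\<forall>a\<le>\<kappa>. \<forall>b\<le>\<kappa>. \<forall>c\<le>\<kappa>.
     T a b c = (T 0 0 0 * T a b 0 * T a 0 c * T 0 b c) / (T a 0 0 * T 0 b 0 * T 0 0 c))"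

end

(*
Comparing the probability of the three cells S1(0) = a, S1(1) = b, S2(0) = c under a (D,U)-HZMC law
with its probability after one step gives rho_a D_ac U_cb = (rho D)_a (UD)_ab T_(a,b),c. Summing over
c and then over b yields rho = rho D and DU = UD, so T_(a,b),c = D_ac U_cb / (DU)_ab. This product
form implies condition (1), and it forces D, U to be the kernels built from eta = (U_0b)_b; moreover
the diagonal of DU is proportional to nu and eta is a left eigenvector of X, so eta = gamma.

Conversely, under (1) the kernels built from gamma satisfy T_(a,b),c = D_ac U_cb / (DU)_ab with
(DU)_ab = gamma_b / (T_(a,b),0 Z_a), and the eigenvector equations of X say that rho is invariant
under DU. When D and U commute, rho is also invariant under D and U, the law of a line S1 is that of
the DU = UD chain started from rho, and the image law has the cylinder probabilities of the
(D,U)-HZMC. Since the diagonal of DU is proportional to nu = nu Y, the matrices DU and UD always have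
the same diagonal, hence agree when there are two states.
*)

theory Submission
  imports Defs
begin

section \<open>Positive eigenvectors of nonnegative matrices\<close>

text \<open>The vectors \<nu>, \<gamma> and \<mu> are definite descriptions, so existence and
  uniqueness of positive eigenvectors must come first. State 0 serves as a hub:
  \<open>T a a 0\<close> and \<open>T 0 0 c\<close> are positive, which makes the square of Y
  entrywise positive, and the other matrices involved have positive squares too. Perron theory for
  exponent 2 therefore suffices. The matrix X arises by elimination. From D_a0 U_0d = (DU)_ad
  T_(a,d),0, taken once with d = a, one gets (DU)_ad = (DU)_aa T_(a,a),0 U_0d / (U_0a T_(a,d),0).
  Since row a of DU sums to 1 and (DU)_aa is proportional to \<nu>_a, this says exactly that row 0
  of U is a left eigenvector of X. A zigzag chain is specified only by finite-dimensional
  probabilities, so a two-sided process with these probabilities has to be constructed. Because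
  \<rho> is invariant under both D and U, the zigzag is a single chain with alternating kernels and
  constant one-time law \<rho>, extended to negative times by time reversal.\<close>

lemma compact_box_nat:
  fixes n :: nat
  shows "compact {x :: nat \<Rightarrow> real. \<forall>i. x i \<in> (if i \<le> n then {0..1} else {0})}"
proof -
  have eq: "{x :: nat \<Rightarrow> real. \<forall>i. x i \<in> (if i \<le> n then {0..1} else {0})}
      = Pi\<^sub>E UNIV (\<lambda>i. if i \<le> n then {0..1} else {0})"
    by (auto simp: PiE_def Pi_def simp del: atLeastAtMost_iff)
  have "compactin (product_topology (\<lambda>i. euclidean) UNIV)
      (Pi\<^sub>E UNIV (\<lambda>i::nat. if i \<le> n then {0..1::real} else {0}))"
    by (subst compactin_PiE) auto
  then show ?thesis
    unfolding eq by (simp add: euclidean_product_topology)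
qed

text \<open>The Collatz-Wielandt condition r x \<le> x A on a probability row vector x. The largest
  feasible r is the Perron eigenvalue, and a maximizing x will be the eigenvector.\<close>

definition subinvariant_vec :: "nat \<Rightarrow> (nat \<Rightarrow> nat \<Rightarrow> real) \<Rightarrow> real \<Rightarrow> (nat \<Rightarrow> real) \<Rightarrow> bool" where
  "subinvariant_vec n A r x \<longleftrightarrow> r \<ge> 0 \<and> (\<forall>i\<le>n. x i \<ge> 0) \<and> (\<Sum>i\<le>n. x i) = 1 \<and>
     (\<forall>j\<le>n. r * x j \<le> (\<Sum>i\<le>n. x i * A i j))"

lemma max_subinvariant:
  fixes A :: "nat \<Rightarrow> nat \<Rightarrow> real"
  assumes nn: "\<And>i j. i \<le> n \<Longrightarrow> j \<le> n \<Longrightarrow> A i j \<ge> 0"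
  shows "\<exists>r x. subinvariant_vec n A r x \<and> (\<forall>r' x'. subinvariant_vec n A r' x' \<longrightarrow> r' \<le> r)"
proof -
  define M where "M = (\<Sum>i\<le>n. \<Sum>j\<le>n. A i j)"
  \<comment> \<open>Only coordinates up to n matter. Pinning the others to 0 keeps this set of
    functions on all naturals compact in the product topology.\<close>
  define K where "K = {x :: nat \<Rightarrow> real. \<forall>i. x i \<in> (if i \<le> n then {0..1} else {0})}"
  define S where "S = ({0..M} \<times> K) \<inter> {p. (\<Sum>i\<le>n. snd p i) = 1} \<inter>
    (\<Inter>j\<in>{..n}. {p. fst p * snd p j \<le> (\<Sum>i\<le>n. snd p i * A i j)})"
  have cc[continuous_intros]: "continuous_on UNIV (\<lambda>p :: real \<times> (nat \<Rightarrow> real). snd p i)" for i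
    by (rule continuous_on_product_then_coordinatewise) (intro continuous_intros)
  have "compact S"
    unfolding S_def
  proof (intro compact_Int_closed)
    show "compact ({0..M} \<times> K)"
      unfolding K_def by (intro compact_Times compact_box_nat) auto
    show "closed {p::real \<times> (nat \<Rightarrow> real). (\<Sum>i\<le>n. snd p i) = 1}"
      by (intro closed_Collect_eq continuous_intros)
    show "closed (\<Inter>j\<in>{..n}. {p. fst p * snd p j \<le> (\<Sum>i\<le>n. snd p i * A i j)})"
      by (intro closed_INT ballI closed_Collect_le continuous_intros)
  qed
  \<comment> \<open>The value r = 0 is feasible for any probability vector since A is nonnegative; a
    point mass is the simplest choice.\<close>
  moreover have "(0, \<lambda>i. if i = 0 then 1 else 0) \<in> S"
    unfolding S_def K_def M_def using nn by (auto intro!: sum_nonneg)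
  then have "S \<noteq> {}" by auto
  ultimately obtain p where p: "p \<in> S" "\<And>q. q \<in> S \<Longrightarrow> fst q \<le> fst p"
    using continuous_attains_sup[of S fst] continuous_on_fst[OF continuous_on_id, of S] by blast
  have "subinvariant_vec n A (fst p) (snd p)"
    unfolding subinvariant_vec_def
  proof (intro conjI allI impI)
    show "0 \<le> snd p i" if "i \<le> n" for i
    proof -
      have "snd p i \<in> (if i \<le> n then {0..1} else {0})"
        using p(1) unfolding S_def K_def by (auto simp del: atLeastAtMost_iff split del: if_split)
      then show ?thesis using that by auto
    qed
  qed (use p(1) in \<open>auto simp: S_def\<close>)
  moreover have "r' \<le> fst p" if "subinvariant_vec n A r' x'" for r' x'
  proof -
    have r': "r' \<ge> 0" and x': "\<And>i. i \<le> n \<Longrightarrow> x' i \<ge> 0" "(\<Sum>i\<le>n. x' i) = 1"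
      and le: "\<And>j. j \<le> n \<Longrightarrow> r' * x' j \<le> (\<Sum>i\<le>n. x' i * A i j)"
      using that by (auto simp: subinvariant_vec_def)
    have le1: "x' i \<le> 1" if "i \<le> n" for i
    proof -
      have "x' i \<le> (\<Sum>i\<le>n. x' i)" using x'(1) that by (intro member_le_sum) auto
      then show ?thesis using x'(2) by simp
    qed
    define x2 where "x2 i = (if i \<le> n then x' i else 0)" for i
    have [simp]: "(\<Sum>i\<le>n. x2 i) = (\<Sum>i\<le>n. x' i)"
      "\<And>j. (\<Sum>i\<le>n. x2 i * A i j) = (\<Sum>i\<le>n. x' i * A i j)"
      by (intro sum.cong; simp add: x2_def)+
    \<comment> \<open>Summing the inequalities over j, with all entries of x' at most 1, bounds r'
      by the total mass of A. This is why the cap M on r loses nothing.\<close>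
    have "r' = r' * (\<Sum>j\<le>n. x' j)" using x'(2) by simp
    also have "\<dots> = (\<Sum>j\<le>n. r' * x' j)" by (rule sum_distrib_left)
    also have "\<dots> \<le> (\<Sum>j\<le>n. \<Sum>i\<le>n. x' i * A i j)"
      by (intro sum_mono le) auto
    also have "\<dots> \<le> (\<Sum>j\<le>n. \<Sum>i\<le>n. A i j)"
      by (intro sum_mono mult_left_le_one_le) (use x'(1) nn le1 in auto)
    also have "\<dots> = M" unfolding M_def by (rule sum.swap)
    finally have "r' \<le> M" .
    moreover have "x2 \<in> K" unfolding K_def using x'(1) le1 by (auto simp: x2_def)
    moreover have "\<forall>j\<in>{..n}. r' * x2 j \<le> (\<Sum>i\<le>n. x2 i * A i j)" using le by (simp add: x2_def[of j for j])
    ultimately have "(r', x2) \<in> S"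
      unfolding S_def using r' x'(2) by auto
    then show ?thesis using p(2)[of "(r', x2)"] by simp
  qed
  ultimately show ?thesis by blast
qed

text \<open>At a maximal pair (r, x) no slack can remain: multiplying by the positive matrix A^2
  would spread slack in a single coordinate to all coordinates and leave room to increase r.
  Positivity of x then follows from x A^2 = r^2 x.\<close>

lemma pos_left_eigenvector_exists:
  fixes A :: "nat \<Rightarrow> nat \<Rightarrow> real"
  assumes nn: "\<And>i j. i \<le> n \<Longrightarrow> j \<le> n \<Longrightarrow> A i j \<ge> 0"
    and pos: "\<And>i j. i \<le> n \<Longrightarrow> j \<le> n \<Longrightarrow> (\<Sum>l\<le>n. A i l * A l j) > 0"
  shows "\<exists>r v. (\<forall>i\<le>n. v i > 0) \<and> (\<Sum>i\<le>n. v i) = 1 \<and> (\<forall>j\<le>n. (\<Sum>i\<le>n. v i * A i j) = r * v j)"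
proof -
  define B where "B i j = (\<Sum>l\<le>n. A i l * A l j)" for i j
  define P where "P x j = (\<Sum>i\<le>n. x i * A i j)" for x :: "nat \<Rightarrow> real" and j
  define Q where "Q x j = (\<Sum>i\<le>n. x i * B i j)" for x :: "nat \<Rightarrow> real" and j
  have PP: "P (P x) j = Q x j" for x j
  proof -
    have "P (P x) j = (\<Sum>l\<le>n. \<Sum>i\<le>n. x i * A i l * A l j)"
      unfolding P_def by (simp add: sum_distrib_right)
    also have "\<dots> = (\<Sum>i\<le>n. \<Sum>l\<le>n. x i * A i l * A l j)" by (rule sum.swap)
    also have "\<dots> = Q x j"
      unfolding Q_def B_def by (simp add: sum_distrib_left mult.assoc)
    finally show ?thesis .
  qed
  have Qpos: "Q x j > 0" if "\<And>i. i \<le> n \<Longrightarrow> x i \<ge> 0" "k \<le> n" "x k > 0" "j \<le> n" for x j k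
  proof -
    have "0 < x k * B k j" using that pos by (simp add: B_def)
    moreover have "0 \<le> x i * B i j" if "i \<le> n" for i
      using \<open>i \<le> n\<close> that(1) \<open>j \<le> n\<close> pos[of i j] \<open>\<And>i. i \<le> n \<Longrightarrow> x i \<ge> 0\<close> by (simp add: B_def less_imp_le)
    ultimately show ?thesis
      unfolding Q_def using \<open>k \<le> n\<close> by (intro sum_pos2[of _ k]) auto
  qed
  obtain r x where sub: "subinvariant_vec n A r x"
    and mx: "\<And>r' x'. subinvariant_vec n A r' x' \<Longrightarrow> r' \<le> r"
    using max_subinvariant[of n A, OF nn] by blast
  have rx: "r \<ge> 0" "\<And>i. i \<le> n \<Longrightarrow> x i \<ge> 0" "(\<Sum>i\<le>n. x i) = 1"
    "\<And>j. j \<le> n \<Longrightarrow> r * x j \<le> P x j"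
    using sub by (auto simp: subinvariant_vec_def P_def)
  have "\<exists>k\<in>{..n}. x k \<noteq> 0"
    using rx(3) by (metis sum.neutral zero_neq_one)
  then obtain k where k: "k \<le> n" "x k > 0"
    using rx(2) by (metis atMost_iff less_eq_real_def)
  define y where "y j = P x j - r * x j" for j
  have eq: "P x j = r * x j" if "j \<le> n" for j
  proof (rule ccontr)
    assume "P x j \<noteq> r * x j"
    then have yj: "y j > 0" using rx(4)[OF that] by (simp add: y_def)
    have y0: "y i \<ge> 0" if "i \<le> n" for i using rx(4)[OF that] by (simp add: y_def)
    define z where "z = Q x"
    have z: "z i > 0" if "i \<le> n" for i
      unfolding z_def using rx(2) k that by (intro Qpos[of x k i]) auto
    have Qy: "Q y i > 0" if "i \<le> n" for i
      using y0 yj \<open>j \<le> n\<close> that by (intro Qpos[of y j i]) auto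
    have Plin: "P (\<lambda>i. f i - c * g i) i = P f i - c * P g i" for f g c i
      unfolding P_def by (simp add: sum_subtractf sum_distrib_left algebra_simps)
    \<comment> \<open>Multiplication by A commutes with multiplication by A^2, so the slack of z = x
      A^2 is the image under A^2 of the slack y of x.\<close>
    have Pz: "P z i - r * z i = Q y i" for i
    proof -
      have 1: "P y = (\<lambda>i. P (P x) i - r * P x i)" unfolding y_def[abs_def] using Plin by auto
      have "Q y i = P (P (P x)) i - r * P (P x) i" unfolding PP[symmetric] 1 Plin ..
      moreover have "P (P x) = z" using PP[of x] unfolding z_def by auto
      ultimately show ?thesis by simp
    qed
    \<comment> \<open>The slack of z is strictly positive everywhere, so the smallest ratio of slack
      to entry is a uniform amount by which r can grow.\<close>
    define e where "e = Min ((\<lambda>i. Q y i / z i) ` {..n})"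
    have e: "e > 0" unfolding e_def using Qy z by (subst Min_gr_iff) auto
    have ez: "e * z i \<le> Q y i" if "i \<le> n" for i
    proof -
      have "e \<le> Q y i / z i" unfolding e_def using that by (intro Min_le) auto
      then show ?thesis using z[OF that] by (simp add: field_simps)
    qed
    define s where "s = (\<Sum>i\<le>n. z i)"
    have s: "s > 0" unfolding s_def using z by (intro sum_pos) auto
    have "subinvariant_vec n A (r + e) (\<lambda>i. z i / s)"
      unfolding subinvariant_vec_def
    proof (intro conjI allI impI)
      show "(\<Sum>i\<le>n. z i / s) = 1" using s by (simp add: s_def flip: sum_divide_distrib)
      show "0 \<le> r + e" using rx(1) e by simp
      show "0 \<le> z i / s" if "i \<le> n" for i using z[OF that] s by simp
      fix j assume j: "j \<le> n"
      have "(r + e) * z j \<le> P z j" using ez[OF j] Pz[of j] by (simp add: algebra_simps)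
      then have "(r + e) * z j / s \<le> P z j / s" using s by (intro divide_right_mono) auto
      also have "P z j / s = (\<Sum>i\<le>n. z i / s * A i j)" unfolding P_def by (simp add: sum_divide_distrib)
      finally show "(r + e) * (z j / s) \<le> (\<Sum>i\<le>n. z i / s * A i j)" by simp
    qed
    then have "r + e \<le> r" by (rule mx)
    then show False using e by simp
  qed
  have Qx: "Q x j = r * r * x j" if "j \<le> n" for j
  proof -
    have "P (P x) j = P (\<lambda>i. r * x i) j" unfolding P_def[of "P x"] P_def[of "\<lambda>i. r * x i"]
      by (intro sum.cong) (auto simp: eq)
    also have "\<dots> = r * P x j" unfolding P_def by (simp add: sum_distrib_left mult.assoc)
    finally show ?thesis using eq[OF that] PP by simp
  qed
  have "x i > 0" if "i \<le> n" for i
  proof -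
    have "Q x i > 0" using rx(2) k that by (intro Qpos[of x k i]) auto
    then show ?thesis using rx(2)[OF that] Qx[OF that] by (cases "x i = 0") auto
  qed
  then show ?thesis using rx(3) eq unfolding P_def by blast
qed

text \<open>Subtract from one eigenvector the largest multiple of the other that keeps the
  difference nonnegative. At an index where the two touch, the positive matrix A^2 turns the
  difference into a comparison of squared eigenvalues; if the eigenvalues agree, positivity of A^2
  makes the difference vanish.\<close>

lemma pos_left_eigenvector_unique:
  fixes A :: "nat \<Rightarrow> nat \<Rightarrow> real"
  assumes nn: "\<And>i j. i \<le> n \<Longrightarrow> j \<le> n \<Longrightarrow> A i j \<ge> 0"
    and pos: "\<And>i j. i \<le> n \<Longrightarrow> j \<le> n \<Longrightarrow> (\<Sum>l\<le>n. A i l * A l j) > 0"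
    and v: "\<And>i. i \<le> n \<Longrightarrow> v i > 0" "\<And>j. j \<le> n \<Longrightarrow> (\<Sum>i\<le>n. v i * A i j) = r * v j"
    and w: "\<And>i. i \<le> n \<Longrightarrow> w i \<ge> 0" "\<And>j. j \<le> n \<Longrightarrow> (\<Sum>i\<le>n. w i * A i j) = s * w j"
    and sums: "(\<Sum>i\<le>n. v i) = 1" "(\<Sum>i\<le>n. w i) = 1"
    and i: "i \<le> n"
  shows "v i = w i"
proof -
  define B where "B i j = (\<Sum>l\<le>n. A i l * A l j)" for i j
  have Bpos: "B i j > 0" if "i \<le> n" "j \<le> n" for i j
    using pos that by (simp add: B_def)
  then have Bnn: "B i j \<ge> 0" if "i \<le> n" "j \<le> n" for i j
    using that by (simp add: less_imp_le)
  have Q: "(\<Sum>i\<le>n. x i * B i j) = t * t * x j"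
    if "\<And>j. j \<le> n \<Longrightarrow> (\<Sum>i\<le>n. x i * A i j) = t * x j" "j \<le> n" for x t j
  proof -
    have "(\<Sum>i\<le>n. x i * B i j) = (\<Sum>i\<le>n. \<Sum>l\<le>n. x i * A i l * A l j)"
      unfolding B_def by (simp add: sum_distrib_left mult.assoc)
    also have "\<dots> = (\<Sum>l\<le>n. (\<Sum>i\<le>n. x i * A i l) * A l j)"
      by (subst sum.swap) (simp add: sum_distrib_right)
    also have "\<dots> = (\<Sum>l\<le>n. t * (x l * A l j))" using that by (intro sum.cong) auto
    also have "\<dots> = t * t * x j" using that by (simp flip: sum_distrib_left)
    finally show ?thesis .
  qed
  \<comment> \<open>The comparison below only sees squares of eigenvalues, so their signs are fixed
    beforehand by summing the eigenvector equation.\<close>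
  have sgn: "t \<ge> 0" if "\<And>j. j \<le> n \<Longrightarrow> (\<Sum>i\<le>n. x i * A i j) = t * x j" "\<And>i. i \<le> n \<Longrightarrow> x i \<ge> 0"
      "(\<Sum>i\<le>n. x i) = 1" for x t
  proof -
    have "t = t * (\<Sum>j\<le>n. x j)" using that(3) by simp
    also have "\<dots> = (\<Sum>j\<le>n. t * x j)" by (rule sum_distrib_left)
    also have "\<dots> = (\<Sum>j\<le>n. \<Sum>i\<le>n. x i * A i j)" using that(1) by (intro sum.cong) auto
    also have "\<dots> \<ge> 0" using that(2) nn by (intro sum_nonneg mult_nonneg_nonneg) auto
    finally show ?thesis .
  qed
  \<comment> \<open>A zero entry of w would make the whole sum in that column of w A^2 vanish, which
    a positive column allows only for w = 0.\<close>
  have wpos: "w j > 0" if j: "j \<le> n" for j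
  proof (rule ccontr)
    assume "\<not> w j > 0"
    then have "w j = 0" using w(1)[OF j] by simp
    then have "(\<Sum>i\<le>n. w i * B i j) = 0" using Q[OF w(2) j] by simp
    then have "\<forall>i\<in>{..n}. w i * B i j = 0"
      by (subst (asm) sum_nonneg_eq_0_iff)
        (use w(1) Bnn[OF _ j] in auto)
    then have "\<forall>i\<le>n. w i = 0" using Bpos[OF _ j] by fastforce
    then show False using sums(2) by simp
  qed
  have main: "t \<le> u \<and> (u = t \<longrightarrow> (\<exists>c. \<forall>i\<le>n. x i = c * y i))"
    if x: "\<And>i. i \<le> n \<Longrightarrow> x i > 0" "\<And>j. j \<le> n \<Longrightarrow> (\<Sum>i\<le>n. x i * A i j) = u * x j" and u: "u \<ge> 0"
    and y: "\<And>i. i \<le> n \<Longrightarrow> y i > 0" "\<And>j. j \<le> n \<Longrightarrow> (\<Sum>i\<le>n. y i * A i j) = t * y j" and t: "t \<ge> 0"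
    for x y t u
  proof -
    define c where "c = Min ((\<lambda>i. x i / y i) ` {..n})"
    have "c \<in> (\<lambda>i. x i / y i) ` {..n}" unfolding c_def by (intro Min_in) auto
    then obtain k where k: "k \<le> n" "c = x k / y k" by auto
    have ck: "x k = c * y k" using k y(1)[of k] by (simp add: field_simps)
    have c: "c > 0" using k x(1) y(1) by simp
    have le: "c * y i \<le> x i" if "i \<le> n" for i
    proof -
      have "c \<le> x i / y i" unfolding c_def using that by (intro Min_le) auto
      then show ?thesis using y(1)[OF that] by (simp add: field_simps)
    qed
    \<comment> \<open>At the touching index k one has c y_k = x_k, so both eigenvector equations
      contribute multiples of the same number x_k.\<close>
    have eq: "(\<Sum>i\<le>n. (x i - c * y i) * B i k) = (u * u - t * t) * x k"
    proof -
      have "(\<Sum>i\<le>n. (x i - c * y i) * B i k) = (\<Sum>i\<le>n. x i * B i k) - c * (\<Sum>i\<le>n. y i * B i k)"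
        by (simp add: algebra_simps sum_subtractf sum_distrib_left)
      also have "\<dots> = (u * u - t * t) * x k"
        using Q[OF x(2) k(1)] Q[OF y(2) k(1)] ck by (simp add: algebra_simps)
      finally show ?thesis .
    qed
    have ge: "(\<Sum>i\<le>n. (x i - c * y i) * B i k) \<ge> 0"
      using le Bnn[OF _ k(1)] by (intro sum_nonneg mult_nonneg_nonneg) auto
    then have "u * u - t * t \<ge> 0" using eq x(1)[OF k(1)] by (simp add: zero_le_mult_iff)
    then have "t \<le> u" using u by (intro power2_le_imp_le[OF _ u]) (simp add: power2_eq_square)
    moreover have "\<exists>c. \<forall>i\<le>n. x i = c * y i" if "u = t"
    proof -
      have "(\<Sum>i\<le>n. (x i - c * y i) * B i k) = 0" using eq that by simp
      then have "\<forall>i\<in>{..n}. (x i - c * y i) * B i k = 0"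
        by (subst (asm) sum_nonneg_eq_0_iff)
          (use le Bnn[OF _ k(1)] in auto)
      then have "\<forall>i\<le>n. x i = c * y i" using Bpos[OF _ k(1)] by fastforce
      then show ?thesis by blast
    qed
    ultimately show ?thesis by blast
  qed
  have rs: "r \<ge> 0" "s \<ge> 0" using sgn[of v r] sgn[of w s] v w sums by (simp_all add: less_imp_le)
  have "s \<le> r" "r \<le> s" using main[OF v rs(1) wpos w(2) rs(2)] main[OF wpos w(2) rs(2) v rs(1)] by auto
  then obtain c where c: "\<forall>i\<le>n. v i = c * w i"
    using main[OF v rs(1) wpos w(2) rs(2)] by auto
  have "1 = (\<Sum>i\<le>n. c * w i)" unfolding sums(1)[symmetric] using c by (intro sum.cong) auto
  also have "\<dots> = c * (\<Sum>i\<le>n. w i)" by (rule sum_distrib_left[symmetric])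
  finally have "c = 1" using sums(2) by simp
  then show ?thesis using c i by simp
qed

section \<open>Perron eigenvectors of matrices with entrywise positive square\<close>

lemma index_mult_mat_sum:
  assumes "A \<in> carrier_mat (n + 1) (n + 1)" "B \<in> carrier_mat (n + 1) (n + 1)" "i \<le> n" "j \<le> n"
  shows "(A * B) $$ (i, j) = (\<Sum>l\<le>n. A $$ (i, l) * B $$ (l, j))"
  using assms by (auto simp: scalar_prod_def atLeast0LessThan lessThan_Suc_atMost intro!: sum.cong)

lemma index_mult_mat_vec_sum:
  assumes "A \<in> carrier_mat (n + 1) (n + 1)" "v \<in> carrier_vec (n + 1)" "i \<le> n"
  shows "(A *\<^sub>v v) $ i = (\<Sum>l\<le>n. A $$ (i, l) * v $ l)"
  using assms by (auto simp: scalar_prod_def atLeast0LessThan lessThan_Suc_atMost intro!: sum.cong)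

lemma eq_vec_atMost:
  assumes "v \<in> carrier_vec (n + 1)" "w \<in> carrier_vec (n + 1)" "\<And>i. i \<le> n \<Longrightarrow> v $ i = w $ i"
  shows "v = w"
  using assms by (intro eq_vecI) auto

lemma eigenvector_iff_sum:
  assumes A: "A \<in> carrier_mat (n + 1) (n + 1)"
  shows "eigenvector A v r \<longleftrightarrow> v \<in> carrier_vec (n + 1) \<and> (\<exists>i\<le>n. v $ i \<noteq> 0) \<and>
    (\<forall>i\<le>n. (\<Sum>j\<le>n. A $$ (i, j) * v $ j) = r * v $ i)" (is "?L \<longleftrightarrow> ?R")
proof -
  have 1: "v \<noteq> 0\<^sub>v (n + 1) \<longleftrightarrow> (\<exists>i\<le>n. v $ i \<noteq> 0)" if v: "v \<in> carrier_vec (n + 1)"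
  proof
    assume "v \<noteq> 0\<^sub>v (n + 1)"
    moreover have "v = 0\<^sub>v (n + 1)" if "\<forall>i\<le>n. v $ i = 0"
      using v that by (intro eq_vec_atMost[of _ n]) auto
    ultimately show "\<exists>i\<le>n. v $ i \<noteq> 0" by blast
  qed auto
  have 2: "A *\<^sub>v v = r \<cdot>\<^sub>v v \<longleftrightarrow> (\<forall>i\<le>n. (\<Sum>j\<le>n. A $$ (i, j) * v $ j) = r * v $ i)"
    if v: "v \<in> carrier_vec (n + 1)"
  proof
    assume "A *\<^sub>v v = r \<cdot>\<^sub>v v"
    then have "(A *\<^sub>v v) $ i = r * v $ i" if "i \<le> n" for i
      using v that by simp
    then show "\<forall>i\<le>n. (\<Sum>j\<le>n. A $$ (i, j) * v $ j) = r * v $ i"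
      using index_mult_mat_vec_sum[OF A v] by simp
  next
    assume "\<forall>i\<le>n. (\<Sum>j\<le>n. A $$ (i, j) * v $ j) = r * v $ i"
    then show "A *\<^sub>v v = r \<cdot>\<^sub>v v"
      using index_mult_mat_vec_sum[OF A v] v A by (intro eq_vec_atMost[of _ n]) auto
  qed
  show ?thesis
    using A 1 2 unfolding eigenvector_def by auto
qed

lemma eigenvector_transpose_iff_sum:
  assumes A: "A \<in> carrier_mat (n + 1) (n + 1)"
  shows "eigenvector (transpose_mat A) v r \<longleftrightarrow> v \<in> carrier_vec (n + 1) \<and> (\<exists>i\<le>n. v $ i \<noteq> 0) \<and>
    (\<forall>j\<le>n. (\<Sum>i\<le>n. v $ i * A $$ (i, j)) = r * v $ j)"
proof -
  have "(\<Sum>j\<le>n. transpose_mat A $$ (i, j) * v $ j) = (\<Sum>j\<le>n. v $ j * A $$ (j, i))" if "i \<le> n" for i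
    using A that by (intro sum.cong) auto
  then show ?thesis
    using A by (subst eigenvector_iff_sum[of _ n]) auto
qed

lemma eigenvalue_transpose:
  fixes A :: "'a :: field mat"
  assumes "A \<in> carrier_mat n n"
  shows "eigenvalue (transpose_mat A) r \<longleftrightarrow> eigenvalue A r"
  using assms by (simp add: eigenvalue_root_char_poly[of _ n])

lemma perron_eigenvalue_transpose:
  assumes A: "A \<in> carrier_mat n n"
  shows "perron_eigenvalue (transpose_mat A) r \<longleftrightarrow> perron_eigenvalue A r"
proof -
  have "map_mat complex_of_real (transpose_mat A) = transpose_mat (map_mat complex_of_real A)"
    using A by (intro eq_matI) auto
  then show ?thesis
    using A eigenvalue_transpose[of "map_mat complex_of_real A" n] eigenvalue_transpose[OF A]
    by (simp add: perron_eigenvalue_def)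
qed

text \<open>Primitivity with exponent 2, the form in which it holds for Y, X and the kernels that
  occur here. It feeds the two eigenvector lemmas on functions directly.\<close>

definition square_pos_mat :: "nat \<Rightarrow> real mat \<Rightarrow> bool" where
  "square_pos_mat n A \<longleftrightarrow> A \<in> carrier_mat (n + 1) (n + 1) \<and> (\<forall>i\<le>n. \<forall>j\<le>n. A $$ (i, j) \<ge> 0) \<and>
     (\<forall>i\<le>n. \<forall>j\<le>n. (\<Sum>l\<le>n. A $$ (i, l) * A $$ (l, j)) > 0)"

lemma square_pos_mat_transpose:
  assumes "square_pos_mat n A"
  shows "square_pos_mat n (transpose_mat A)"
proof -
  have A: "A \<in> carrier_mat (n + 1) (n + 1)" using assms by (simp add: square_pos_mat_def)
  have "(\<Sum>l\<le>n. transpose_mat A $$ (i, l) * transpose_mat A $$ (l, j)) = (\<Sum>l\<le>n. A $$ (j, l) * A $$ (l, i))"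
    if "i \<le> n" "j \<le> n" for i j
    using A that by (intro sum.cong) auto
  then show ?thesis using assms A by (auto simp: square_pos_mat_def)
qed

lemma square_pos_mat_primitive:
  assumes "square_pos_mat n A"
  shows "primitive_mat A"
proof -
  have A: "A \<in> carrier_mat (n + 1) (n + 1)" using assms by (simp add: square_pos_mat_def)
  have "A ^\<^sub>m 2 = A * A" using A by (simp add: numeral_2_eq_2)
  then have "(A ^\<^sub>m 2) $$ (i, j) > 0" if "i \<le> n" "j \<le> n" for i j
    using assms that index_mult_mat_sum[OF A A] by (simp add: square_pos_mat_def)
  then show ?thesis
    using assms A unfolding primitive_mat_def square_pos_mat_def
    by (intro conjI exI[of _ 2]) auto
qed

text \<open>Pair the positive left eigenvector with the entrywise moduli of an arbitrary complex
  right eigenvector: the triangle inequality gives |z| q \<le> r q with q > 0.\<close>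

lemma perron_eigenvalue_pos_left_eigenvector:
  assumes A: "square_pos_mat n A"
    and v: "v \<in> carrier_vec (n + 1)" "\<And>i. i \<le> n \<Longrightarrow> v $ i > 0"
      "\<And>j. j \<le> n \<Longrightarrow> (\<Sum>i\<le>n. v $ i * A $$ (i, j)) = r * v $ j"
  shows "perron_eigenvalue A r"
  unfolding perron_eigenvalue_def
proof (intro conjI allI impI)
  have Ac: "A \<in> carrier_mat (n + 1) (n + 1)" using A by (simp add: square_pos_mat_def)
  have "\<exists>i\<le>n. v $ i \<noteq> 0" using v(2)[of 0] by auto
  then have "eigenvector (transpose_mat A) v r"
    using v Ac by (subst eigenvector_transpose_iff_sum[of _ n]) auto
  then show "eigenvalue A r"
    using eigenvalue_transpose[OF Ac] unfolding eigenvalue_def by blast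
  fix z assume "eigenvalue (map_mat complex_of_real A) z"
  then obtain w where w: "eigenvector (map_mat complex_of_real A) w z"
    unfolding eigenvalue_def by blast
  have w0: "w \<in> carrier_vec (n + 1)" "\<exists>i\<le>n. w $ i \<noteq> 0"
    and w: "\<And>i. i \<le> n \<Longrightarrow> (\<Sum>j\<le>n. complex_of_real (A $$ (i, j)) * w $ j) = z * w $ i"
    using w Ac by (subst (asm) eigenvector_iff_sum[of _ n]; auto)+
  have le: "cmod z * cmod (w $ i) \<le> (\<Sum>j\<le>n. A $$ (i, j) * cmod (w $ j))" if "i \<le> n" for i
  proof -
    have "cmod z * cmod (w $ i) = cmod (\<Sum>j\<le>n. complex_of_real (A $$ (i, j)) * w $ j)"
      using w[OF that] by (simp add: norm_mult)
    also have "\<dots> \<le> (\<Sum>j\<le>n. cmod (complex_of_real (A $$ (i, j)) * w $ j))"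
      by (rule norm_sum)
    also have "\<dots> = (\<Sum>j\<le>n. A $$ (i, j) * cmod (w $ j))"
      using A that by (intro sum.cong) (auto simp: norm_mult square_pos_mat_def)
    finally show ?thesis .
  qed
  define q where "q = (\<Sum>i\<le>n. v $ i * cmod (w $ i))"
  obtain k where "k \<le> n" "w $ k \<noteq> 0" using w0 by blast
  then have q: "q > 0"
    unfolding q_def using v(2) by (intro sum_pos2[of _ k]) (auto simp: less_imp_le)
  have "cmod z * q = (\<Sum>i\<le>n. v $ i * (cmod z * cmod (w $ i)))"
    unfolding q_def by (simp add: sum_distrib_left mult_ac)
  also have "\<dots> \<le> (\<Sum>i\<le>n. v $ i * (\<Sum>j\<le>n. A $$ (i, j) * cmod (w $ j)))"
    using le v(2) by (intro sum_mono mult_left_mono) (auto simp: less_imp_le)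
  also have "\<dots> = (\<Sum>j\<le>n. (\<Sum>i\<le>n. v $ i * A $$ (i, j)) * cmod (w $ j))"
    unfolding sum_distrib_left sum_distrib_right by (subst sum.swap) (simp add: mult.assoc)
  also have "\<dots> = (\<Sum>j\<le>n. r * (v $ j * cmod (w $ j)))"
    using v(3) by (intro sum.cong) auto
  also have "\<dots> = r * q" unfolding q_def by (rule sum_distrib_left[symmetric])
  finally have "cmod z \<le> r" using q by simp
  then show "cmod z \<le> \<bar>r\<bar>" by simp
qed

text \<open>Maximality of the eigenvalue is automatic for a positive eigenvector, so only positivity
  and the linear equations remain to be checked.\<close>

lemma perron_left_eigenvector_iff:
  assumes A: "square_pos_mat n A"
  shows "perron_left_eigenvector A v \<longleftrightarrow> v \<in> carrier_vec (n + 1) \<and> (\<forall>i\<le>n. v $ i > 0) \<and>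
    (\<exists>r. \<forall>j\<le>n. (\<Sum>i\<le>n. v $ i * A $$ (i, j)) = r * v $ j)" (is "_ \<longleftrightarrow> ?R")
proof
  have Ac: "A \<in> carrier_mat (n + 1) (n + 1)" using A by (simp add: square_pos_mat_def)
  {
    assume "perron_left_eigenvector A v"
    then show ?R
      unfolding perron_left_eigenvector_def eigenvector_transpose_iff_sum[OF Ac] pos_vec_def by auto
  next
    assume R: ?R
    then obtain r where r: "\<And>j. j \<le> n \<Longrightarrow> (\<Sum>i\<le>n. v $ i * A $$ (i, j)) = r * v $ j" by blast
    have "perron_eigenvalue A r"
      using R r by (intro perron_eigenvalue_pos_left_eigenvector[OF A, of v]) auto
    moreover have "\<exists>i\<le>n. v $ i \<noteq> 0" using R by (intro exI[of _ 0]) auto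
    ultimately show "perron_left_eigenvector A v"
      unfolding perron_left_eigenvector_def eigenvector_transpose_iff_sum[OF Ac] pos_vec_def
      using R r square_pos_mat_primitive[OF A] by auto
  }
qed

lemma perron_right_eigenvector_iff:
  assumes A: "square_pos_mat n A"
  shows "perron_right_eigenvector A v \<longleftrightarrow> v \<in> carrier_vec (n + 1) \<and> (\<forall>i\<le>n. v $ i > 0) \<and>
    (\<exists>r. \<forall>i\<le>n. (\<Sum>j\<le>n. A $$ (i, j) * v $ j) = r * v $ i)"
proof -
  have Ac: "A \<in> carrier_mat (n + 1) (n + 1)" using A by (simp add: square_pos_mat_def)
  note At = square_pos_mat_transpose[OF A]
  have "perron_right_eigenvector A v \<longleftrightarrow> perron_left_eigenvector (transpose_mat A) v"
    unfolding perron_right_eigenvector_def perron_left_eigenvector_def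
    using square_pos_mat_primitive[OF A] square_pos_mat_primitive[OF At]
      perron_eigenvalue_transpose[OF Ac] by simp
  moreover have "(\<Sum>i\<le>n. v $ i * transpose_mat A $$ (i, j)) = (\<Sum>i\<le>n. A $$ (j, i) * v $ i)"
    if "j \<le> n" for j
    using Ac that by (intro sum.cong) auto
  ultimately show ?thesis
    unfolding perron_left_eigenvector_iff[OF At] by auto
qed

text \<open>This makes the definite description \<open>stochastic_perron_left\<close>
  meaningful.\<close>

lemma stochastic_perron_left_unique:
  assumes A: "square_pos_mat n A"
  shows "\<exists>!v. perron_left_eigenvector A v \<and> (\<Sum>i<dim_vec v. v $ i) = 1"
proof -
  have nn: "A $$ (i, j) \<ge> 0" and pos: "(\<Sum>l\<le>n. A $$ (i, l) * A $$ (l, j)) > 0"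
    if "i \<le> n" "j \<le> n" for i j
    using A that by (auto simp: square_pos_mat_def)
  have dim: "{..<dim_vec v} = {..n}" if "v \<in> carrier_vec (n + 1)" for v :: "real vec"
    using that by auto
  have "\<exists>r u. (\<forall>i\<le>n. u i > 0) \<and> (\<Sum>i\<le>n. u i) = 1 \<and> (\<forall>j\<le>n. (\<Sum>i\<le>n. u i * A $$ (i, j)) = r * u j)"
    by (intro pos_left_eigenvector_exists nn pos)
  then obtain r u where u: "\<forall>i\<le>n. u i > 0" "(\<Sum>i\<le>n. u i) = 1"
    "\<forall>j\<le>n. (\<Sum>i\<le>n. u i * A $$ (i, j)) = r * u j"
    by blast
  define v where "v = vec (n + 1) u"
  have vu: "v $ i = u i" if "i \<le> n" for i
    using that by (auto simp: v_def)
  have vc: "v \<in> carrier_vec (n + 1)" by (simp add: v_def)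
  have vsum: "(\<Sum>i\<le>n. v $ i) = 1" and veq: "(\<Sum>i\<le>n. v $ i * A $$ (i, j)) = r * v $ j"
    if "j \<le> n" for j
    using u(2,3) vu that by simp_all
  show ?thesis
  proof (rule ex1I[of _ v])
    show "perron_left_eigenvector A v \<and> (\<Sum>i<dim_vec v. v $ i) = 1"
      unfolding perron_left_eigenvector_iff[OF A] dim[OF vc] using vc vu u(1) vsum[of 0] veq by auto
    fix w assume w: "perron_left_eigenvector A w \<and> (\<Sum>i<dim_vec w. w $ i) = 1"
    then have wc: "w \<in> carrier_vec (n + 1)" and wpos: "\<And>i. i \<le> n \<Longrightarrow> w $ i > 0"
      unfolding perron_left_eigenvector_iff[OF A] by auto
    obtain s where weq: "\<And>j. j \<le> n \<Longrightarrow> (\<Sum>i\<le>n. w $ i * A $$ (i, j)) = s * w $ j"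
      using w unfolding perron_left_eigenvector_iff[OF A] by blast
    have "w $ i = v $ i" if "i \<le> n" for i
    proof (rule pos_left_eigenvector_unique[OF nn pos wpos weq _ veq _ _ that])
      show "0 \<le> v $ i" if "i \<le> n" for i using u(1) vu[OF that] that by (simp add: less_imp_le)
      show "(\<Sum>i\<le>n. w $ i) = 1" using w dim[OF wc] by simp
      show "(\<Sum>i\<le>n. v $ i) = 1" using vsum[of 0] by simp
    qed
    then show "w = v" by (intro eq_vec_atMost[OF wc vc])
  qed
qed

lemma stochastic_perron_left:
  assumes A: "square_pos_mat n A"
  shows "stochastic_perron_left A \<in> carrier_vec (n + 1)"
    and "i \<le> n \<Longrightarrow> stochastic_perron_left A $ i > 0"
    and "(\<Sum>i\<le>n. stochastic_perron_left A $ i) = 1"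
    and "\<exists>r. \<forall>j\<le>n. (\<Sum>i\<le>n. stochastic_perron_left A $ i * A $$ (i, j)) = r * stochastic_perron_left A $ j"
proof -
  let ?v = "stochastic_perron_left A"
  have *: "perron_left_eigenvector A ?v \<and> (\<Sum>i<dim_vec ?v. ?v $ i) = 1"
    unfolding stochastic_perron_left_def by (rule theI'[OF stochastic_perron_left_unique[OF A]])
  then show c: "?v \<in> carrier_vec (n + 1)" and "i \<le> n \<Longrightarrow> ?v $ i > 0"
    and "\<exists>r. \<forall>j\<le>n. (\<Sum>i\<le>n. ?v $ i * A $$ (i, j)) = r * ?v $ j"
    unfolding perron_left_eigenvector_iff[OF A] by auto
  have "{..<dim_vec ?v} = {..n}" using c by auto
  then show "(\<Sum>i\<le>n. ?v $ i) = 1" using * by simp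
qed

lemma stochastic_perron_left_eqI:
  assumes A: "square_pos_mat n A" and v: "v \<in> carrier_vec (n + 1)" "\<And>i. i \<le> n \<Longrightarrow> v $ i > 0"
    "(\<Sum>i\<le>n. v $ i) = 1" "\<And>j. j \<le> n \<Longrightarrow> (\<Sum>i\<le>n. v $ i * A $$ (i, j)) = r * v $ j"
  shows "stochastic_perron_left A = v"
proof -
  have "{..<dim_vec v} = {..n}" using v(1) by auto
  then have "perron_left_eigenvector A v \<and> (\<Sum>i<dim_vec v. v $ i) = 1"
    unfolding perron_left_eigenvector_iff[OF A] using v by auto
  then show ?thesis
    unfolding stochastic_perron_left_def by (intro the1_equality stochastic_perron_left_unique[OF A])
qed

section \<open>Invariant probabilities of kernels\<close>

text \<open>Positive right eigenvectors form a single ray, and pairing with the positive vector g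
  selects one point of it. With g = \<gamma> this justifies the description defining
  \<open>mu_vec\<close>.\<close>

lemma perron_right_normalized_unique:
  assumes A: "square_pos_mat n A" and g: "\<And>i. i \<le> n \<Longrightarrow> g $ i > 0"
  shows "\<exists>!\<mu>. perron_right_eigenvector A \<mu> \<and> prob_vec n (rho_of n g \<mu>)"
proof -
  note At = square_pos_mat_transpose[OF A]
  have Ac: "A \<in> carrier_mat (n + 1) (n + 1)" using A by (simp add: square_pos_mat_def)
  define v where "v = stochastic_perron_left (transpose_mat A)"
  have vc: "v \<in> carrier_vec (n + 1)" and vpos: "\<And>i. i \<le> n \<Longrightarrow> v $ i > 0"
    and "\<exists>r. \<forall>j\<le>n. (\<Sum>i\<le>n. v $ i * transpose_mat A $$ (i, j)) = r * v $ j"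
    using stochastic_perron_left[OF At] unfolding v_def by auto
  have tr: "(\<Sum>i\<le>n. x i * transpose_mat A $$ (i, j)) = (\<Sum>i\<le>n. A $$ (j, i) * x i)"
    if "j \<le> n" for x j
    using Ac that by (intro sum.cong) auto
  obtain r where r: "\<And>j. j \<le> n \<Longrightarrow> (\<Sum>i\<le>n. A $$ (j, i) * v $ i) = r * v $ j"
    using \<open>\<exists>r. _\<close> tr by auto
  define s where "s = (\<Sum>i\<le>n. g $ i * v $ i)"
  have s: "s > 0" unfolding s_def using g vpos by (intro sum_pos) auto
  define \<mu> where "\<mu> = vec (n + 1) (\<lambda>i. v $ i / s)"
  have \<mu>: "\<mu> $ i = v $ i / s" if "i \<le> n" for i using that by (simp add: \<mu>_def)
  have \<mu>c: "\<mu> \<in> carrier_vec (n + 1)" by (simp add: \<mu>_def)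
  show ?thesis
  proof (rule ex1I[of _ \<mu>])
    have "(\<Sum>j\<le>n. A $$ (i, j) * \<mu> $ j) = r * \<mu> $ i" if "i \<le> n" for i
      using r[OF that] \<mu> that by (simp flip: sum_divide_distrib)
    moreover have "(\<Sum>i\<le>n. rho_of n g \<mu> $ i) = 1"
      using s by (simp add: rho_of_def \<mu> flip: sum_divide_distrib s_def)
    ultimately show "perron_right_eigenvector A \<mu> \<and> prob_vec n (rho_of n g \<mu>)"
      unfolding perron_right_eigenvector_iff[OF A] prob_vec_def
      using \<mu>c \<mu> vpos g s by (auto simp: rho_of_def less_imp_le)
    fix \<mu>' assume \<mu>': "perron_right_eigenvector A \<mu>' \<and> prob_vec n (rho_of n g \<mu>')"
    then have c': "\<mu>' \<in> carrier_vec (n + 1)" and p': "\<And>i. i \<le> n \<Longrightarrow> \<mu>' $ i > 0"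
      and sum': "(\<Sum>i\<le>n. g $ i * \<mu>' $ i) = 1"
      unfolding perron_right_eigenvector_iff[OF A] prob_vec_def by (auto simp: rho_of_def)
    obtain r' where r': "\<And>i. i \<le> n \<Longrightarrow> (\<Sum>j\<le>n. A $$ (i, j) * \<mu>' $ j) = r' * \<mu>' $ i"
      using \<mu>' unfolding perron_right_eigenvector_iff[OF A] by blast
    \<comment> \<open>The competitor is rescaled to total mass 1 so that it can be identified with
      v; the two normalisations are then reciprocal, s t = 1.\<close>
    define t where "t = (\<Sum>i\<le>n. \<mu>' $ i)"
    have t: "t > 0" unfolding t_def using p' by (intro sum_pos) auto
    define u where "u = vec (n + 1) (\<lambda>i. \<mu>' $ i / t)"
    have u: "u $ i = \<mu>' $ i / t" if "i \<le> n" for i using that by (simp add: u_def)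
    have "v = u"
      unfolding v_def
    proof (rule stochastic_perron_left_eqI[OF At, where r = r'])
      show "u \<in> carrier_vec (n + 1)" by (simp add: u_def)
      show "u $ i > 0" if "i \<le> n" for i using u[OF that] p'[OF that] t by simp
      show "(\<Sum>i\<le>n. u $ i) = 1" using t u by (simp flip: sum_divide_distrib t_def)
      fix j assume j: "j \<le> n"
      have "(\<Sum>i\<le>n. u $ i * transpose_mat A $$ (i, j)) = (\<Sum>i\<le>n. A $$ (j, i) * \<mu>' $ i) / t"
        unfolding tr[OF j] sum_divide_distrib using u by (intro sum.cong) auto
      then show "(\<Sum>i\<le>n. u $ i * transpose_mat A $$ (i, j)) = r' * u $ j"
        using r'[OF j] u[OF j] by simp
    qed
    then have vu: "v $ i = \<mu>' $ i / t" if "i \<le> n" for i using u that by simp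
    have "s = (\<Sum>i\<le>n. g $ i * \<mu>' $ i) / t"
      unfolding s_def sum_divide_distrib using vu by (intro sum.cong) auto
    then have "s * t = 1" using sum' t by simp
    then have "\<mu>' $ i = \<mu> $ i" if "i \<le> n" for i
      using \<mu>[OF that] vu[OF that] s t by (simp add: field_simps)
    then show "\<mu>' = \<mu>" by (intro eq_vec_atMost[OF c' \<mu>c])
  qed
qed

lemma invariant_prob_iff_sum:
  assumes "K \<in> carrier_mat (n + 1) (n + 1)"
  shows "invariant_prob n K p \<longleftrightarrow> prob_vec n p \<and> (\<forall>j\<le>n. (\<Sum>i\<le>n. p $ i * K $$ (i, j)) = p $ j)"
proof (cases "prob_vec n p")
  case True
  then have p: "p \<in> carrier_vec (n + 1)" by (simp add: prob_vec_def)
  have Kt: "transpose_mat K \<in> carrier_mat (n + 1) (n + 1)" using assms by simp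
  have entry: "(transpose_mat K *\<^sub>v p) $ j = (\<Sum>i\<le>n. p $ i * K $$ (i, j))" if "j \<le> n" for j
    unfolding index_mult_mat_vec_sum[OF Kt p that] using assms that by (intro sum.cong) auto
  have c: "transpose_mat K *\<^sub>v p \<in> carrier_vec (n + 1)" using Kt p by (rule mult_mat_vec_carrier)
  have "transpose_mat K *\<^sub>v p = p \<longleftrightarrow> (\<forall>j\<le>n. (\<Sum>i\<le>n. p $ i * K $$ (i, j)) = p $ j)"
  proof
    assume *: "transpose_mat K *\<^sub>v p = p"
    show "\<forall>j\<le>n. (\<Sum>i\<le>n. p $ i * K $$ (i, j)) = p $ j"
    proof (intro allI impI)
      fix j assume "j \<le> n"
      from entry[OF this, symmetric] show "(\<Sum>i\<le>n. p $ i * K $$ (i, j)) = p $ j"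
        unfolding * .
    qed
  next
    assume *: "\<forall>j\<le>n. (\<Sum>i\<le>n. p $ i * K $$ (i, j)) = p $ j"
    show "transpose_mat K *\<^sub>v p = p"
    proof (rule eq_vec_atMost[OF c p])
      show "(transpose_mat K *\<^sub>v p) $ j = p $ j" if "j \<le> n" for j
        unfolding entry[OF that] using * that by blast
    qed
  qed
  then show ?thesis using True by (simp add: invariant_prob_def)
qed (simp add: invariant_prob_def)

lemma invariant_prob_unique:
  assumes K: "square_pos_mat n K" and \<rho>: "invariant_prob n K \<rho>" "\<And>i. i \<le> n \<Longrightarrow> \<rho> $ i > 0"
  shows "invariant_prob n K p \<longleftrightarrow> p = \<rho>"
proof
  assume p: "invariant_prob n K p"
  have Kc: "K \<in> carrier_mat (n + 1) (n + 1)" using K by (simp add: square_pos_mat_def)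
  note p = p[unfolded invariant_prob_iff_sum[OF Kc] prob_vec_def]
  note \<rho>' = \<rho>(1)[unfolded invariant_prob_iff_sum[OF Kc] prob_vec_def]
  have "\<rho> $ i = p $ i" if "i \<le> n" for i
  proof (rule pos_left_eigenvector_unique[of n "\<lambda>i j. K $$ (i, j)" "\<lambda>i. \<rho> $ i" 1 "\<lambda>i. p $ i" 1 i])
    show "K $$ (i, j) \<ge> 0" "(\<Sum>l\<le>n. K $$ (i, l) * K $$ (l, j)) > 0" if "i \<le> n" "j \<le> n" for i j
      using K that by (simp_all add: square_pos_mat_def)
    show "(\<Sum>i\<le>n. \<rho> $ i * K $$ (i, j)) = 1 * \<rho> $ j" "(\<Sum>i\<le>n. p $ i * K $$ (i, j)) = 1 * p $ j"
      if "j \<le> n" for j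
      using that p \<rho>' by simp_all
  qed (use that p \<rho>' \<rho>(2) in auto)
  then show "p = \<rho>" using p \<rho>' by (intro eq_vec_atMost[of _ n]) auto
qed (use \<rho> in simp)

text \<open>Since D commutes with DU, the vector \<rho>D is again an invariant probability of DU,
  hence equals \<rho> by uniqueness. Exchanging the roles of the two factors gives the same for
  U.\<close>

lemma invariant_prob_commuting:
  assumes D: "D \<in> carrier_mat (n + 1) (n + 1)" "markov_kernel n D" and U: "U \<in> carrier_mat (n + 1) (n + 1)"
    and comm: "D * U = U * D" and pos: "square_pos_mat n (D * U)"
    and \<rho>: "invariant_prob n (D * U) \<rho>" "\<And>i. i \<le> n \<Longrightarrow> \<rho> $ i > 0"
  shows "invariant_prob n D \<rho>"
proof -
  define K where "K = D * U"
  have Kc: "K \<in> carrier_mat (n + 1) (n + 1)" using D U by (simp add: K_def)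
  have p: "\<rho> \<in> carrier_vec (n + 1)" "prob_vec n \<rho>" using \<rho>(1) by (auto simp: invariant_prob_def prob_vec_def)
  define p where "p = transpose_mat D *\<^sub>v \<rho>"
  have pc: "p \<in> carrier_vec (n + 1)" using D p by (simp add: p_def)
  have pj: "p $ j = (\<Sum>i\<le>n. \<rho> $ i * D $$ (i, j))" if "j \<le> n" for j
    unfolding p_def using D p that
    by (subst index_mult_mat_vec_sum[of _ n]) (auto intro!: sum.cong)
  have "transpose_mat K *\<^sub>v p = transpose_mat (D * K) *\<^sub>v \<rho>"
    unfolding p_def using D Kc p
    by (simp add: transpose_mult[OF D(1) Kc] assoc_mult_mat_vec[of _ "n + 1" "n + 1" _ "n + 1"])
  also have "D * K = K * D"
    unfolding K_def using D U by (subst comm, simp add: assoc_mult_mat[of _ "n + 1" "n + 1" _ "n + 1" _ "n + 1"])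
  also have "transpose_mat (K * D) *\<^sub>v \<rho> = transpose_mat D *\<^sub>v (transpose_mat K *\<^sub>v \<rho>)"
    using D Kc p by (simp add: transpose_mult[OF Kc D(1)] assoc_mult_mat_vec[of _ "n + 1" "n + 1" _ "n + 1"])
  also have "transpose_mat K *\<^sub>v \<rho> = \<rho>" using \<rho>(1) by (simp add: invariant_prob_def K_def)
  finally have Kp: "transpose_mat K *\<^sub>v p = p" by (simp add: p_def)
  have "(\<Sum>j\<le>n. p $ j) = (\<Sum>j\<le>n. \<Sum>i\<le>n. \<rho> $ i * D $$ (i, j))" using pj by (intro sum.cong) auto
  also have "\<dots> = (\<Sum>i\<le>n. \<rho> $ i * (\<Sum>j\<le>n. D $$ (i, j)))"
    by (subst sum.swap) (simp add: sum_distrib_left)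
  also have "\<dots> = 1" using D(2) p by (simp add: markov_kernel_def prob_vec_def)
  finally have "(\<Sum>j\<le>n. p $ j) = 1" .
  moreover have "p $ j \<ge> 0" if "j \<le> n" for j
    unfolding pj[OF that] using D(2) \<rho>(2) that
    by (intro sum_nonneg mult_nonneg_nonneg) (auto simp: markov_kernel_def less_imp_le)
  ultimately have "invariant_prob n K p"
    using pc Kp by (simp add: invariant_prob_def prob_vec_def)
  then have "p = \<rho>" using invariant_prob_unique[OF pos \<rho>] by (simp add: K_def)
  then show ?thesis using p by (simp add: invariant_prob_def p_def)
qed

section \<open>The kernels built from a transition matrix\<close>

locale positive_pca =
  fixes \<kappa> :: nat and T :: "nat \<Rightarrow> nat \<Rightarrow> nat \<Rightarrow> real"
  assumes T: "transition_matrix \<kappa> T"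
    and T0: "a \<le> \<kappa> \<Longrightarrow> b \<le> \<kappa> \<Longrightarrow> T a b 0 > 0"
    and T00: "c \<le> \<kappa> \<Longrightarrow> T 0 0 c > 0"
begin

abbreviation "\<nu> \<equiv> nu_vec \<kappa> T"
abbreviation "\<gamma> \<equiv> gamma_vec \<kappa> T"
abbreviation "\<mu> \<equiv> mu_vec \<kappa> T"
abbreviation "D\<gamma> \<equiv> D_mat \<kappa> T \<gamma>"
abbreviation "U\<gamma> \<equiv> U_mat \<kappa> T \<gamma>"
abbreviation "\<rho> \<equiv> rho_of \<kappa> \<gamma> \<mu>"

lemma T_nonneg: "a \<le> \<kappa> \<Longrightarrow> b \<le> \<kappa> \<Longrightarrow> c \<le> \<kappa> \<Longrightarrow> T a b c \<ge> 0"
  and T_sum: "a \<le> \<kappa> \<Longrightarrow> b \<le> \<kappa> \<Longrightarrow> (\<Sum>c\<le>\<kappa>. T a b c) = 1"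
  using T by (auto simp: transition_matrix_def)

text \<open>The two-step path from i to j through state 0 has weight
  \<open>T i i 0 * T 0 0 j\<close>, and each positivity assumption supplies one of its
  factors.\<close>

lemma square_pos_Y: "square_pos_mat \<kappa> (Y_mat \<kappa> T)"
  unfolding square_pos_mat_def
proof (intro conjI allI impI)
  fix i j assume ij: "i \<le> \<kappa>" "j \<le> \<kappa>"
  have "(\<Sum>l\<le>\<kappa>. T i i l * T l l j) > 0"
    using ij T0 T00 T_nonneg by (intro sum_pos2[of _ 0]) auto
  then show "(\<Sum>l\<le>\<kappa>. Y_mat \<kappa> T $$ (i, l) * Y_mat \<kappa> T $$ (l, j)) > 0"
    using ij by (simp add: Y_mat_def)
  show "Y_mat \<kappa> T $$ (i, j) \<ge> 0" using ij T_nonneg by (simp add: Y_mat_def)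
qed (simp add: Y_mat_def)

lemma nu_pos: "i \<le> \<kappa> \<Longrightarrow> \<nu> $ i > 0"
  and nu_sum: "(\<Sum>i\<le>\<kappa>. \<nu> $ i) = 1"
  using stochastic_perron_left[OF square_pos_Y] by (simp_all add: nu_vec_def)

text \<open>Y is stochastic, so summing the eigenvector equation over j forces the eigenvalue to be
  1.\<close>

lemma nu_invariant:
  assumes "j \<le> \<kappa>"
  shows "(\<Sum>i\<le>\<kappa>. \<nu> $ i * T i i j) = \<nu> $ j"
proof -
  obtain r where "\<And>j. j \<le> \<kappa> \<Longrightarrow> (\<Sum>i\<le>\<kappa>. \<nu> $ i * Y_mat \<kappa> T $$ (i, j)) = r * \<nu> $ j"
    using stochastic_perron_left(4)[OF square_pos_Y] unfolding nu_vec_def by blast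
  then have r: "(\<Sum>i\<le>\<kappa>. \<nu> $ i * T i i j) = r * \<nu> $ j" if "j \<le> \<kappa>" for j
    using that by (simp add: Y_mat_def)
  have "r = r * (\<Sum>j\<le>\<kappa>. \<nu> $ j)" by (simp add: nu_sum)
  also have "\<dots> = (\<Sum>j\<le>\<kappa>. \<Sum>i\<le>\<kappa>. \<nu> $ i * T i i j)"
    unfolding sum_distrib_left using r by (intro sum.cong) auto
  also have "\<dots> = (\<Sum>i\<le>\<kappa>. \<nu> $ i * (\<Sum>j\<le>\<kappa>. T i i j))"
    by (subst sum.swap) (simp add: sum_distrib_left)
  also have "\<dots> = 1" by (simp add: T_sum nu_sum)
  finally show ?thesis using r[OF assms] by simp
qed

lemma nu_eqI:
  assumes "v \<in> carrier_vec (\<kappa> + 1)" "\<And>i. i \<le> \<kappa> \<Longrightarrow> v $ i > 0" "(\<Sum>i\<le>\<kappa>. v $ i) = 1"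
    "\<And>j. j \<le> \<kappa> \<Longrightarrow> (\<Sum>i\<le>\<kappa>. v $ i * T i i j) = v $ j"
  shows "\<nu> = v"
  unfolding nu_vec_def
  by (rule stochastic_perron_left_eqI[OF square_pos_Y, of v 1]) (use assms in \<open>auto simp: Y_mat_def\<close>)

lemma X_entry: "d \<le> \<kappa> \<Longrightarrow> a \<le> \<kappa> \<Longrightarrow> X_mat \<kappa> T $$ (d, a) = T a a 0 * \<nu> $ a / T a d 0"
  by (simp add: X_mat_def)

lemma X_pos: "d \<le> \<kappa> \<Longrightarrow> a \<le> \<kappa> \<Longrightarrow> X_mat \<kappa> T $$ (d, a) > 0"
  by (simp add: X_entry T0 nu_pos)

lemma square_pos_X: "square_pos_mat \<kappa> (X_mat \<kappa> T)"
  unfolding square_pos_mat_def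
  by (intro conjI allI impI sum_pos mult_pos_pos) (auto simp: X_pos less_imp_le, simp add: X_mat_def)

lemma gamma_pos: "i \<le> \<kappa> \<Longrightarrow> \<gamma> $ i > 0"
  using stochastic_perron_left(2)[OF square_pos_X] by (simp add: gamma_vec_def)

text \<open>The eigenvalue r stays free because the Perron eigenvalue of X is not known in
  advance.\<close>

lemma gamma_eqI:
  assumes "v \<in> carrier_vec (\<kappa> + 1)" "\<And>i. i \<le> \<kappa> \<Longrightarrow> v $ i > 0" "(\<Sum>i\<le>\<kappa>. v $ i) = 1"
    "\<And>a. a \<le> \<kappa> \<Longrightarrow> (\<Sum>d\<le>\<kappa>. v $ d * (T a a 0 * \<nu> $ a / T a d 0)) = r * v $ a"
  shows "\<gamma> = v"
  unfolding gamma_vec_def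
  by (rule stochastic_perron_left_eqI[OF square_pos_X, of v r]) (use assms in \<open>auto simp: X_entry\<close>)

text \<open>The denominator in row a of \<open>D\<gamma>\<close>. The same sum occurs in the product
  of \<gamma> with column a of X, which links the kernel to the eigenvector equation.\<close>

definition Z :: "nat \<Rightarrow> real" where
  "Z a = (\<Sum>l\<le>\<kappa>. \<gamma> $ l / T a l 0)"

lemma Z_pos: "a \<le> \<kappa> \<Longrightarrow> Z a > 0"
  unfolding Z_def using gamma_pos T0 by (intro sum_pos divide_pos_pos) auto

lemma gamma_eigenvector:
  obtains r where "r > 0" "\<And>a. a \<le> \<kappa> \<Longrightarrow> T a a 0 * \<nu> $ a * Z a = r * \<gamma> $ a"
proof -
  obtain r where r: "\<And>a. a \<le> \<kappa> \<Longrightarrow> (\<Sum>d\<le>\<kappa>. \<gamma> $ d * X_mat \<kappa> T $$ (d, a)) = r * \<gamma> $ a"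
    using stochastic_perron_left(4)[OF square_pos_X] unfolding gamma_vec_def by blast
  have eq: "T a a 0 * \<nu> $ a * Z a = r * \<gamma> $ a" if "a \<le> \<kappa>" for a
    using r[OF that] that by (simp add: X_entry Z_def sum_distrib_left mult_ac)
  have "r * \<gamma> $ 0 > 0" using T0[of 0 0] nu_pos[of 0] Z_pos[of 0] by (simp flip: eq)
  then have "r > 0" using gamma_pos[of 0] by (simp add: zero_less_mult_iff)
  then show ?thesis using that eq by blast
qed

lemma mu_perron: "perron_right_eigenvector (X_mat \<kappa> T) \<mu>"
  and rho_prob: "prob_vec \<kappa> \<rho>"
proof -
  have "perron_right_eigenvector (X_mat \<kappa> T) \<mu> \<and> prob_vec \<kappa> \<rho>"
    unfolding mu_vec_def by (rule theI'[OF perron_right_normalized_unique[OF square_pos_X gamma_pos]])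
  then show "perron_right_eigenvector (X_mat \<kappa> T) \<mu>" "prob_vec \<kappa> \<rho>" by auto
qed

lemma mu_pos: "i \<le> \<kappa> \<Longrightarrow> \<mu> $ i > 0"
  using mu_perron unfolding perron_right_eigenvector_iff[OF square_pos_X] by blast

lemma rho_pos: "i \<le> \<kappa> \<Longrightarrow> \<rho> $ i > 0"
  using mu_pos gamma_pos by (simp add: rho_of_def)

lemma D_carrier: "D_mat \<kappa> T \<eta> \<in> carrier_mat (\<kappa> + 1) (\<kappa> + 1)"
  and U_carrier: "U_mat \<kappa> T \<eta> \<in> carrier_mat (\<kappa> + 1) (\<kappa> + 1)"
  by (simp_all add: D_mat_def U_mat_def)

lemma U_mat_entry:
  "c \<le> \<kappa> \<Longrightarrow> b \<le> \<kappa> \<Longrightarrow> U_mat \<kappa> T \<eta> $$ (c, b) =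
    (if \<forall>a\<le>\<kappa>. T a b c = 0 then 0
     else (\<eta> $ b / T 0 b 0 * T 0 b c) / (\<Sum>b'\<le>\<kappa>. \<eta> $ b' / T 0 b' 0 * T 0 b' c))"
  by (simp add: U_mat_def)

lemma eq_mat_atMost:
  assumes "A \<in> carrier_mat (\<kappa> + 1) (\<kappa> + 1)" "B \<in> carrier_mat (\<kappa> + 1) (\<kappa> + 1)"
    "\<And>i j. i \<le> \<kappa> \<Longrightarrow> j \<le> \<kappa> \<Longrightarrow> A $$ (i, j) = B $$ (i, j)"
  shows "A = B"
  using assms by (intro eq_matI) auto

text \<open>A commuting pair of kernels that reproduces \<open>T\<close> determines \<open>\<eta>\<close> as row \<open>0\<close> of \<open>U\<close>, and the
  diagonal of \<open>D U\<close> is proportional to \<open>\<nu>\<close>.\<close>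

lemma kernels_determined:
  assumes D: "markov_kernel \<kappa> D" and U: "markov_kernel \<kappa> U"
    and pos: "\<And>a b. a \<le> \<kappa> \<Longrightarrow> b \<le> \<kappa> \<Longrightarrow> (D * U) $$ (a, b) > 0" and comm: "D * U = U * D"
    and eq: "\<And>a b c. a \<le> \<kappa> \<Longrightarrow> b \<le> \<kappa> \<Longrightarrow> c \<le> \<kappa> \<Longrightarrow> D $$ (a, c) * U $$ (c, b) = (D * U) $$ (a, b) * T a b c"
  shows "product_condition \<kappa> T \<and> D\<gamma> = D \<and> U\<gamma> = U"
proof -
  have Dc: "D \<in> carrier_mat (\<kappa> + 1) (\<kappa> + 1)" and Uc: "U \<in> carrier_mat (\<kappa> + 1) (\<kappa> + 1)"
    and nn: "\<And>a b. a \<le> \<kappa> \<Longrightarrow> b \<le> \<kappa> \<Longrightarrow> D $$ (a, b) \<ge> 0" "\<And>a b. a \<le> \<kappa> \<Longrightarrow> b \<le> \<kappa> \<Longrightarrow> U $$ (a, b) \<ge> 0"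
    and row: "\<And>a. a \<le> \<kappa> \<Longrightarrow> (\<Sum>b\<le>\<kappa>. D $$ (a, b)) = 1" "\<And>a. a \<le> \<kappa> \<Longrightarrow> (\<Sum>b\<le>\<kappa>. U $$ (a, b)) = 1"
    using D U by (auto simp: markov_kernel_def)
  define d where "d a c = D $$ (a, c)" for a c
  define u where "u c b = U $$ (c, b)" for c b
  define q where "q a b = (D * U) $$ (a, b)" for a b
  have q: "q a b > 0" if "a \<le> \<kappa>" "b \<le> \<kappa>" for a b using pos that by (simp add: q_def)
  have T_eq: "T a b c = d a c * u c b / q a b" if "a \<le> \<kappa>" "b \<le> \<kappa>" "c \<le> \<kappa>" for a b c
    using eq[OF that] q[OF that(1,2)] by (simp add: d_def u_def q_def[symmetric])
  \<comment> \<open>The positive entry \<open>T a a 0\<close> is a product of D_a0 and U_0a divided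
    by a positive number, so neither factor vanishes. The entries \<open>T 0 0 c\<close> treat row 0
    of D and column 0 of U in the same way.\<close>
  have d0: "d a 0 > 0" and u0: "u 0 a > 0" if "a \<le> \<kappa>" for a
  proof -
    have "d a 0 * u 0 a > 0"
      using T0[OF that that] q[OF that that] that unfolding T_eq[OF that that le0] by (simp add: zero_less_divide_iff)
    moreover have "d a 0 \<ge> 0" "u 0 a \<ge> 0" using nn that by (auto simp: d_def u_def)
    ultimately show "d a 0 > 0" "u 0 a > 0" by (auto simp: zero_less_mult_iff)
  qed
  have d0c: "d 0 c > 0" and uc0: "u c 0 > 0" if "c \<le> \<kappa>" for c
  proof -
    have "d 0 c * u c 0 > 0"
      using T00[OF that] q[of 0 0] that unfolding T_eq[OF le0 le0 that] by (simp add: zero_less_divide_iff)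
    moreover have "d 0 c \<ge> 0" "u c 0 \<ge> 0" using nn that by (auto simp: d_def u_def)
    ultimately show "d 0 c > 0" "u c 0 > 0" by (auto simp: zero_less_mult_iff)
  qed
  have "product_condition \<kappa> T"
    unfolding product_condition_def
  proof (intro allI impI)
    fix a b c assume le: "a \<le> \<kappa>" "b \<le> \<kappa>" "c \<le> \<kappa>"
    have nz: "d a 0 \<noteq> 0" "u 0 b \<noteq> 0" "d 0 0 \<noteq> 0" "u 0 0 \<noteq> 0" "d 0 c \<noteq> 0" "u c 0 \<noteq> 0"
      "q 0 0 \<noteq> 0" "q a b \<noteq> 0" "q a 0 \<noteq> 0" "q 0 b \<noteq> 0"
      using d0[of a] u0[of b] d0[of 0] u0[of 0] d0c[of c] uc0[of c] q[of 0 0] q[of a b] q[of a 0] q[of 0 b] le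
      by auto
    \<comment> \<open>After inserting the product form, every entry of D, U and DU on the right
      cancels except D_ac, U_cb and (DU)_ab.\<close>
    show "T a b c = T 0 0 0 * T a b 0 * T a 0 c * T 0 b c / (T a 0 0 * T 0 b 0 * T 0 0 c)"
      using le nz by (simp add: T_eq)
  qed
  define \<eta> where "\<eta> = vec (\<kappa> + 1) (u 0)"
  have \<eta>: "\<eta> $ b = u 0 b" if "b \<le> \<kappa>" for b using that by (simp add: \<eta>_def)
  define t where "t = (\<Sum>i\<le>\<kappa>. q i i)"
  have t: "t > 0" unfolding t_def using q by (intro sum_pos) auto
  \<comment> \<open>Since q_ii T_(i,i),j = D_ij U_ji, summing over i gives the diagonal of UD, which
    commutation turns back into that of DU.\<close>
  have "\<nu> = vec (\<kappa> + 1) (\<lambda>i. q i i / t)"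
  proof (rule nu_eqI)
    fix j assume j: "j \<le> \<kappa>"
    have "(\<Sum>i\<le>\<kappa>. vec (\<kappa> + 1) (\<lambda>i. q i i / t) $ i * T i i j) = (\<Sum>i\<le>\<kappa>. u j i * d i j / t)"
    proof (intro sum.cong refl)
      fix i assume "i \<in> {..\<kappa>}"
      then show "vec (\<kappa> + 1) (\<lambda>i. q i i / t) $ i * T i i j = u j i * d i j / t"
        using j q[of i i] by (simp add: T_eq)
    qed
    also have "\<dots> = q j j / t"
      unfolding q_def comm index_mult_mat_sum[OF Uc Dc j j] by (simp add: u_def d_def sum_divide_distrib)
    finally show "(\<Sum>i\<le>\<kappa>. vec (\<kappa> + 1) (\<lambda>i. q i i / t) $ i * T i i j) = vec (\<kappa> + 1) (\<lambda>i. q i i / t) $ j"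
      using j by simp
  next
    show "(\<Sum>i\<le>\<kappa>. vec (\<kappa> + 1) (\<lambda>i. q i i / t) $ i) = 1"
      using t by (simp flip: sum_divide_distrib t_def)
  qed (use q t in auto)
  then have \<nu>: "\<nu> $ i = q i i / t" if "i \<le> \<kappa>" for i using that by simp
  have q_row: "(\<Sum>b\<le>\<kappa>. q a b) = 1" if "a \<le> \<kappa>" for a
  proof -
    have "(\<Sum>b\<le>\<kappa>. q a b) = (\<Sum>b\<le>\<kappa>. \<Sum>c\<le>\<kappa>. d a c * u c b)"
      unfolding q_def d_def u_def using that by (intro sum.cong index_mult_mat_sum[OF Dc Uc]) auto
    also have "\<dots> = (\<Sum>c\<le>\<kappa>. d a c * (\<Sum>b\<le>\<kappa>. u c b))"
      by (subst sum.swap) (simp add: sum_distrib_left)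
    also have "\<dots> = 1" using row that by (simp add: d_def u_def)
    finally show ?thesis .
  qed
  \<comment> \<open>Each term of the product of \<eta> with column a of X reduces to (U_0a / t)
    (DU)_ae. Row a of DU sums to 1, so the eigenvalue is 1 / t, with t the trace of DU.\<close>
  have \<gamma>: "\<gamma> = \<eta>"
  proof (rule gamma_eqI[where r = "1 / t"])
    show "(\<Sum>i\<le>\<kappa>. \<eta> $ i) = 1" using row(2)[of 0] by (simp add: \<eta> u_def)
    fix a assume a: "a \<le> \<kappa>"
    have "(\<Sum>d\<le>\<kappa>. \<eta> $ d * (T a a 0 * \<nu> $ a / T a d 0)) = (\<Sum>d\<le>\<kappa>. u 0 a / t * q a d)"
    proof (intro sum.cong refl)
      fix e assume "e \<in> {..\<kappa>}"
      then show "\<eta> $ e * (T a a 0 * \<nu> $ a / T a e 0) = u 0 a / t * q a e"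
        using a q[of a a] q[of a e] d0[of a] u0[of e] t by (simp add: \<eta> \<nu> T_eq)
    qed
    also have "\<dots> = u 0 a / t" by (simp only: sum_distrib_left[symmetric] q_row[OF a] mult_1_right)
    finally show "(\<Sum>d\<le>\<kappa>. \<eta> $ d * (T a a 0 * \<nu> $ a / T a d 0)) = 1 / t * \<eta> $ a"
      using a by (simp add: \<eta>)
  qed (use u0 in \<open>auto simp: \<eta>_def\<close>)
  \<comment> \<open>The dependence on l of each term is only through U_cl, so the stochastic row c
    of U sums it away.\<close>
  have sumD: "(\<Sum>l\<le>\<kappa>. \<eta> $ l / T a l 0 * T a l c) = d a c / d a 0" if ac: "a \<le> \<kappa>" "c \<le> \<kappa>" for a c
  proof -
    have "\<eta> $ l / T a l 0 * T a l c = d a c / d a 0 * u c l" if "l \<le> \<kappa>" for l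
      using ac that q[of a l] d0[of a] u0[of l] by (simp add: \<eta> T_eq)
    then have "(\<Sum>l\<le>\<kappa>. \<eta> $ l / T a l 0 * T a l c) = (\<Sum>l\<le>\<kappa>. d a c / d a 0 * u c l)"
      by (intro sum.cong) auto
    also have "\<dots> = d a c / d a 0"
      using row(2)[OF ac(2)] by (simp only: sum_distrib_left[symmetric] u_def mult_1_right)
    finally show ?thesis .
  qed
  have sumZ: "(\<Sum>l\<le>\<kappa>. \<eta> $ l / T a l 0) = 1 / d a 0" if a: "a \<le> \<kappa>" for a
  proof -
    have "\<eta> $ l / T a l 0 = 1 / d a 0 * q a l" if "l \<le> \<kappa>" for l
      using a that q[of a l] d0[of a] u0[of l] by (simp add: \<eta> T_eq)
    then have "(\<Sum>l\<le>\<kappa>. \<eta> $ l / T a l 0) = (\<Sum>l\<le>\<kappa>. 1 / d a 0 * q a l)"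
      by (intro sum.cong) auto
    also have "\<dots> = 1 / d a 0" by (simp only: sum_distrib_left[symmetric] q_row[OF a] mult_1_right)
    finally show ?thesis .
  qed
  have "D_mat \<kappa> T \<eta> = D"
  proof (rule eq_mat_atMost[OF D_carrier Dc])
    fix a c assume ac: "a \<le> \<kappa>" "c \<le> \<kappa>"
    then show "D_mat \<kappa> T \<eta> $$ (a, c) = D $$ (a, c)"
      using sumD[OF ac] sumZ[OF ac(1)] d0[OF ac(1)] by (simp add: D_mat_def d_def)
  qed
  moreover have "U_mat \<kappa> T \<eta> = U"
  proof (rule eq_mat_atMost[OF U_carrier Uc])
    fix c b assume cb: "c \<le> \<kappa>" "b \<le> \<kappa>"
    have 1: "\<eta> $ b / T 0 b 0 * T 0 b c = d 0 c / d 0 0 * u c b"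
      using cb q[of 0 b] d0[of 0] u0[of b] by (simp add: \<eta> T_eq)
    \<comment> \<open>The convention in the definition of U is consistent: a vanishing T_(0,b),c
      forces U_cb = 0 because D_0c > 0.\<close>
    have 2: "u c b = 0" if "\<forall>a\<le>\<kappa>. T a b c = 0"
      using that[rule_format, of 0] T_eq[of 0 b c] cb q[of 0 b] d0c[of c] by simp
    have 3: "(\<Sum>b'\<le>\<kappa>. \<eta> $ b' / T 0 b' 0 * T 0 b' c) = d 0 c / d 0 0" using sumD[of 0 c] cb by simp
    have "U_mat \<kappa> T \<eta> $$ (c, b) =
        (if \<forall>a\<le>\<kappa>. T a b c = 0 then 0 else (d 0 c / d 0 0 * u c b) / (d 0 c / d 0 0))"
      using U_mat_entry[OF cb, of \<eta>] unfolding 1 3 .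
    also have "\<dots> = u c b" using 2 d0c[OF cb(1)] d0[of 0] by auto
    finally show "U_mat \<kappa> T \<eta> $$ (c, b) = U $$ (c, b)" by (simp add: u_def)
  qed
  ultimately show ?thesis using \<open>product_condition \<kappa> T\<close> \<gamma> by simp
qed

section \<open>Stochasticity and positivity of the kernels built from \<gamma>\<close>

lemma D_row_sum: "a \<le> \<kappa> \<Longrightarrow> (\<Sum>c\<le>\<kappa>. D\<gamma> $$ (a, c)) = 1"
proof -
  assume a: "a \<le> \<kappa>"
  have "(\<Sum>c\<le>\<kappa>. D\<gamma> $$ (a, c)) = (\<Sum>c\<le>\<kappa>. \<Sum>l\<le>\<kappa>. \<gamma> $ l / T a l 0 * T a l c) / Z a"
    using a by (simp add: D_mat_def Z_def sum_divide_distrib)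
  also have "(\<Sum>c\<le>\<kappa>. \<Sum>l\<le>\<kappa>. \<gamma> $ l / T a l 0 * T a l c) = (\<Sum>l\<le>\<kappa>. \<gamma> $ l / T a l 0 * (\<Sum>c\<le>\<kappa>. T a l c))"
    by (subst sum.swap) (simp add: sum_distrib_left)
  also have "\<dots> = Z a" using a by (simp add: T_sum Z_def)
  finally show ?thesis using Z_pos[OF a] by simp
qed

lemma D_nonneg: "a \<le> \<kappa> \<Longrightarrow> c \<le> \<kappa> \<Longrightarrow> D\<gamma> $$ (a, c) \<ge> 0"
  using T_nonneg T0 gamma_pos Z_pos[of a]
  by (simp add: D_mat_def Z_def[symmetric])
    (intro divide_nonneg_nonneg sum_nonneg mult_nonneg_nonneg; simp add: less_imp_le)

lemma markov_D: "markov_kernel \<kappa> D\<gamma>"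
  using D_row_sum D_nonneg D_carrier by (simp add: markov_kernel_def)

lemma D_positive:
  shows "a \<le> \<kappa> \<Longrightarrow> D\<gamma> $$ (a, 0) > 0" and "c \<le> \<kappa> \<Longrightarrow> D\<gamma> $$ (0, c) > 0"
proof -
  have pos: "D\<gamma> $$ (a, c) > 0" if "a \<le> \<kappa>" "c \<le> \<kappa>" "k \<le> \<kappa>" "T a k c > 0" for a c k
  proof -
    have "(\<Sum>l\<le>\<kappa>. \<gamma> $ l / T a l 0 * T a l c) > 0"
    proof (rule sum_pos2[of _ k])
      show "0 < \<gamma> $ k / T a k 0 * T a k c" using that gamma_pos T0 by simp
      show "0 \<le> \<gamma> $ l / T a l 0 * T a l c" if "l \<in> {..\<kappa>}" for l
        using that \<open>a \<le> \<kappa>\<close> \<open>c \<le> \<kappa>\<close> gamma_pos[of l] T0[of a l] T_nonneg[of a l c] by simp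
    qed (use that in auto)
    then show ?thesis using that Z_pos[of a] by (simp add: D_mat_def Z_def[symmetric])
  qed
  show "a \<le> \<kappa> \<Longrightarrow> D\<gamma> $$ (a, 0) > 0" using pos[of a 0 0] T0[of a 0] by simp
  show "c \<le> \<kappa> \<Longrightarrow> D\<gamma> $$ (0, c) > 0" using pos[of 0 c 0] T00[of c] by simp
qed

text \<open>A positive row 0 and column 0 provide a positive two-step path between any two states
  through state 0, even if other entries vanish.\<close>

lemma square_pos_mat_cross:
  assumes "K \<in> carrier_mat (\<kappa> + 1) (\<kappa> + 1)" "\<And>i j. i \<le> \<kappa> \<Longrightarrow> j \<le> \<kappa> \<Longrightarrow> K $$ (i, j) \<ge> 0"
    "\<And>i. i \<le> \<kappa> \<Longrightarrow> K $$ (i, 0) > 0" "\<And>j. j \<le> \<kappa> \<Longrightarrow> K $$ (0, j) > 0"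
  shows "square_pos_mat \<kappa> K"
  unfolding square_pos_mat_def
proof (intro conjI allI impI)
  fix i j assume ij: "i \<le> \<kappa>" "j \<le> \<kappa>"
  show "(\<Sum>l\<le>\<kappa>. K $$ (i, l) * K $$ (l, j)) > 0"
    using ij assms by (intro sum_pos2[of _ 0] mult_nonneg_nonneg) auto
qed (use assms in auto)

lemma square_pos_D: "square_pos_mat \<kappa> D\<gamma>"
  by (rule square_pos_mat_cross[OF D_carrier D_nonneg D_positive])

section \<open>Factorization under the product condition\<close>

definition \<beta> :: "nat \<Rightarrow> nat \<Rightarrow> real" where
  "\<beta> b c = T 0 b c * T 0 0 0 / (T 0 b 0 * T 0 0 c)"

text \<open>Up to the factor T_(0,0),c / T_(0,0),0 this is the denominator in row c of
  \<open>U\<gamma>\<close>. It also appears as a factor of column c of \<open>D\<gamma>\<close>, so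
  it cancels in D_ac U_cb.\<close>

definition W :: "nat \<Rightarrow> real" where
  "W c = (\<Sum>l\<le>\<kappa>. \<gamma> $ l * \<beta> l c)"

context
  assumes prod: "product_condition \<kappa> T"
begin

text \<open>Separates the dependence of T on c into a factor involving a only and a factor \<beta>
  involving b only. This separation is what allows T to be a product of two kernels up to
  normalisation.\<close>

lemma T_factor:
  assumes "a \<le> \<kappa>" "b \<le> \<kappa>" "c \<le> \<kappa>"
  shows "T a b c = T a b 0 * (T a 0 c / T a 0 0) * \<beta> b c"
proof -
  have "T a b c = T 0 0 0 * T a b 0 * T a 0 c * T 0 b c / (T a 0 0 * T 0 b 0 * T 0 0 c)"
    using prod assms unfolding product_condition_def by blast
  then show ?thesis by (simp add: \<beta>_def mult_ac)
qed

lemma beta_nonneg: "b \<le> \<kappa> \<Longrightarrow> c \<le> \<kappa> \<Longrightarrow> \<beta> b c \<ge> 0"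
  using T_nonneg[of 0 b c] T0[of 0 b] T0[of 0 0] T00[of c] by (simp add: \<beta>_def)

lemma W_pos: "c \<le> \<kappa> \<Longrightarrow> W c > 0"
  unfolding W_def
proof (rule sum_pos2[of _ 0])
  assume c: "c \<le> \<kappa>"
  show "0 < \<gamma> $ 0 * \<beta> 0 c" using gamma_pos[of 0] T00[OF c] T0[of 0 0] by (simp add: \<beta>_def)
  show "0 \<le> \<gamma> $ l * \<beta> l c" if "l \<in> {..\<kappa>}" for l
    using gamma_pos[of l] beta_nonneg[of l c] that c by simp
qed auto

lemma D_factor:
  assumes "a \<le> \<kappa>" "c \<le> \<kappa>"
  shows "D\<gamma> $$ (a, c) = T a 0 c / T a 0 0 * W c / Z a"
proof -
  have "\<gamma> $ l / T a l 0 * T a l c = T a 0 c / T a 0 0 * (\<gamma> $ l * \<beta> l c)" if "l \<le> \<kappa>" for l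
    using T_factor[OF assms(1) that assms(2)] T0[OF assms(1) that] by simp
  then have "(\<Sum>l\<le>\<kappa>. \<gamma> $ l / T a l 0 * T a l c) = T a 0 c / T a 0 0 * W c"
    unfolding W_def sum_distrib_left by (intro sum.cong) auto
  then show ?thesis using assms by (simp add: D_mat_def Z_def)
qed

lemma U_factor:
  assumes "c \<le> \<kappa>" "b \<le> \<kappa>"
  shows "U\<gamma> $$ (c, b) = \<gamma> $ b * \<beta> b c / W c"
proof -
  define t where "t = T 0 0 c / T 0 0 0"
  have t: "t > 0" using T00[OF assms(1)] T0[of 0 0] by (simp add: t_def)
  have 1: "\<gamma> $ l / T 0 l 0 * T 0 l c = t * (\<gamma> $ l * \<beta> l c)" if "l \<le> \<kappa>" for l
    using T0[OF le0 that] T0[of 0 0] T00[OF assms(1)] by (simp add: \<beta>_def t_def)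
  then have 2: "(\<Sum>l\<le>\<kappa>. \<gamma> $ l / T 0 l 0 * T 0 l c) = t * W c"
    unfolding W_def sum_distrib_left by (intro sum.cong) auto
  \<comment> \<open>In the branch fixed by convention the formula gives the same value 0, so the
    case distinction disappears.\<close>
  have 3: "\<beta> b c = 0" if "\<forall>a\<le>\<kappa>. T a b c = 0" using that by (simp add: \<beta>_def)
  have "U\<gamma> $$ (c, b) = (if \<forall>a\<le>\<kappa>. T a b c = 0 then 0 else t * (\<gamma> $ b * \<beta> b c) / (t * W c))"
    using U_mat_entry[OF assms, of \<gamma>] unfolding 1[OF assms(2)] 2 .
  then show ?thesis using t 3 by auto
qed

lemma U_nonneg: "c \<le> \<kappa> \<Longrightarrow> b \<le> \<kappa> \<Longrightarrow> U\<gamma> $$ (c, b) \<ge> 0"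
  using gamma_pos[of b] beta_nonneg[of b c] W_pos[of c] by (simp add: U_factor)

lemma markov_U: "markov_kernel \<kappa> U\<gamma>"
proof -
  have "(\<Sum>b\<le>\<kappa>. U\<gamma> $$ (c, b)) = 1" if c: "c \<le> \<kappa>" for c
  proof -
    have "(\<Sum>b\<le>\<kappa>. U\<gamma> $$ (c, b)) = W c / W c"
      unfolding W_def[of c] sum_divide_distrib using c by (intro sum.cong) (auto simp: U_factor W_def)
    then show ?thesis using W_pos[OF c] by simp
  qed
  then show ?thesis using U_nonneg U_carrier by (simp add: markov_kernel_def)
qed

lemma square_pos_U: "square_pos_mat \<kappa> U\<gamma>"
proof (rule square_pos_mat_cross[OF U_carrier U_nonneg])
  fix i assume i: "i \<le> \<kappa>"
  show "U\<gamma> $$ (i, 0) > 0"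
    using i gamma_pos[of 0] W_pos[of i] T00[of i] T0[of 0 0] by (simp add: U_factor \<beta>_def)
  show "U\<gamma> $$ (0, i) > 0"
    using i gamma_pos[of i] W_pos[of 0] T0[of 0 i] T0[of 0 0] by (simp add: U_factor \<beta>_def)
qed

text \<open>The constants W cancel, so as a function of c the product is a multiple of T_(a,b),c.
  Summing over c then identifies the multiple as (DU)_ab.\<close>

lemma D_times_U:
  assumes "a \<le> \<kappa>" "b \<le> \<kappa>" "c \<le> \<kappa>"
  shows "D\<gamma> $$ (a, c) * U\<gamma> $$ (c, b) = \<gamma> $ b / (T a b 0 * Z a) * T a b c"
  using T_factor[OF assms] W_pos[OF assms(3)] Z_pos[OF assms(1)] T0[OF assms(1,2)] assms
  by (simp add: D_factor U_factor mult_ac)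

lemma DU_entry:
  assumes "a \<le> \<kappa>" "b \<le> \<kappa>"
  shows "(D\<gamma> * U\<gamma>) $$ (a, b) = \<gamma> $ b / (T a b 0 * Z a)"
proof -
  have "(D\<gamma> * U\<gamma>) $$ (a, b) = (\<Sum>c\<le>\<kappa>. \<gamma> $ b / (T a b 0 * Z a) * T a b c)"
    unfolding index_mult_mat_sum[OF D_carrier U_carrier assms]
    using assms by (intro sum.cong) (auto simp: D_times_U)
  also have "\<dots> = \<gamma> $ b / (T a b 0 * Z a) * (\<Sum>c\<le>\<kappa>. T a b c)" by (rule sum_distrib_left[symmetric])
  finally show ?thesis using assms by (simp add: T_sum)
qed

lemma DU_pos: "a \<le> \<kappa> \<Longrightarrow> b \<le> \<kappa> \<Longrightarrow> (D\<gamma> * U\<gamma>) $$ (a, b) > 0"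
  using gamma_pos[of b] T0[of a b] Z_pos[of a] by (simp add: DU_entry)

lemma D_times_U_eq_DU_T:
  assumes "a \<le> \<kappa>" "b \<le> \<kappa>" "c \<le> \<kappa>"
  shows "D\<gamma> $$ (a, c) * U\<gamma> $$ (c, b) = (D\<gamma> * U\<gamma>) $$ (a, b) * T a b c"
  using assms by (simp only: D_times_U DU_entry)

lemma DU_carrier: "D\<gamma> * U\<gamma> \<in> carrier_mat (\<kappa> + 1) (\<kappa> + 1)"
  using D_carrier U_carrier by (rule mult_carrier_mat)

lemma square_pos_DU: "square_pos_mat \<kappa> (D\<gamma> * U\<gamma>)"
  by (rule square_pos_mat_cross[OF DU_carrier]) (simp_all add: DU_pos less_imp_le del: index_mult_mat)

text \<open>Up to the factor r, the matrix X is the transpose of DU conjugated by the diagonal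
  matrix of \<gamma>. A right eigenvector \<mu> of X thus becomes the left eigenvector \<gamma>_i
  \<mu>_i of DU, which is the origin of the formula for \<rho>.\<close>

lemma rho_invariant_DU: "invariant_prob \<kappa> (D\<gamma> * U\<gamma>) \<rho>"
proof -
  obtain r where r: "r > 0" "\<And>a. a \<le> \<kappa> \<Longrightarrow> T a a 0 * \<nu> $ a * Z a = r * \<gamma> $ a"
    using gamma_eigenvector by blast
  obtain s where s: "\<And>d. d \<le> \<kappa> \<Longrightarrow> (\<Sum>a\<le>\<kappa>. X_mat \<kappa> T $$ (d, a) * \<mu> $ a) = s * \<mu> $ d"
    using mu_perron unfolding perron_right_eigenvector_iff[OF square_pos_X] by blast
  have X: "\<gamma> $ d * X_mat \<kappa> T $$ (d, a) = r * \<gamma> $ a * (D\<gamma> * U\<gamma>) $$ (a, d)" if "a \<le> \<kappa>" "d \<le> \<kappa>" for a d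
    unfolding r(2)[OF that(1), symmetric] using that Z_pos[of a] by (simp add: X_entry DU_entry del: index_mult_mat)
  have key: "r * (\<Sum>a\<le>\<kappa>. \<rho> $ a * (D\<gamma> * U\<gamma>) $$ (a, d)) = s * \<rho> $ d" if d: "d \<le> \<kappa>" for d
  proof -
    have "r * (\<Sum>a\<le>\<kappa>. \<rho> $ a * (D\<gamma> * U\<gamma>) $$ (a, d)) = (\<Sum>a\<le>\<kappa>. \<gamma> $ d * (X_mat \<kappa> T $$ (d, a) * \<mu> $ a))"
      unfolding sum_distrib_left
    proof (intro sum.cong refl)
      fix a assume "a \<in> {..\<kappa>}"
      then have a: "a \<le> \<kappa>" by simp
      then have "\<rho> $ a = \<gamma> $ a * \<mu> $ a" by (simp add: rho_of_def)
      then show "r * (\<rho> $ a * (D\<gamma> * U\<gamma>) $$ (a, d)) = \<gamma> $ d * (X_mat \<kappa> T $$ (d, a) * \<mu> $ a)"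
        using X[OF a d] by (simp only: mult.assoc[symmetric]) (simp only: mult_ac)
    qed
    also have "\<dots> = s * \<rho> $ d"
      using d by (simp add: sum_distrib_left[symmetric] s rho_of_def)
    finally show ?thesis .
  qed
  \<comment> \<open>The left and right Perron equations of X come with separate eigenvalues r and s.
    Stochasticity of DU preserves total mass and so forces s = r.\<close>
  define S where "S d = (\<Sum>a\<le>\<kappa>. \<rho> $ a * (D\<gamma> * U\<gamma>) $$ (a, d))" for d
  have S: "r * S d = s * \<rho> $ d" if "d \<le> \<kappa>" for d
    unfolding S_def by (rule key[OF that])
  have "(\<Sum>d\<le>\<kappa>. (D\<gamma> * U\<gamma>) $$ (a, d)) = 1" if a: "a \<le> \<kappa>" for a
  proof -
    have "(\<Sum>d\<le>\<kappa>. (D\<gamma> * U\<gamma>) $$ (a, d)) = (\<Sum>d\<le>\<kappa>. \<gamma> $ d / T a d 0) / Z a"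
      unfolding sum_divide_distrib using a by (intro sum.cong) (auto simp: DU_entry simp del: index_mult_mat)
    then show ?thesis using Z_pos[OF a] by (simp add: Z_def)
  qed
  then have "(\<Sum>d\<le>\<kappa>. S d) = (\<Sum>a\<le>\<kappa>. \<rho> $ a)"
    unfolding S_def by (subst sum.swap) (simp add: sum_distrib_left[symmetric] del: index_mult_mat)
  also have sum\<rho>: "\<dots> = 1" using rho_prob by (simp add: prob_vec_def)
  finally have "r = r * (\<Sum>d\<le>\<kappa>. S d)" by simp
  also have "\<dots> = (\<Sum>d\<le>\<kappa>. r * S d)" by (rule sum_distrib_left)
  also have "\<dots> = (\<Sum>d\<le>\<kappa>. s * \<rho> $ d)" by (intro sum.cong refl S) simp
  also have "\<dots> = s * (\<Sum>d\<le>\<kappa>. \<rho> $ d)" by (rule sum_distrib_left[symmetric])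
  finally have "s = r" using sum\<rho> by simp
  then have "S d = \<rho> $ d" if "d \<le> \<kappa>" for d
    using S[OF that] r(1) by simp
  then have "\<forall>d\<le>\<kappa>. (\<Sum>a\<le>\<kappa>. \<rho> $ a * (D\<gamma> * U\<gamma>) $$ (a, d)) = \<rho> $ d"
    unfolding S_def by blast
  then show ?thesis unfolding invariant_prob_iff_sum[OF DU_carrier] using rho_prob by blast
qed

text \<open>The diagonal of \<open>D U\<close> is proportional to \<open>\<nu>\<close>, which is invariant under \<open>Y\<close>.\<close>

lemma DU_UD_diagonal:
  assumes c: "c \<le> \<kappa>"
  shows "(D\<gamma> * U\<gamma>) $$ (c, c) = (U\<gamma> * D\<gamma>) $$ (c, c)"
proof -
  obtain r where r: "r > 0" "\<And>a. a \<le> \<kappa> \<Longrightarrow> T a a 0 * \<nu> $ a * Z a = r * \<gamma> $ a"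
    using gamma_eigenvector by blast
  have diag: "(D\<gamma> * U\<gamma>) $$ (a, a) = \<nu> $ a / r" if "a \<le> \<kappa>" for a
    using r(2)[OF that] r(1) T0[OF that that] Z_pos[OF that]
    unfolding DU_entry[OF that that] by (simp add: field_simps)
  \<comment> \<open>Read in the other order, each summand is the product form of T at neighbourhood
    (a, a), so Y acts on the diagonal of DU and produces the diagonal of UD.\<close>
  have "(U\<gamma> * D\<gamma>) $$ (c, c) = (\<Sum>a\<le>\<kappa>. D\<gamma> $$ (a, c) * U\<gamma> $$ (c, a))"
    unfolding index_mult_mat_sum[OF U_carrier D_carrier c c] by (simp add: mult.commute)
  also have "\<dots> = (\<Sum>a\<le>\<kappa>. \<nu> $ a * T a a c / r)"
    using c by (intro sum.cong) (auto simp: D_times_U_eq_DU_T diag simp del: index_mult_mat)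
  also have "\<dots> = \<nu> $ c / r"
    unfolding sum_divide_distrib[symmetric] nu_invariant[OF c] ..
  finally show ?thesis using diag[OF c] by simp
qed

end

end

section \<open>Laws on the horizontal zigzag\<close>

lemma space_line_space: "space (line_space \<kappa>) = {S. \<forall>x. S x \<le> \<kappa>}"
  by (auto simp: line_space_def space_PiM PiE_def)

lemma space_hz_space: "space (hz_space \<kappa>) = {(S0, S1). \<forall>x. S0 x \<le> \<kappa> \<and> S1 x \<le> \<kappa>}"
  by (auto simp: hz_space_def space_pair_measure space_line_space)

lemma measurable_line_component[measurable]: "(\<lambda>S. S x) \<in> line_space \<kappa> \<rightarrow>\<^sub>M count_space UNIV"
proof -
  have "(\<lambda>S. S x) \<in> line_space \<kappa> \<rightarrow>\<^sub>M count_space {..\<kappa>}"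
    unfolding line_space_def by (rule measurable_component_singleton) simp
  then show ?thesis
    by (rule measurable_compose) (simp add: measurable_count_space)
qed

lemma measurable_hz_fst[measurable]: "fst \<in> hz_space \<kappa> \<rightarrow>\<^sub>M line_space \<kappa>"
  and measurable_hz_snd[measurable]: "snd \<in> hz_space \<kappa> \<rightarrow>\<^sub>M line_space \<kappa>"
  by (simp_all add: hz_space_def)

text \<open>The two lines get separate index sets because one step of the automaton consumes one
  more site of the current line than it produces, and because marginals leave one line free.\<close>

definition cyl :: "nat \<Rightarrow> int set \<Rightarrow> int set \<Rightarrow> (int \<Rightarrow> nat) \<Rightarrow> (int \<Rightarrow> nat)
    \<Rightarrow> ((int \<Rightarrow> nat) \<times> (int \<Rightarrow> nat)) set" where
  "cyl \<kappa> I J a b = {\<omega> \<in> space (hz_space \<kappa>). (\<forall>x\<in>I. fst \<omega> x = a x) \<and> (\<forall>x\<in>J. snd \<omega> x = b x)}"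

lemma sets_cyl[measurable, intro]: "finite I \<Longrightarrow> finite J \<Longrightarrow> cyl \<kappa> I J a b \<in> sets (hz_space \<kappa>)"
  unfolding cyl_def by measurable

lemma cyl_cong:
  "(\<And>x. x \<in> I \<Longrightarrow> a x = a' x) \<Longrightarrow> (\<And>x. x \<in> J \<Longrightarrow> b x = b' x) \<Longrightarrow> cyl \<kappa> I J a b = cyl \<kappa> I J a' b'"
  unfolding cyl_def by auto

text \<open>Both ends are excluded so that \<open>window 0\<close> is empty and the whole space is
  itself a window cylinder.\<close>

definition window :: "nat \<Rightarrow> int set" where
  "window N = {- int N<..<int N}"

definition window_cyls :: "nat \<Rightarrow> ((int \<Rightarrow> nat) \<times> (int \<Rightarrow> nat)) set set" where
  "window_cyls \<kappa> = insert {} {cyl \<kappa> (window N) (window N) (fst \<omega>) (snd \<omega>) | N \<omega>. \<omega> \<in> space (hz_space \<kappa>)}"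

lemma finite_window[simp]: "finite (window N)"
  by (simp add: window_def)

lemma window_max: "window (max N N') = window N \<union> window N'"
  by (auto simp: window_def)

text \<open>A cylinder can be written with the values of any of its points. For a common point of
  two cylinders both are described by the same values, and nestedness of windows leaves only the
  larger one.\<close>

lemma Int_stable_window_cyls: "Int_stable (window_cyls \<kappa>)"
proof (rule Int_stableI)
  fix A B assume AB: "A \<in> window_cyls \<kappa>" "B \<in> window_cyls \<kappa>"
  show "A \<inter> B \<in> window_cyls \<kappa>"
  proof (cases "A \<inter> B = {}")
    case False
    then obtain \<omega> where \<omega>: "\<omega> \<in> A" "\<omega> \<in> B" by auto
    obtain N v where A: "A = cyl \<kappa> (window N) (window N) (fst v) (snd v)"
      using AB(1) \<omega>(1) by (auto simp: window_cyls_def)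
    obtain N' v' where B: "B = cyl \<kappa> (window N') (window N') (fst v') (snd v')"
      using AB(2) \<omega>(2) by (auto simp: window_cyls_def)
    have "A = cyl \<kappa> (window N) (window N) (fst \<omega>) (snd \<omega>)" "B = cyl \<kappa> (window N') (window N') (fst \<omega>) (snd \<omega>)"
      using \<omega> unfolding A B by (auto simp: cyl_def)
    then have "A \<inter> B = cyl \<kappa> (window (max N N')) (window (max N N')) (fst \<omega>) (snd \<omega>)"
      unfolding window_max by (auto simp: cyl_def)
    moreover have "\<omega> \<in> space (hz_space \<kappa>)" using \<omega> unfolding A by (simp add: cyl_def)
    ultimately show ?thesis unfolding window_cyls_def by blast
  qed (simp add: window_cyls_def)
qed

text \<open>The state set is finite, so a window carries finitely many cylinders and every event
  about one coordinate is a finite union of them. The identity map is therefore measurable from the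
  generated sigma-algebra to the product one.\<close>

lemma sets_hz_space: "sets (hz_space \<kappa>) = sigma_sets (space (hz_space \<kappa>)) (window_cyls \<kappa>)"
proof
  let ?\<Omega> = "space (hz_space \<kappa>)"
  let ?\<Sigma> = "sigma ?\<Omega> (window_cyls \<kappa>)"
  have sub: "window_cyls \<kappa> \<subseteq> sets (hz_space \<kappa>)"
    by (auto simp: window_cyls_def)
  then show "sigma_sets ?\<Omega> (window_cyls \<kappa>) \<subseteq> sets (hz_space \<kappa>)"
    by (intro sets.sigma_sets_subset)
  have pow: "window_cyls \<kappa> \<subseteq> Pow ?\<Omega>"
    using sub sets.sets_into_space by auto
  have coord: "{\<omega> \<in> ?\<Omega>. f \<omega> = c} \<in> sets ?\<Sigma>"
    if "f = (\<lambda>\<omega>. fst \<omega> x) \<or> f = (\<lambda>\<omega>. snd \<omega> x)" for f c x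
  proof -
    define N where "N = nat \<bar>x\<bar> + 1"
    have x: "x \<in> window N" by (auto simp: window_def N_def)
    define C where "C \<omega> = cyl \<kappa> (window N) (window N) (fst \<omega>) (snd \<omega>)" for \<omega>
    have fin: "finite (C ` ?\<Omega>)"
    proof (rule finite_subset)
      let ?F = "Pi\<^sub>E (window N) (\<lambda>_. {..\<kappa>})"
      show "C ` ?\<Omega> \<subseteq> (\<lambda>(a, b). cyl \<kappa> (window N) (window N) a b) ` (?F \<times> ?F)"
      proof
        fix B assume "B \<in> C ` ?\<Omega>"
        then obtain \<omega> where \<omega>: "\<omega> \<in> ?\<Omega>" "B = C \<omega>" by auto
        have "B = cyl \<kappa> (window N) (window N) (restrict (fst \<omega>) (window N)) (restrict (snd \<omega>) (window N))"
          unfolding \<omega> C_def by (intro cyl_cong) auto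
        moreover have "(restrict (fst \<omega>) (window N), restrict (snd \<omega>) (window N)) \<in> ?F \<times> ?F"
          using \<omega>(1) by (auto simp: space_hz_space)
        ultimately show "B \<in> (\<lambda>(a, b). cyl \<kappa> (window N) (window N) a b) ` (?F \<times> ?F)" by blast
      qed
      show "finite ((\<lambda>(a, b). cyl \<kappa> (window N) (window N) a b) ` (?F \<times> ?F))"
        by (intro finite_imageI finite_cartesian_product finite_PiE) auto
    qed
    have eq: "{\<omega> \<in> ?\<Omega>. f \<omega> = c} = \<Union> (C ` {\<omega> \<in> ?\<Omega>. f \<omega> = c})"
      using that x by (auto simp: C_def cyl_def)
    have "C ` {\<omega> \<in> ?\<Omega>. f \<omega> = c} \<subseteq> sets ?\<Sigma>"
      using pow by (auto simp: C_def window_cyls_def intro!: sigma_sets.Basic)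
    moreover have "finite (C ` {\<omega> \<in> ?\<Omega>. f \<omega> = c})"
      by (rule finite_subset[OF _ fin]) auto
    ultimately have "\<Union> (C ` {\<omega> \<in> ?\<Omega>. f \<omega> = c}) \<in> sets ?\<Sigma>"
      by (intro sets.finite_Union)
    then show ?thesis using eq by simp
  qed
  have sp: "space ?\<Sigma> = ?\<Omega>" using pow by (rule space_measure_of)
  have line: "f \<in> ?\<Sigma> \<rightarrow>\<^sub>M line_space \<kappa>" if f: "f = fst \<or> f = snd" for f
    unfolding line_space_def
  proof (rule measurable_PiM_single'[where f="\<lambda>x \<omega>. f \<omega> x"])
    show "(\<lambda>\<omega>. f \<omega> x) \<in> ?\<Sigma> \<rightarrow>\<^sub>M count_space {..\<kappa>}" for x
    proof (subst measurable_count_space_eq2)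
      have "(\<lambda>\<omega>. f \<omega> x) -` {c} \<inter> space ?\<Sigma> = {\<omega> \<in> ?\<Omega>. f \<omega> x = c}" for c
        unfolding sp by auto
      moreover have "{\<omega> \<in> ?\<Omega>. f \<omega> x = c} \<in> sets ?\<Sigma>" for c
        using f by (intro coord[where f="\<lambda>\<omega>. f \<omega> x"]) auto
      moreover have "(\<lambda>\<omega>. f \<omega> x) \<in> space ?\<Sigma> \<rightarrow> {..\<kappa>}"
        unfolding sp using f by (auto simp: space_hz_space)
      ultimately show "(\<lambda>\<omega>. f \<omega> x) \<in> space ?\<Sigma> \<rightarrow> {..\<kappa>} \<and>
          (\<forall>a\<in>{..\<kappa>}. (\<lambda>\<omega>. f \<omega> x) -` {a} \<inter> space ?\<Sigma> \<in> sets ?\<Sigma>)"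
        by simp
    qed simp
    show "(\<lambda>\<omega> x. f \<omega> x) \<in> space ?\<Sigma> \<rightarrow> Pi\<^sub>E UNIV (\<lambda>i. space (count_space {..\<kappa>}))"
      unfolding sp using f by (auto simp: space_hz_space PiE_def)
  qed
  have "(\<lambda>\<omega>. (fst \<omega>, snd \<omega>)) \<in> ?\<Sigma> \<rightarrow>\<^sub>M line_space \<kappa> \<Otimes>\<^sub>M line_space \<kappa>"
    by (intro measurable_Pair) (simp_all add: line)
  then have id: "(\<lambda>\<omega>. \<omega>) \<in> ?\<Sigma> \<rightarrow>\<^sub>M hz_space \<kappa>"
    by (simp add: hz_space_def[symmetric])
  show "sets (hz_space \<kappa>) \<subseteq> sigma_sets ?\<Omega> (window_cyls \<kappa>)"
  proof
    fix A assume A: "A \<in> sets (hz_space \<kappa>)"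
    have "(\<lambda>\<omega>. \<omega>) -` A \<inter> space ?\<Sigma> \<in> sets ?\<Sigma>" by (rule measurable_sets[OF id A])
    moreover have "A \<subseteq> ?\<Omega>" using A by (rule sets.sets_into_space)
    ultimately show "A \<in> sigma_sets ?\<Omega> (window_cyls \<kappa>)"
      using pow sp by (simp add: Int_absorb2)
  qed
qed

lemma hz_measure_eqI:
  assumes m: "m \<in> space (prob_algebra (hz_space \<kappa>))" "m' \<in> space (prob_algebra (hz_space \<kappa>))"
    and eq: "\<And>i0 n a b. (\<And>x. a x \<le> \<kappa>) \<Longrightarrow> (\<And>x. b x \<le> \<kappa>) \<Longrightarrow>
      measure m (cyl \<kappa> {i0..i0 + int n} {i0..i0 + int n} a b) =
      measure m' (cyl \<kappa> {i0..i0 + int n} {i0..i0 + int n} a b)"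
  shows "m = m'"
proof -
  have s: "sets m = sets (hz_space \<kappa>)" "sets m' = sets (hz_space \<kappa>)" "prob_space m" "prob_space m'"
    using m by (auto simp: space_prob_algebra)
  interpret m: prob_space m by fact
  interpret m': prob_space m' by fact
  let ?\<Omega> = "space (hz_space \<kappa>)"
  have sp: "space m = ?\<Omega>" "space m' = ?\<Omega>" using s(1,2)[THEN sets_eq_imp_space_eq] by auto
  have 0: "(\<lambda>_. 0, \<lambda>_. 0) \<in> ?\<Omega>" by (simp add: space_hz_space)
  have sG: "?\<Omega> \<in> window_cyls \<kappa>"
    unfolding window_cyls_def by (rule insertI2, rule CollectI, rule exI[of _ 0], rule exI, rule conjI[OF _ 0])
      (simp add: cyl_def window_def)
  show ?thesis
  proof (rule measure_eqI_generator_eq[OF Int_stable_window_cyls])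
    show "window_cyls \<kappa> \<subseteq> Pow ?\<Omega>" by (auto simp: window_cyls_def cyl_def)
    show "sets m = sigma_sets ?\<Omega> (window_cyls \<kappa>)" "sets m' = sigma_sets ?\<Omega> (window_cyls \<kappa>)"
      using s sets_hz_space by auto
    show "range (\<lambda>_::nat. ?\<Omega>) \<subseteq> window_cyls \<kappa>" using sG by auto
    show "(\<Union>i::nat. ?\<Omega>) = ?\<Omega>" by simp
    show "emeasure m ?\<Omega> \<noteq> \<infinity>" by simp
    fix X assume "X \<in> window_cyls \<kappa>"
    then consider "X = {}" | N \<omega> where "\<omega> \<in> ?\<Omega>" "X = cyl \<kappa> (window N) (window N) (fst \<omega>) (snd \<omega>)"
      by (auto simp: window_cyls_def)
    then show "emeasure m X = emeasure m' X"
    proof cases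
      case 2
      show ?thesis
      proof (cases N)
        case 0
        then have "X = ?\<Omega>" unfolding 2 by (simp add: cyl_def window_def)
        then show ?thesis using m.emeasure_space_1 m'.emeasure_space_1 sp by simp
      next
        case (Suc k)
        \<comment> \<open>A nonempty window is the interval from -k to k, which matches the
          hypothesis with starting point -k and length parameter 2k.\<close>
        have "window N = {- int k..- int k + int (2 * k)}" unfolding Suc by (auto simp: window_def)
        moreover have "fst \<omega> x \<le> \<kappa>" "snd \<omega> x \<le> \<kappa>" for x using 2(1) by (auto simp: space_hz_space)
        ultimately have "measure m X = measure m' X" unfolding 2 by (metis eq)
        then show ?thesis unfolding m.emeasure_eq_measure m'.emeasure_eq_measure by simp
      qed
    qed simp
  qed
qed


section \<open>One step of the automaton as a probability kernel\<close>

context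
  fixes \<kappa> :: nat and T :: "nat \<Rightarrow> nat \<Rightarrow> nat \<Rightarrow> real"
  assumes T: "transition_matrix \<kappa> T"
begin

lemma prob_space_pca_site:
  assumes "S \<in> space (line_space \<kappa>)"
  shows "prob_space (point_measure {..\<kappa>} (\<lambda>c. ennreal (T (S x) (S (x + 1)) c)))"
proof (rule prob_spaceI)
  have "S x \<le> \<kappa>" "S (x + 1) \<le> \<kappa>" using assms by (auto simp: space_line_space)
  moreover from this have "(\<Sum>c\<le>\<kappa>. ennreal (T (S x) (S (x + 1)) c)) = ennreal (\<Sum>c\<le>\<kappa>. T (S x) (S (x + 1)) c)"
    using T by (intro sum_ennreal) (auto simp: transition_matrix_def)
  ultimately show "emeasure (point_measure {..\<kappa>} (\<lambda>c. ennreal (T (S x) (S (x + 1)) c)))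
      (space (point_measure {..\<kappa>} (\<lambda>c. ennreal (T (S x) (S (x + 1)) c)))) = 1"
    using T by (simp add: space_point_measure emeasure_point_measure_finite transition_matrix_def)
qed

lemma emeasure_pca_kernel:
  assumes S: "S \<in> space (line_space \<kappa>)" and J: "finite J" and E: "\<And>x. x \<in> J \<Longrightarrow> E x \<subseteq> {..\<kappa>}"
  shows "emeasure (pca_kernel \<kappa> T S) {S'. (\<forall>x. S' x \<le> \<kappa>) \<and> (\<forall>x\<in>J. S' x \<in> E x)} =
    (\<Prod>x\<in>J. \<Sum>c\<in>E x. ennreal (T (S x) (S (x + 1)) c))"
proof -
  let ?M = "\<lambda>x. point_measure {..\<kappa>} (\<lambda>c. ennreal (T (S x) (S (x + 1)) c))"
  have eq: "{S'. (\<forall>x. S' x \<le> \<kappa>) \<and> (\<forall>x\<in>J. S' x \<in> E x)} = prod_emb UNIV ?M J (Pi\<^sub>E J E)"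
    by (auto simp: prod_emb_def space_point_measure PiE_def Pi_def)
  have "emeasure (pca_kernel \<kappa> T S) (prod_emb UNIV ?M J (Pi\<^sub>E J E)) = (\<Prod>x\<in>J. emeasure (?M x) (E x))"
    unfolding pca_kernel_def
    using E J by (intro emeasure_PiM_emb prob_space_pca_site[OF S]) (auto simp: sets_point_measure)
  also have "\<dots> = (\<Prod>x\<in>J. \<Sum>c\<in>E x. ennreal (T (S x) (S (x + 1)) c))"
    using E by (intro prod.cong emeasure_point_measure_finite) auto
  finally show ?thesis unfolding eq .
qed

lemma sets_pca_kernel: "sets (pca_kernel \<kappa> T S) = sets (line_space \<kappa>)"
  unfolding pca_kernel_def line_space_def by (intro sets_PiM_cong) (simp_all add: sets_point_measure)

text \<open>It suffices to test finite-dimensional rectangles, and their probabilities are finite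
  products and sums in finitely many coordinates of S.\<close>

lemma measurable_pca_kernel: "pca_kernel \<kappa> T \<in> line_space \<kappa> \<rightarrow>\<^sub>M prob_algebra (line_space \<kappa>)"
proof (rule measurable_prob_algebra_generated)
  show "sets (line_space \<kappa>) = sigma_sets (Pi\<^sub>E UNIV (\<lambda>_. {..\<kappa>})) (prod_algebra UNIV (\<lambda>_. count_space {..\<kappa>}))"
    unfolding line_space_def by (simp add: sets_PiM)
  show "Int_stable (prod_algebra UNIV (\<lambda>_::int. count_space {..\<kappa>}))"
    by (rule Int_stable_prod_algebra)
  show "prod_algebra UNIV (\<lambda>_::int. count_space {..\<kappa>}) \<subseteq> Pow (Pi\<^sub>E UNIV (\<lambda>_. {..\<kappa>}))"
    using prod_algebra_sets_into_space[of UNIV "\<lambda>_::int. count_space {..\<kappa>}"] by simp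
  fix S assume S: "S \<in> space (line_space \<kappa>)"
  show "prob_space (pca_kernel \<kappa> T S)"
    unfolding pca_kernel_def by (intro prob_space_PiM prob_space_pca_site S)
  show "sets (pca_kernel \<kappa> T S) = sets (line_space \<kappa>)" by (rule sets_pca_kernel)
next
  fix A assume "A \<in> prod_algebra UNIV (\<lambda>_::int. count_space {..\<kappa>})"
  then obtain J E where A: "A = prod_emb UNIV (\<lambda>_. count_space {..\<kappa>}) J (Pi\<^sub>E J E)"
    and J: "finite J" and E: "\<And>x. x \<in> J \<Longrightarrow> E x \<in> sets (count_space {..\<kappa>})"
    by (rule prod_algebraE) blast
  have "A = {S'. (\<forall>x. S' x \<le> \<kappa>) \<and> (\<forall>x\<in>J. S' x \<in> E x)}"
    unfolding A by (auto simp: prod_emb_def PiE_def Pi_def)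
  then have "emeasure (pca_kernel \<kappa> T S) A = (\<Prod>x\<in>J. \<Sum>c\<in>E x. ennreal (T (S x) (S (x + 1)) c))"
    if "S \<in> space (line_space \<kappa>)" for S
    using emeasure_pca_kernel[OF that J, of E] E by simp
  moreover have "(\<lambda>S. \<Prod>x\<in>J. \<Sum>c\<in>E x. ennreal (T (S x) (S (x + 1)) c)) \<in> borel_measurable (line_space \<kappa>)"
  proof -
    have [measurable]: "(\<lambda>S. T (S x) (S (x + 1)) c) \<in> borel_measurable (line_space \<kappa>)" for x c
      by (rule measurable_compose_countable[where f="\<lambda>a S. T a (S (x + 1)) c"],
          rule measurable_compose_countable[where f="\<lambda>b S. T a b c" for a]) auto
    show ?thesis by measurable
  qed
  ultimately show "(\<lambda>S. emeasure (pca_kernel \<kappa> T S) A) \<in> borel_measurable (line_space \<kappa>)"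
    by (simp cong: measurable_cong)
qed

lemma measurable_pca_step:
  "(\<lambda>\<omega>. distr (pca_kernel \<kappa> T (snd \<omega>)) (hz_space \<kappa>) (\<lambda>S2. (snd \<omega>, S2)))
    \<in> hz_space \<kappa> \<rightarrow>\<^sub>M prob_algebra (hz_space \<kappa>)"
proof (rule measurable_distr_prob_space2)
  show "(\<lambda>\<omega>. pca_kernel \<kappa> T (snd \<omega>)) \<in> hz_space \<kappa> \<rightarrow>\<^sub>M prob_algebra (line_space \<kappa>)"
    by (rule measurable_compose[OF measurable_hz_snd measurable_pca_kernel])
  show "(\<lambda>(\<omega>, S2). (snd \<omega>, S2)) \<in> hz_space \<kappa> \<Otimes>\<^sub>M line_space \<kappa> \<rightarrow>\<^sub>M hz_space \<kappa>"
    unfolding hz_space_def by measurable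
qed

lemma pca_image_prob_algebra:
  assumes m: "m \<in> space (prob_algebra (hz_space \<kappa>))"
  shows "pca_image \<kappa> T m \<in> space (prob_algebra (hz_space \<kappa>))"
proof -
  have "prob_space (pca_image \<kappa> T m)" "sets (pca_image \<kappa> T m) = sets (hz_space \<kappa>)"
    unfolding pca_image_def case_prod_beta
    using m measurable_pca_step
    by (auto intro!: prob_space_bind'[OF m measurable_pca_step] sets_bind'[OF m measurable_pca_step])
  then show ?thesis by (simp add: space_prob_algebra)
qed

text \<open>The conditions on I and J say that the whole neighbourhood of every updated site is
  prescribed. The conditional probability of the new values is then constant on the event and
  factors out; b is a placeholder for the unconstrained old line.\<close>

lemma measure_pca_image_cyl:
  assumes m: "m \<in> space (prob_algebra (hz_space \<kappa>))"
    and I: "finite I" "J \<subseteq> I" "(\<lambda>x. x + 1) ` J \<subseteq> I"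
    and a: "\<And>x. a x \<le> \<kappa>" and c: "\<And>x. c x \<le> \<kappa>"
  shows "measure (pca_image \<kappa> T m) (cyl \<kappa> I J a c) =
    measure m (cyl \<kappa> {} I b a) * (\<Prod>x\<in>J. T (a x) (a (x + 1)) (c x))"
proof -
  have J: "finite J" using I finite_subset by blast
  have sm: "sets m = sets (hz_space \<kappa>)" "prob_space m" using m by (auto simp: space_prob_algebra)
  interpret m: prob_space m by fact
  interpret im: prob_space "pca_image \<kappa> T m"
    using pca_image_prob_algebra[OF m] by (simp add: space_prob_algebra)
  have sp: "space m = space (hz_space \<kappa>)" using sm(1) by (rule sets_eq_imp_space_eq)
  let ?K = "\<lambda>\<omega>. distr (pca_kernel \<kappa> T (snd \<omega>)) (hz_space \<kappa>) (\<lambda>S2. (snd \<omega>, S2))"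
  let ?p = "\<Prod>x\<in>J. T (a x) (a (x + 1)) (c x)"
  have p: "?p \<ge> 0" using T a c by (intro prod_nonneg) (auto simp: transition_matrix_def)
  have K: "emeasure (?K \<omega>) (cyl \<kappa> I J a c) = ennreal ?p * indicator (cyl \<kappa> {} I b a) \<omega>"
    if \<omega>: "\<omega> \<in> space (hz_space \<kappa>)" for \<omega>
  proof -
    have S: "snd \<omega> \<in> space (line_space \<kappa>)" using measurable_space[OF measurable_hz_snd \<omega>] .
    have spk: "space (pca_kernel \<kappa> T (snd \<omega>)) = space (line_space \<kappa>)"
      by (rule sets_eq_imp_space_eq[OF sets_pca_kernel])
    have meas: "(\<lambda>S2. (snd \<omega>, S2)) \<in> pca_kernel \<kappa> T (snd \<omega>) \<rightarrow>\<^sub>M hz_space \<kappa>"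
      unfolding measurable_cong_sets[OF sets_pca_kernel refl] hz_space_def
      using S by (rule measurable_Pair1')
    have "emeasure (?K \<omega>) (cyl \<kappa> I J a c) =
        emeasure (pca_kernel \<kappa> T (snd \<omega>)) ((\<lambda>S2. (snd \<omega>, S2)) -` cyl \<kappa> I J a c \<inter> space (line_space \<kappa>))"
      using I J by (subst emeasure_distr[OF meas]) (auto simp: spk)
    also have "(\<lambda>S2. (snd \<omega>, S2)) -` cyl \<kappa> I J a c \<inter> space (line_space \<kappa>) =
        (if \<forall>x\<in>I. snd \<omega> x = a x then {S'. (\<forall>x. S' x \<le> \<kappa>) \<and> (\<forall>x\<in>J. S' x \<in> {c x})} else {})"
      using S by (auto simp: cyl_def space_line_space space_hz_space)
    also have "emeasure (pca_kernel \<kappa> T (snd \<omega>)) \<dots> = ennreal ?p * indicator (cyl \<kappa> {} I b a) \<omega>"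
    proof (cases "\<forall>x\<in>I. snd \<omega> x = a x")
      case True
      have "snd \<omega> x = a x \<and> snd \<omega> (x + 1) = a (x + 1)" if "x \<in> J" for x
        using True I that by (metis image_eqI subsetD)
      then have "emeasure (pca_kernel \<kappa> T (snd \<omega>)) {S'. (\<forall>x. S' x \<le> \<kappa>) \<and> (\<forall>x\<in>J. S' x \<in> {c x})} =
          (\<Prod>x\<in>J. ennreal (T (a x) (a (x + 1)) (c x)))"
        using I c by (subst emeasure_pca_kernel[OF S J]) (auto intro!: prod.cong)
      also have "\<dots> = ennreal ?p"
        using T a c by (intro prod_ennreal) (auto simp: transition_matrix_def)
      finally show ?thesis using True \<omega> by (simp add: cyl_def)
    qed (auto simp: cyl_def)
    finally show ?thesis .
  qed
  have "emeasure (pca_image \<kappa> T m) (cyl \<kappa> I J a c) = (\<integral>\<^sup>+\<omega>. emeasure (?K \<omega>) (cyl \<kappa> I J a c) \<partial>m)"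
    unfolding pca_image_def case_prod_beta
    using I J by (intro emeasure_bind_prob_algebra[OF m measurable_pca_step]) auto
  also have "\<dots> = (\<integral>\<^sup>+\<omega>. ennreal ?p * indicator (cyl \<kappa> {} I b a) \<omega> \<partial>m)"
    using K sp by (intro nn_integral_cong) auto
  also have "\<dots> = ennreal ?p * emeasure m (cyl \<kappa> {} I b a)"
    using I sm by (intro nn_integral_cmult_indicator) auto
  finally show ?thesis
    using p unfolding m.emeasure_eq_measure im.emeasure_eq_measure
    by (simp add: ennreal_mult[symmetric] mult.commute)
qed

end


section \<open>Marginals and cylinder probabilities of zigzag chains\<close>

lemma measure_cyl_split_fst:
  assumes m: "m \<in> space (prob_algebra (hz_space \<kappa>))" and fin: "finite W" "finite J"
  shows "measure m (cyl \<kappa> {} J a b) = (\<Sum>s\<in>Pi\<^sub>E W (\<lambda>_. {..\<kappa>}). measure m (cyl \<kappa> W J s b))"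
proof -
  interpret prob_space m using m by (simp add: space_prob_algebra)
  have sm: "sets m = sets (hz_space \<kappa>)" using m by (simp add: space_prob_algebra)
  have 1: "\<omega> \<in> (\<Union>s\<in>Pi\<^sub>E W (\<lambda>_. {..\<kappa>}). cyl \<kappa> W J s b)" if \<omega>: "\<omega> \<in> cyl \<kappa> {} J a b" for \<omega>
  proof (rule UN_I[of "restrict (fst \<omega>) W"])
    have "fst \<omega> x \<le> \<kappa>" for x using \<omega> by (auto simp: cyl_def space_hz_space)
    then show "restrict (fst \<omega>) W \<in> Pi\<^sub>E W (\<lambda>_. {..\<kappa>})" by auto
    show "\<omega> \<in> cyl \<kappa> W J (restrict (fst \<omega>) W) b" using \<omega> by (simp add: cyl_def)
  qed
  have 2: "cyl \<kappa> W J s b \<subseteq> cyl \<kappa> {} J a b" for s by (auto simp: cyl_def)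
  have "cyl \<kappa> {} J a b = (\<Union>s\<in>Pi\<^sub>E W (\<lambda>_. {..\<kappa>}). cyl \<kappa> W J s b)"
    by (rule equalityI) (rule subsetI, erule 1, rule UN_least, rule 2)
  moreover have "disjoint_family_on (\<lambda>s. cyl \<kappa> W J s b) (Pi\<^sub>E W (\<lambda>_. {..\<kappa>}))"
  proof (unfold disjoint_family_on_def, intro ballI impI)
    fix s t assume st: "s \<in> Pi\<^sub>E W (\<lambda>_. {..\<kappa>})" "t \<in> Pi\<^sub>E W (\<lambda>_. {..\<kappa>})" "s \<noteq> t"
    have False if \<omega>: "\<omega> \<in> cyl \<kappa> W J s b" "\<omega> \<in> cyl \<kappa> W J t b" for \<omega>
    proof -
      have "s x = t x" if "x \<in> W" for x using \<omega> that by (simp add: cyl_def)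
      then have "s = t" by (rule PiE_ext[OF st(1,2)])
      then show False using st(3) by simp
    qed
    then show "cyl \<kappa> W J s b \<inter> cyl \<kappa> W J t b = {}" by blast
  qed
  ultimately show ?thesis
    using fin by (simp add: finite_measure_finite_Union[OF finite_PiE] image_subset_iff sm sets_cyl)
qed

lemma measure_cyl_split_insert_fst:
  assumes m: "m \<in> space (prob_algebra (hz_space \<kappa>))" and fin: "finite I" "finite J" and x: "x \<notin> I"
  shows "measure m (cyl \<kappa> I J a b) = (\<Sum>s\<le>\<kappa>. measure m (cyl \<kappa> (insert x I) J (a(x := s)) b))"
proof -
  interpret prob_space m using m by (simp add: space_prob_algebra)
  have sm: "sets m = sets (hz_space \<kappa>)" using m by (simp add: space_prob_algebra)
  have "cyl \<kappa> I J a b = (\<Union>s\<in>{..\<kappa>}. cyl \<kappa> (insert x I) J (a(x := s)) b)"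
    using x by (auto simp: cyl_def space_hz_space)
  moreover have "disjoint_family_on (\<lambda>s. cyl \<kappa> (insert x I) J (a(x := s)) b) {..\<kappa>}"
    by (auto simp: disjoint_family_on_def cyl_def)
  ultimately show ?thesis
    using fin by (simp add: finite_measure_finite_Union image_subset_iff sm sets_cyl)
qed

lemma measure_cyl_split_insert_snd:
  assumes m: "m \<in> space (prob_algebra (hz_space \<kappa>))" and fin: "finite I" "finite J" and x: "x \<notin> J"
  shows "measure m (cyl \<kappa> I J a b) = (\<Sum>s\<le>\<kappa>. measure m (cyl \<kappa> I (insert x J) a (b(x := s))))"
proof -
  interpret prob_space m using m by (simp add: space_prob_algebra)
  have sm: "sets m = sets (hz_space \<kappa>)" using m by (simp add: space_prob_algebra)
  have "cyl \<kappa> I J a b = (\<Union>s\<in>{..\<kappa>}. cyl \<kappa> I (insert x J) a (b(x := s)))"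
    using x by (auto simp: cyl_def space_hz_space)
  moreover have "disjoint_family_on (\<lambda>s. cyl \<kappa> I (insert x J) a (b(x := s))) {..\<kappa>}"
    by (auto simp: disjoint_family_on_def cyl_def)
  ultimately show ?thesis
    using fin by (simp add: finite_measure_finite_Union image_subset_iff sm sets_cyl)
qed

definition zigzag_weight :: "real mat \<Rightarrow> real mat \<Rightarrow> real vec \<Rightarrow> int \<Rightarrow> nat \<Rightarrow> (int \<Rightarrow> nat) \<Rightarrow> (int \<Rightarrow> nat) \<Rightarrow> real" where
  "zigzag_weight D U \<rho> i0 n a b = \<rho> $ a i0 * (\<Prod>i<n. D $$ (a (i0 + int i), b (i0 + int i)) *
     U $$ (b (i0 + int i), a (i0 + int i + 1))) * D $$ (a (i0 + int n), b (i0 + int n))"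

lemma hzmc_law_iff:
  "hzmc_law \<kappa> D U \<rho> m \<longleftrightarrow> markov_kernel \<kappa> D \<and> markov_kernel \<kappa> U \<and> invariant_prob \<kappa> (D * U) \<rho> \<and>
    m \<in> space (prob_algebra (hz_space \<kappa>)) \<and>
    (\<forall>i0 n a b. (\<forall>x. a x \<le> \<kappa>) \<longrightarrow> (\<forall>x. b x \<le> \<kappa>) \<longrightarrow>
      measure m (cyl \<kappa> {i0..i0 + int n} {i0..i0 + int n} a b) = zigzag_weight D U \<rho> i0 n a b)"
    (is "_ \<longleftrightarrow> ?D \<and> ?U \<and> ?inv \<and> ?m \<and> ?cyl")
proof -
  have cyl: "{(S0, S1) \<in> space m. \<forall>i\<le>n. S0 (i0 + int i) = a (i0 + int i) \<and> S1 (i0 + int i) = b (i0 + int i)}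
      = cyl \<kappa> {i0..i0 + int n} {i0..i0 + int n} a b" if ?m for i0 n and a b :: "int \<Rightarrow> nat"
  proof -
    have sp: "space m = space (hz_space \<kappa>)"
      using that by (intro sets_eq_imp_space_eq) (simp add: space_prob_algebra)
    have W: "(\<forall>x\<in>{i0..i0 + int n}. P x) \<longleftrightarrow> (\<forall>i\<le>n. P (i0 + int i))" for P
    proof
      assume P: "\<forall>i\<le>n. P (i0 + int i)"
      show "\<forall>x\<in>{i0..i0 + int n}. P x"
      proof
        fix x assume "x \<in> {i0..i0 + int n}"
        then have "nat (x - i0) \<le> n" "i0 + int (nat (x - i0)) = x" by auto
        moreover have "P (i0 + int (nat (x - i0)))" using P calculation(1) by blast
        ultimately show "P x" by simp
      qed
    qed auto
    show ?thesis unfolding sp cyl_def W by auto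
  qed
  have "(\<forall>i0 n a b. (\<forall>i\<le>n. a i \<le> \<kappa> \<and> b i \<le> \<kappa>) \<longrightarrow>
        measure m {(S0, S1) \<in> space m.
            \<forall>i\<le>n. S0 (i0 + int i) = a i \<and> S1 (i0 + int i) = b i}
        = \<rho> $ a 0 * (\<Prod>i<n. D $$ (a i, b i) * U $$ (b i, a (i + 1))) * D $$ (a n, b n)) \<longleftrightarrow> ?cyl"
    (is "?L \<longleftrightarrow> _") if m: ?m
  proof
    assume L: ?L
    show ?cyl
    proof (intro allI impI)
      fix i0 :: int and n :: nat and a b :: "int \<Rightarrow> nat"
      assume "\<forall>x. a x \<le> \<kappa>" "\<forall>x. b x \<le> \<kappa>"
      then have "\<forall>i\<le>n. a (i0 + int i) \<le> \<kappa> \<and> b (i0 + int i) \<le> \<kappa>" by blast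
      then have "measure m {(S0, S1) \<in> space m. \<forall>i\<le>n. S0 (i0 + int i) = a (i0 + int i) \<and> S1 (i0 + int i) = b (i0 + int i)}
        = \<rho> $ a (i0 + int 0) * (\<Prod>i<n. D $$ (a (i0 + int i), b (i0 + int i)) *
            U $$ (b (i0 + int i), a (i0 + int (i + 1)))) * D $$ (a (i0 + int n), b (i0 + int n))"
        using L[THEN spec[of _ i0], THEN spec[of _ n], THEN spec[of _ "\<lambda>i. a (i0 + int i)"],
          THEN spec[of _ "\<lambda>i. b (i0 + int i)"]] by blast
      then show "measure m (cyl \<kappa> {i0..i0 + int n} {i0..i0 + int n} a b) = zigzag_weight D U \<rho> i0 n a b"
        unfolding cyl[OF m] zigzag_weight_def by (simp add: add_ac)
    qed
  next
    assume R: ?cyl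
    show ?L
    proof (intro allI impI)
      fix i0 :: int and n :: nat and a b :: "nat \<Rightarrow> nat"
      assume ab: "\<forall>i\<le>n. a i \<le> \<kappa> \<and> b i \<le> \<kappa>"
      \<comment> \<open>Finite paths are extended by state 0, which belongs to the state set, so
        that configurations on all of \<int> can be used throughout.\<close>
      define a' where "a' x = (if x \<in> {i0..i0 + int n} then a (nat (x - i0)) else 0)" for x
      define b' where "b' x = (if x \<in> {i0..i0 + int n} then b (nat (x - i0)) else 0)" for x
      have a': "a' (i0 + int i) = a i" and b': "b' (i0 + int i) = b i" if "i \<le> n" for i
        using that by (auto simp: a'_def b'_def)
      have a'1: "a' (i0 + int i + 1) = a (Suc i)" if "i < n" for i
        using a'[of "Suc i"] that by (simp add: add_ac)
      have le: "\<forall>x. a' x \<le> \<kappa>" "\<forall>x. b' x \<le> \<kappa>" using ab by (auto simp: a'_def b'_def)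
      have "{(S0, S1) \<in> space m. \<forall>i\<le>n. S0 (i0 + int i) = a i \<and> S1 (i0 + int i) = b i} =
          cyl \<kappa> {i0..i0 + int n} {i0..i0 + int n} a' b'"
        unfolding cyl[OF m, symmetric] using a' b' by (intro Collect_cong) auto
      moreover have "zigzag_weight D U \<rho> i0 n a' b' =
          \<rho> $ a 0 * (\<Prod>i<n. D $$ (a i, b i) * U $$ (b i, a (i + 1))) * D $$ (a n, b n)"
        unfolding zigzag_weight_def using a' b' a'1 a'[of 0] by simp
      ultimately show "measure m {(S0, S1) \<in> space m.
            \<forall>i\<le>n. S0 (i0 + int i) = a i \<and> S1 (i0 + int i) = b i}
        = \<rho> $ a 0 * (\<Prod>i<n. D $$ (a i, b i) * U $$ (b i, a (i + 1))) * D $$ (a n, b n)"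
        using R[THEN spec[of _ i0], THEN spec[of _ n], THEN spec[of _ a'], THEN spec[of _ b']] le by simp
    qed
  qed
  then show ?thesis unfolding hzmc_law_def by blast
qed

lemma hzmc_law_unique:
  assumes "hzmc_law \<kappa> D U \<rho> m" "hzmc_law \<kappa> D U \<rho> m'"
  shows "m = m'"
  using assms by (intro hz_measure_eqI[of _ \<kappa>]) (auto simp: hzmc_law_iff)

text \<open>Conditionally on \<open>S1\<close> the weight of a zigzag path factorizes over the sites of \<open>S0\<close>.\<close>

lemma hzmc_law_snd_marginal:
  assumes law: "hzmc_law \<kappa> D U \<rho> m" and b: "\<And>x. b x \<le> \<kappa>"
  shows "measure m (cyl \<kappa> {} {i0..i0 + int n} a b) = (\<Sum>s\<le>\<kappa>. \<rho> $ s * D $$ (s, b i0)) *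
    (\<Prod>i<n. \<Sum>s\<le>\<kappa>. U $$ (b (i0 + int i), s) * D $$ (s, b (i0 + int i + 1)))"
proof -
  let ?W = "{i0..i0 + int n}"
  have m: "m \<in> space (prob_algebra (hz_space \<kappa>))" using law by (simp add: hzmc_law_iff)
  \<comment> \<open>The factors of the weight are regrouped by the site of the first line they
    involve: the incoming U from b (x - 1), or \<rho> at the left end, together with the outgoing D
    to b x. Summing over the first line then becomes a product of separate sums.\<close>
  define h where "h x s = (if x = i0 then \<rho> $ s * D $$ (s, b x) else U $$ (b (x - 1), s) * D $$ (s, b x))" for x s
  have bij: "bij_betw (\<lambda>i. i0 + int i) {..n} ?W"
    by (rule bij_betw_byWitness[of _ "\<lambda>x. nat (x - i0)"]) auto
  have reindex: "(\<Prod>x\<in>?W. f x) = (\<Prod>i\<le>n. f (i0 + int i))" for f :: "int \<Rightarrow> real"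
    by (rule prod.reindex_bij_betw[OF bij, symmetric])
  have weight: "zigzag_weight D U \<rho> i0 n s b = (\<Prod>x\<in>?W. h x (s x))" for s
    unfolding reindex zigzag_weight_def
    by (induction n) (simp_all add: h_def algebra_simps)
  have "measure m (cyl \<kappa> ?W ?W s b) = (\<Prod>x\<in>?W. h x (s x))" if s: "s \<in> Pi\<^sub>E ?W (\<lambda>_. {..\<kappa>})" for s
  proof -
    \<comment> \<open>Extensional functions are undefined outside the window, so they are first
      replaced by a genuine configuration.\<close>
    define s' where "s' x = (if x \<in> ?W then s x else 0)" for x
    have s': "s' x \<le> \<kappa>" for x using s by (auto simp: s'_def PiE_def Pi_def)
    have "measure m (cyl \<kappa> ?W ?W s b) = measure m (cyl \<kappa> ?W ?W s' b)"
      by (intro arg_cong[where f="measure m"] cyl_cong) (auto simp: s'_def)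
    also have "\<dots> = (\<Prod>x\<in>?W. h x (s' x))"
      using law b s' unfolding weight[symmetric] hzmc_law_iff by blast
    also have "\<dots> = (\<Prod>x\<in>?W. h x (s x))"
      by (intro prod.cong) (auto simp: s'_def)
    finally show ?thesis .
  qed
  then have "measure m (cyl \<kappa> {} ?W a b) = (\<Sum>s\<in>Pi\<^sub>E ?W (\<lambda>_. {..\<kappa>}). \<Prod>x\<in>?W. h x (s x))"
    by (subst measure_cyl_split_fst[OF m, of ?W]) auto
  also have "\<dots> = (\<Prod>x\<in>?W. \<Sum>s\<le>\<kappa>. h x s)"
    by (rule prod_sum_PiE[symmetric]) auto
  also have "\<dots> = (\<Prod>i\<le>n. \<Sum>s\<le>\<kappa>. h (i0 + int i) s)" by (rule reindex)
  also have "\<dots> = (\<Sum>s\<le>\<kappa>. h i0 s) * (\<Prod>i<n. \<Sum>s\<le>\<kappa>. h (i0 + int (Suc i)) s)"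
    by (subst prod.atMost_shift) simp
  also have "\<dots> = (\<Sum>s\<le>\<kappa>. \<rho> $ s * D $$ (s, b i0)) *
      (\<Prod>i<n. \<Sum>s\<le>\<kappa>. U $$ (b (i0 + int i), s) * D $$ (s, b (i0 + int i + 1)))"
    by (simp add: h_def add_ac)
  finally show ?thesis .
qed

section \<open>Existence of the two-sided zigzag chain\<close>

fun fwd_path :: "(int \<times> nat \<Rightarrow> nat) \<Rightarrow> nat \<Rightarrow> nat" where
  "fwd_path w 0 = w (0, 0)"
| "fwd_path w (Suc n) = w (int n + 1, fwd_path w n)"

fun bwd_path :: "(int \<times> nat \<Rightarrow> nat) \<Rightarrow> nat \<Rightarrow> nat" where
  "bwd_path w 0 = w (0, 0)"
| "bwd_path w (Suc n) = w (- int n - 1, bwd_path w n)"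

text \<open>The chain is driven by independent update tables: \<open>w (k, s)\<close> is the state at time \<open>k\<close> given
  that the state at the neighbouring time closer to \<open>0\<close> is \<open>s\<close>. The entries at times \<open>k > 0\<close> follow
  the kernels, those at times \<open>k < 0\<close> the reversed kernels.\<close>

definition two_sided_path :: "(int \<times> nat \<Rightarrow> nat) \<Rightarrow> int \<Rightarrow> nat" where
  "two_sided_path w k = (if k \<ge> 0 then fwd_path w (nat k) else bwd_path w (nat (- k)))"

text \<open>Time 0 has no neighbour closer to 0; the dummy state 0 selects the table entry (0, 0),
  at which both path recursions start.\<close>

definition inner_state :: "(int \<Rightarrow> nat) \<Rightarrow> int \<Rightarrow> nat" where
  "inner_state x k = (if k > 0 then x (k - 1) else if k < 0 then x (k + 1) else 0)"

lemma two_sided_path_eq: "two_sided_path w k = w (k, inner_state (two_sided_path w) k)"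
proof -
  consider (zero) "k = 0" | (pos) n where "k = int n + 1" | (neg) n where "k = - int n - 1"
  proof (cases "k = 0")
    case False
    then have "k = int (nat (k - 1)) + 1 \<or> k = - int (nat (- k - 1)) - 1" by auto
    then show ?thesis using that by blast
  qed (use that in blast)
  then show ?thesis
  proof cases
    case pos
    then have "nat k = Suc n" by simp
    then show ?thesis using pos by (simp add: two_sided_path_def inner_state_def)
  next
    case neg
    then have "nat (- k) = Suc n" by simp
    moreover have "two_sided_path w (k + 1) = bwd_path w n"
      using neg by (cases n) (simp_all add: two_sided_path_def nat_add_distrib)
    moreover have "\<not> k \<ge> 0" "w (- int n - 1, s) = w (k, s)" for s using neg by auto
    ultimately show ?thesis by (simp add: two_sided_path_def[of w k] inner_state_def)
  qed (simp add: two_sided_path_def inner_state_def)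
qed

text \<open>On the event that the path follows x, the table entries consulted are known in advance,
  one for each time. The path event thus becomes a condition on distinct independent entries. The
  converse direction is an induction outward from time 0.\<close>

lemma two_sided_path_eq_iff:
  "(\<forall>k\<in>{- int N..int N}. two_sided_path w k = x k) \<longleftrightarrow>
   (\<forall>k\<in>{- int N..int N}. w (k, inner_state x k) = x k)" (is "?L \<longleftrightarrow> ?R")
proof
  have inner: "inner_state x k = inner_state y k"
    if "k \<noteq> 0 \<Longrightarrow> x (k - sgn k) = y (k - sgn k)" for x y :: "int \<Rightarrow> nat" and k
    using that by (auto simp: inner_state_def)
  have in_range: "k - sgn k \<in> {- int N..int N}" if "k \<in> {- int N..int N}" "k \<noteq> 0" for k
    using that by (auto simp: sgn_if)
  {
    assume L: ?L
    show ?R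
    proof
      fix k assume k: "k \<in> {- int N..int N}"
      have "inner_state x k = inner_state (two_sided_path w) k"
        using L in_range[OF k] by (intro inner) auto
      then show "w (k, inner_state x k) = x k" using two_sided_path_eq[of w k] L k by simp
    qed
  next
    assume R: ?R
    have "\<forall>k. nat \<bar>k\<bar> = n \<longrightarrow> k \<in> {- int N..int N} \<longrightarrow> two_sided_path w k = x k" for n :: nat
    proof (induction n)
      case 0
      have "two_sided_path w 0 = x 0"
        using bspec[OF R, of 0] two_sided_path_eq[of w 0] by (simp add: inner_state_def)
      then show ?case by auto
    next
      case (Suc n)
      show ?case
      proof (intro allI impI)
        fix k assume k: "nat \<bar>k\<bar> = Suc n" "k \<in> {- int N..int N}"
        then have "nat \<bar>k - sgn k\<bar> = n" "k \<noteq> 0" by (auto simp: sgn_if abs_if split: if_splits)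
        then have "two_sided_path w (k - sgn k) = x (k - sgn k)" using Suc in_range[OF k(2)] by blast
        then have "inner_state x k = inner_state (two_sided_path w) k" by (intro inner) simp
        then show "two_sided_path w k = x k" using two_sided_path_eq[of w k] bspec[OF R k(2)] by simp
      qed
    qed
    then show ?L by blast
  }
qed

text \<open>Kernels may depend on time so that D and U can alternate. A common stationary law makes
  \<rho> the one-time law at every time and the weight in every time reversal.\<close>

locale stationary_kernels =
  fixes \<kappa> :: nat and \<rho> :: "nat \<Rightarrow> real" and K :: "int \<Rightarrow> nat \<Rightarrow> nat \<Rightarrow> real"
  assumes pos: "i \<le> \<kappa> \<Longrightarrow> \<rho> i > 0"
    and sum1: "(\<Sum>i\<le>\<kappa>. \<rho> i) = 1"
    and nonneg: "i \<le> \<kappa> \<Longrightarrow> j \<le> \<kappa> \<Longrightarrow> K k i j \<ge> 0"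
    and row: "i \<le> \<kappa> \<Longrightarrow> (\<Sum>j\<le>\<kappa>. K k i j) = 1"
    and stationary: "j \<le> \<kappa> \<Longrightarrow> (\<Sum>i\<le>\<kappa>. \<rho> i * K k i j) = \<rho> j"
begin

text \<open>\<open>K k\<close> governs the transition from time k to k + 1, hence the shift by one
  for positive times and Bayes reversal with respect to \<rho> for negative ones. Time 0 and
  irrelevant states get \<rho>, so every entry has a probability law.\<close>

definition table :: "int \<times> nat \<Rightarrow> nat \<Rightarrow> real" where
  "table p c = (case p of (k, s) \<Rightarrow>
     if s \<le> \<kappa> \<and> k > 0 then K (k - 1) s c
     else if s \<le> \<kappa> \<and> k < 0 then \<rho> c * K k c s / \<rho> s
     else \<rho> c)"

lemma table_nonneg: "c \<le> \<kappa> \<Longrightarrow> table p c \<ge> 0"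
  using pos nonneg by (auto simp: table_def less_imp_le split: prod.split)

lemma table_sum: "(\<Sum>c\<le>\<kappa>. table p c) = 1"
proof -
  obtain k s where p: "p = (k, s)" by (cases p)
  have "(\<Sum>c\<le>\<kappa>. \<rho> c * K k c s / \<rho> s) = 1" if "s \<le> \<kappa>"
    using stationary[OF that] pos[OF that] by (simp flip: sum_divide_distrib)
  then show ?thesis
    using row[of s "k - 1"] sum1
    by (cases "s \<le> \<kappa>"; cases "k > 0"; cases "k < 0") (simp_all add: p table_def)
qed

abbreviation site :: "int \<times> nat \<Rightarrow> nat measure" where
  "site p \<equiv> point_measure {..\<kappa>} (\<lambda>c. ennreal (table p c))"

definition tables :: "(int \<times> nat \<Rightarrow> nat) measure" where
  "tables = Pi\<^sub>M UNIV site"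

lemma prob_space_site: "prob_space (site p)"
proof (rule prob_spaceI)
  have "(\<Sum>c\<le>\<kappa>. ennreal (table p c)) = ennreal (\<Sum>c\<le>\<kappa>. table p c)"
    using table_nonneg by (intro sum_ennreal) auto
  then show "emeasure (site p) (space (site p)) = 1"
    by (simp add: space_point_measure emeasure_point_measure_finite table_sum)
qed

lemma prob_space_tables: "prob_space tables"
  unfolding tables_def by (intro prob_space_PiM prob_space_site)

lemma space_tables: "space tables = {w. \<forall>p. w p \<le> \<kappa>}"
  by (auto simp: tables_def space_PiM space_point_measure PiE_def)

lemma measurable_table_entry: "(\<lambda>w. w p) \<in> tables \<rightarrow>\<^sub>M count_space UNIV"
proof -
  have "(\<lambda>w. w p) \<in> tables \<rightarrow>\<^sub>M site p"
    unfolding tables_def by (rule measurable_component_singleton) simp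
  moreover have "(\<lambda>c. c) \<in> site p \<rightarrow>\<^sub>M count_space UNIV"
    by (rule measurableI) (auto simp: sets_point_measure space_point_measure)
  ultimately show ?thesis by (rule measurable_compose)
qed

lemma measurable_two_sided_path: "(\<lambda>w. two_sided_path w k) \<in> tables \<rightarrow>\<^sub>M count_space UNIV"
proof -
  have "(\<lambda>w. fwd_path w n) \<in> tables \<rightarrow>\<^sub>M count_space UNIV" for n
    by (induction n)
      (auto intro: measurable_table_entry measurable_compose_countable[where f="\<lambda>s w. w (k, s)" for k])
  moreover have "(\<lambda>w. bwd_path w n) \<in> tables \<rightarrow>\<^sub>M count_space UNIV" for n
    by (induction n)
      (auto intro: measurable_table_entry measurable_compose_countable[where f="\<lambda>s w. w (k, s)" for k])
  ultimately show ?thesis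
    by (cases "k \<ge> 0") (simp_all add: two_sided_path_def)
qed

lemma two_sided_path_le: "w \<in> space tables \<Longrightarrow> two_sided_path w k \<le> \<kappa>"
  by (subst two_sided_path_eq) (simp add: space_tables)

definition path_event :: "int \<Rightarrow> int \<Rightarrow> (int \<Rightarrow> nat) \<Rightarrow> (int \<times> nat \<Rightarrow> nat) set" where
  "path_event p q x = {w \<in> space tables. \<forall>k\<in>{p..q}. two_sided_path w k = x k}"

lemma sets_path_event: "path_event p q x \<in> sets tables"
proof -
  have "{w \<in> space tables. two_sided_path w k = x k} \<in> sets tables" for k
  proof -
    have "(\<lambda>w. two_sided_path w k) -` {x k} \<inter> space tables \<in> sets tables"
      by (rule measurable_sets[OF measurable_two_sided_path]) simp
    moreover have "(\<lambda>w. two_sided_path w k) -` {x k} \<inter> space tables = {w \<in> space tables. two_sided_path w k = x k}"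
      by auto
    ultimately show ?thesis by simp
  qed
  then show ?thesis
    unfolding path_event_def by (intro sets.sets_Collect_finite_All) auto
qed

text \<open>Independence of the table entries gives a product. Each extension to the left
  contributes a reversed kernel whose denominator cancels the previous initial weight, moving \<rho>
  to the new left end.\<close>

lemma measure_path_event_symmetric:
  assumes x: "\<And>k. x k \<le> \<kappa>"
  shows "measure tables (path_event (- int N) (int N) x) =
    \<rho> (x (- int N)) * (\<Prod>k\<in>{- int N..<int N}. K k (x k) (x (k + 1)))"
proof -
  interpret prob_space tables by (rule prob_space_tables)
  let ?W = "{- int N..int N}"
  let ?f = "\<lambda>k. (k, inner_state x k)"
  have inj: "inj_on ?f ?W" by (auto simp: inj_on_def)
  have "path_event (- int N) (int N) x = prod_emb UNIV site (?f ` ?W) (Pi\<^sub>E (?f ` ?W) (\<lambda>p. {x (fst p)}))"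
    unfolding path_event_def two_sided_path_eq_iff
    by (auto simp: space_tables prod_emb_def space_point_measure PiE_def Pi_def)
  then have "emeasure tables (path_event (- int N) (int N) x) = (\<Prod>p\<in>?f ` ?W. emeasure (site p) {x (fst p)})"
    unfolding tables_def using x
    by (simp add: emeasure_PiM_emb[OF prob_space_site] sets_point_measure)
  also have "\<dots> = (\<Prod>k\<in>?W. emeasure (site (?f k)) {x k})"
    by (subst prod.reindex[OF inj]) simp
  also have "\<dots> = (\<Prod>k\<in>?W. ennreal (table (?f k) (x k)))"
    using x by (intro prod.cong) (auto simp: emeasure_point_measure_finite)
  also have "\<dots> = ennreal (\<Prod>k\<in>?W. table (?f k) (x k))"
    using x table_nonneg by (intro prod_ennreal) auto
  finally have "measure tables (path_event (- int N) (int N) x) = (\<Prod>k\<in>?W. table (?f k) (x k))"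
    unfolding emeasure_eq_measure using x table_nonneg by (simp add: prod_nonneg)
  also have "\<dots> = \<rho> (x (- int N)) * (\<Prod>k\<in>{- int N..<int N}. K k (x k) (x (k + 1)))"
  proof (induction N)
    case 0
    then show ?case by (simp add: table_def inner_state_def)
  next
    case (Suc N)
    let ?n = "int N"
    define l where "l = - ?n - 1"
    have l: "l + 1 = - ?n" "- int (Suc N) = l" "l < - ?n" "l < 0" by (auto simp: l_def)
    have 1: "{l..int (Suc N)} = insert l (insert (?n + 1) {- ?n..?n})"
      and 2: "{l..<int (Suc N)} = insert l (insert ?n {- ?n..<?n})"
      by (auto simp: l_def)
    have t: "table (?f (?n + 1)) (x (?n + 1)) = K ?n (x ?n) (x (?n + 1))"
      "table (?f l) (x l) = \<rho> (x l) * K l (x l) (x (- ?n)) / \<rho> (x (- ?n))"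
      using x l by (auto simp: table_def inner_state_def)
    have "(\<Prod>k\<in>{l..int (Suc N)}. table (?f k) (x k)) =
        table (?f l) (x l) * (table (?f (?n + 1)) (x (?n + 1)) * (\<Prod>k\<in>{- ?n..?n}. table (?f k) (x k)))"
      unfolding 1 using l by (subst prod.insert, simp, simp, subst prod.insert) auto
    also have "\<dots> = \<rho> (x l) * (K l (x l) (x (- ?n)) *
        (K ?n (x ?n) (x (?n + 1)) * (\<Prod>k\<in>{- ?n..<?n}. K k (x k) (x (k + 1)))))"
      unfolding t Suc using pos[OF x, of "- ?n"] by simp
    also have "\<dots> = \<rho> (x l) * (\<Prod>k\<in>{l..<int (Suc N)}. K k (x k) (x (k + 1)))"
      unfolding 2 using l by (subst prod.insert, simp, simp, subst prod.insert) auto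
    finally have ?case if "- int (Suc N) = l" unfolding that .
    then show ?case using l(2) by blast
  qed
  finally show ?thesis .
qed

definition chain_on :: "int \<Rightarrow> int \<Rightarrow> bool" where
  "chain_on p q \<longleftrightarrow> (\<forall>x. (\<forall>k. x k \<le> \<kappa>) \<longrightarrow>
     measure tables (path_event p q x) = \<rho> (x p) * (\<Prod>k\<in>{p..<q}. K k (x k) (x (k + 1))))"

lemma measure_path_event_split:
  assumes "{p'..q'} = insert k {p..q}" "k \<notin> {p..q}"
  shows "measure tables (path_event p q x) = (\<Sum>s\<le>\<kappa>. measure tables (path_event p' q' (x(k := s))))"
proof -
  interpret prob_space tables by (rule prob_space_tables)
  have "path_event p q x = (\<Union>s\<in>{..\<kappa>}. path_event p' q' (x(k := s)))"
    using assms two_sided_path_le by (auto simp: path_event_def)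
  moreover have "disjoint_family_on (\<lambda>s. path_event p' q' (x(k := s))) {..\<kappa>}"
    using assms by (auto simp: disjoint_family_on_def path_event_def)
  ultimately show ?thesis
    by (simp add: finite_measure_finite_Union image_subset_iff sets_path_event)
qed

text \<open>The last state is summed out using that rows of the kernel sum to 1.\<close>

lemma chain_on_shrink_right:
  assumes "p \<le> q" "chain_on p (q + 1)"
  shows "chain_on p q"
  unfolding chain_on_def
proof (intro allI impI)
  fix x :: "int \<Rightarrow> nat" assume x: "\<forall>k. x k \<le> \<kappa>"
  have ivl: "{p..<q + 1} = insert q {p..<q}" using assms(1) by auto
  have "measure tables (path_event p q x) = (\<Sum>s\<le>\<kappa>. measure tables (path_event p (q + 1) (x(q + 1 := s))))"
    using assms(1) by (intro measure_path_event_split) auto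
  also have "\<dots> = (\<Sum>s\<le>\<kappa>. \<rho> (x p) * (\<Prod>k\<in>{p..<q}. K k (x k) (x (k + 1))) * K q (x q) s)"
  proof (intro sum.cong refl)
    fix s assume s: "s \<in> {..\<kappa>}"
    define y where "y = x(q + 1 := s)"
    have y: "y (q + 1) = s" "\<And>k. k \<in> {p..q} \<Longrightarrow> y k = x k" by (auto simp: y_def)
    have "\<forall>k. y k \<le> \<kappa>" using x s by (simp add: y_def)
    then have "measure tables (path_event p (q + 1) y) = \<rho> (y p) * (\<Prod>k\<in>{p..<q + 1}. K k (y k) (y (k + 1)))"
      by (rule assms(2)[unfolded chain_on_def, THEN spec, THEN mp])
    also have "\<dots> = \<rho> (x p) * (K q (x q) s * (\<Prod>k\<in>{p..<q}. K k (y k) (y (k + 1))))"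
      unfolding ivl using assms(1) y by (subst prod.insert) auto
    also have "(\<Prod>k\<in>{p..<q}. K k (y k) (y (k + 1))) = (\<Prod>k\<in>{p..<q}. K k (x k) (x (k + 1)))"
      using y(2) by (intro prod.cong) auto
    finally show "measure tables (path_event p (q + 1) (x(q + 1 := s))) = \<rho> (x p) * (\<Prod>k\<in>{p..<q}. K k (x k) (x (k + 1))) * K q (x q) s"
      unfolding y_def by (simp only: mult_ac)
  qed
  also have "\<dots> = \<rho> (x p) * (\<Prod>k\<in>{p..<q}. K k (x k) (x (k + 1)))"
    using row[of "x q" q] x by (simp flip: sum_distrib_left)
  finally show "measure tables (path_event p q x) = \<rho> (x p) * (\<Prod>k\<in>{p..<q}. K k (x k) (x (k + 1)))" .
qed

text \<open>The first state is summed out using stationarity, which moves \<rho> one time to the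
  right.\<close>

lemma chain_on_shrink_left:
  assumes "p \<le> q" "chain_on (p - 1) q"
  shows "chain_on p q"
  unfolding chain_on_def
proof (intro allI impI)
  fix x :: "int \<Rightarrow> nat" assume x: "\<forall>k. x k \<le> \<kappa>"
  have ivl: "{p - 1..<q} = insert (p - 1) {p..<q}" using assms(1) by auto
  have "measure tables (path_event p q x) = (\<Sum>s\<le>\<kappa>. measure tables (path_event (p - 1) q (x(p - 1 := s))))"
    using assms(1) by (intro measure_path_event_split) auto
  also have "\<dots> = (\<Sum>s\<le>\<kappa>. \<rho> s * K (p - 1) s (x p) * (\<Prod>k\<in>{p..<q}. K k (x k) (x (k + 1))))"
  proof (intro sum.cong refl)
    fix s assume s: "s \<in> {..\<kappa>}"
    define y where "y = x(p - 1 := s)"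
    have y: "y (p - 1) = s" "\<And>k. k \<in> {p..q} \<Longrightarrow> y k = x k" by (auto simp: y_def)
    have "\<forall>k. y k \<le> \<kappa>" using x s by (simp add: y_def)
    then have "measure tables (path_event (p - 1) q y) = \<rho> (y (p - 1)) * (\<Prod>k\<in>{p - 1..<q}. K k (y k) (y (k + 1)))"
      by (rule assms(2)[unfolded chain_on_def, THEN spec, THEN mp])
    also have "\<dots> = \<rho> s * (K (p - 1) s (x p) * (\<Prod>k\<in>{p..<q}. K k (y k) (y (k + 1))))"
      unfolding ivl using assms(1) y by (subst prod.insert) auto
    also have "(\<Prod>k\<in>{p..<q}. K k (y k) (y (k + 1))) = (\<Prod>k\<in>{p..<q}. K k (x k) (x (k + 1)))"
      using y(2) by (intro prod.cong) auto
    finally show "measure tables (path_event (p - 1) q (x(p - 1 := s))) = \<rho> s * K (p - 1) s (x p) * (\<Prod>k\<in>{p..<q}. K k (x k) (x (k + 1)))"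
      unfolding y_def by (simp only: mult_ac)
  qed
  also have "\<dots> = \<rho> (x p) * (\<Prod>k\<in>{p..<q}. K k (x k) (x (k + 1)))"
    using stationary[of "x p" "p - 1"] x by (simp flip: sum_distrib_right)
  finally show "measure tables (path_event p q x) = \<rho> (x p) * (\<Prod>k\<in>{p..<q}. K k (x k) (x (k + 1)))" .
qed

text \<open>Every interval lies in a symmetric one, where the formula is known, and is reached from
  it by removing end points on the right and then on the left.\<close>

lemma chain_on:
  assumes "p \<le> q"
  shows "chain_on p q"
proof -
  define N where "N = nat (max \<bar>p\<bar> \<bar>q\<bar>)"
  have N: "- int N \<le> p" "q \<le> int N" by (auto simp: N_def)
  have r: "chain_on a (b + int j) \<Longrightarrow> chain_on a b" if "a \<le> b" for a b j
  proof (induction j)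
    case (Suc j)
    have "chain_on a (b + int j + 1)" using Suc.prems by (simp add: ac_simps)
    then have "chain_on a (b + int j)" by (rule chain_on_shrink_right[rotated]) (use that in simp)
    then show ?case by (rule Suc.IH)
  qed simp
  have l: "chain_on (a - int j) b \<Longrightarrow> chain_on a b" if "a \<le> b" for a b j
  proof (induction j)
    case (Suc j)
    have "a - int (Suc j) = a - int j - 1" by simp
    then have "chain_on (a - int j - 1) b" using Suc.prems by (simp only:)
    then have "chain_on (a - int j) b" by (rule chain_on_shrink_left[rotated]) (use that in simp)
    then show ?case by (rule Suc.IH)
  qed simp
  have "chain_on (- int N) (int N)"
    unfolding chain_on_def by (intro allI impI measure_path_event_symmetric) simp
  then have "chain_on (- int N) q"
    using r[of "- int N" q "nat (int N - q)"] N assms by simp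
  then show ?thesis
    using l[of p q "nat (p + int N)"] N assms by simp
qed

end

text \<open>The zigzag is read as one path: even times 2x carry the first line at x and odd times 2x
  + 1 the second, so D acts from even times and U from odd ones. Invariance of \<rho> under each
  kernel separately makes this a stationary system.\<close>

lemma hzmc_law_exists:
  assumes D: "markov_kernel \<kappa> D" and U: "markov_kernel \<kappa> U" and inv: "invariant_prob \<kappa> (D * U) \<rho>"
    and pos: "\<And>i. i \<le> \<kappa> \<Longrightarrow> \<rho> $ i > 0"
    and \<rho>D: "\<And>j. j \<le> \<kappa> \<Longrightarrow> (\<Sum>i\<le>\<kappa>. \<rho> $ i * D $$ (i, j)) = \<rho> $ j"
    and \<rho>U: "\<And>j. j \<le> \<kappa> \<Longrightarrow> (\<Sum>i\<le>\<kappa>. \<rho> $ i * U $$ (i, j)) = \<rho> $ j"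
  shows "\<exists>m. hzmc_law \<kappa> D U \<rho> m"
proof -
  define K where "K k i j = (if even k then D $$ (i, j) else U $$ (i, j))" for k :: int and i j
  interpret stationary_kernels \<kappa> "\<lambda>i. \<rho> $ i" K
  proof
    show "(\<Sum>i\<le>\<kappa>. \<rho> $ i) = 1" using inv by (simp add: invariant_prob_def prob_vec_def)
    show "(\<Sum>j\<le>\<kappa>. K k i j) = 1" if "i \<le> \<kappa>" for i k
      using D U that by (cases "even k") (simp_all add: K_def markov_kernel_def)
    show "(\<Sum>i\<le>\<kappa>. \<rho> $ i * K k i j) = \<rho> $ j" if "j \<le> \<kappa>" for j k
      using \<rho>D[OF that] \<rho>U[OF that] by (cases "even k") (simp_all add: K_def)
  qed (use pos D U in \<open>simp_all add: K_def markov_kernel_def\<close>)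
  interpret prob_space tables by (rule prob_space_tables)
  define split where "split w = (\<lambda>x. two_sided_path w (2 * x), \<lambda>x. two_sided_path w (2 * x + 1))" for w
  have line: "(\<lambda>w x. two_sided_path w (f x)) \<in> tables \<rightarrow>\<^sub>M line_space \<kappa>" for f :: "int \<Rightarrow> int"
    unfolding line_space_def
  proof (rule measurable_PiM_single'[where f="\<lambda>x w. two_sided_path w (f x)"])
    show "(\<lambda>w. two_sided_path w (f x)) \<in> tables \<rightarrow>\<^sub>M count_space {..\<kappa>}" for x
    proof (rule measurableI)
      show "two_sided_path w (f x) \<in> space (count_space {..\<kappa>})" if "w \<in> space tables" for w
        using two_sided_path_le[OF that] by simp
      show "(\<lambda>w. two_sided_path w (f x)) -` A \<inter> space tables \<in> sets tables" for A
        by (rule measurable_sets[OF measurable_two_sided_path]) simp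
    qed
    show "(\<lambda>w x. two_sided_path w (f x)) \<in> space tables \<rightarrow> Pi\<^sub>E UNIV (\<lambda>i. space (count_space {..\<kappa>}))"
      using two_sided_path_le by (auto simp: PiE_def)
  qed
  have split: "split \<in> tables \<rightarrow>\<^sub>M hz_space \<kappa>"
    unfolding split_def[abs_def] hz_space_def by (intro measurable_Pair line)
  define m where "m = distr tables (hz_space \<kappa>) split"
  have "prob_space m" unfolding m_def by (rule prob_space_distr[OF split])
  then have m: "m \<in> space (prob_algebra (hz_space \<kappa>))"
    by (simp add: space_prob_algebra m_def)
  have "measure m (cyl \<kappa> {i0..i0 + int n} {i0..i0 + int n} a b) = zigzag_weight D U \<rho> i0 n a b"
    if ab: "\<forall>x. a x \<le> \<kappa>" "\<forall>x. b x \<le> \<kappa>" for i0 n a b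
  proof -
    define z where "z k = (if even k then a (k div 2) else b (k div 2))" for k :: int
    have z: "\<forall>k. z k \<le> \<kappa>" using ab by (simp add: z_def)
    have "measure m (cyl \<kappa> {i0..i0 + int n} {i0..i0 + int n} a b) =
        measure tables (split -` cyl \<kappa> {i0..i0 + int n} {i0..i0 + int n} a b \<inter> space tables)"
      unfolding m_def by (rule measure_distr[OF split]) auto
    also have "split -` cyl \<kappa> {i0..i0 + int n} {i0..i0 + int n} a b \<inter> space tables =
        path_event (2 * i0) (2 * i0 + 2 * int n + 1) z"
    proof -
      have range: "(\<forall>k\<in>{2 * i0..2 * i0 + 2 * int n + 1}. P k) \<longleftrightarrow>
          (\<forall>x\<in>{i0..i0 + int n}. P (2 * x)) \<and> (\<forall>x\<in>{i0..i0 + int n}. P (2 * x + 1))" for P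
      proof (intro iffI conjI ballI)
        fix k assume P: "(\<forall>x\<in>{i0..i0 + int n}. P (2 * x)) \<and> (\<forall>x\<in>{i0..i0 + int n}. P (2 * x + 1))"
          and k: "k \<in> {2 * i0..2 * i0 + 2 * int n + 1}"
        have "k div 2 \<in> {i0..i0 + int n}" using k by auto
        then have "P (2 * (k div 2))" "P (2 * (k div 2) + 1)" using P by blast+
        moreover have "k = 2 * (k div 2) \<or> k = 2 * (k div 2) + 1" by presburger
        ultimately show "P k" by metis
      qed auto
      have "split w \<in> space (hz_space \<kappa>)" if "w \<in> space tables" for w
        by (rule measurable_space[OF split that])
      then show ?thesis
        unfolding path_event_def cyl_def range by (auto simp: split_def z_def)
    qed
    also have "measure tables \<dots> = \<rho> $ z (2 * i0) *
        (\<Prod>k\<in>{2 * i0..<2 * i0 + 2 * int n + 1}. K k (z k) (z (k + 1)))"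
    proof -
      have "chain_on (2 * i0) (2 * i0 + 2 * int n + 1)" by (rule chain_on) simp
      then show ?thesis using z unfolding chain_on_def by simp
    qed
    also have "\<dots> = zigzag_weight D U \<rho> i0 n a b"
    proof (induction n)
      case 0
      have "{2 * i0..<2 * i0 + 1} = {2 * i0}" by auto
      then show ?case by (simp add: zigzag_weight_def z_def K_def)
    next
      case (Suc n)
      \<comment> \<open>One more site means two more times: the odd time l leads by U to the next
        site of the first line, and l + 1 leads by D to the second line.\<close>
      define l where "l = 2 * i0 + 2 * int n + 1"
      have l: "l div 2 = i0 + int n" "(l + 1) div 2 = i0 + int n + 1" "(l + 2) div 2 = i0 + int n + 1"
        "odd l" "2 * i0 < l"
        by (auto simp: l_def)
      have "{2 * i0..<2 * i0 + 2 * int (Suc n) + 1} = insert (l + 1) (insert l {2 * i0..<l})"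
        by (auto simp: l_def)
      then have "(\<Prod>k\<in>{2 * i0..<2 * i0 + 2 * int (Suc n) + 1}. K k (z k) (z (k + 1))) =
          K (l + 1) (z (l + 1)) (z (l + 2)) * (K l (z l) (z (l + 1)) * (\<Prod>k\<in>{2 * i0..<l}. K k (z k) (z (k + 1))))"
        by (simp add: add_ac)
      also have "K (l + 1) (z (l + 1)) (z (l + 2)) = D $$ (a (i0 + int n + 1), b (i0 + int n + 1))"
        using l by (simp add: K_def z_def)
      also have "K l (z l) (z (l + 1)) = U $$ (b (i0 + int n), a (i0 + int n + 1))"
        using l by (simp add: K_def z_def)
      finally have "\<rho> $ z (2 * i0) * (\<Prod>k\<in>{2 * i0..<2 * i0 + 2 * int (Suc n) + 1}. K k (z k) (z (k + 1))) =
          (\<rho> $ z (2 * i0) * (\<Prod>k\<in>{2 * i0..<l}. K k (z k) (z (k + 1)))) *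
          (U $$ (b (i0 + int n), a (i0 + int n + 1)) * D $$ (a (i0 + int n + 1), b (i0 + int n + 1)))"
        by simp
      also have "\<dots> = zigzag_weight D U \<rho> i0 n a b *
          (U $$ (b (i0 + int n), a (i0 + int n + 1)) * D $$ (a (i0 + int n + 1), b (i0 + int n + 1)))"
        unfolding l_def Suc ..
      also have "\<dots> = zigzag_weight D U \<rho> i0 (Suc n) a b"
        by (simp add: zigzag_weight_def ac_simps)
      finally show ?case .
    qed
    finally show ?thesis .
  qed
  then show ?thesis
    using D U inv m unfolding hzmc_law_iff by blast
qed

section \<open>Invariant zigzag Markov chains\<close>

lemma markov_kernel_mult_row_sum:
  assumes K: "markov_kernel n K" and L: "markov_kernel n L" and i: "i \<le> n"
  shows "(\<Sum>j\<le>n. (K * L) $$ (i, j)) = 1"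
proof -
  have c: "K \<in> carrier_mat (n + 1) (n + 1)" "L \<in> carrier_mat (n + 1) (n + 1)"
    using K L by (auto simp: markov_kernel_def)
  have "(\<Sum>j\<le>n. (K * L) $$ (i, j)) = (\<Sum>j\<le>n. \<Sum>s\<le>n. K $$ (i, s) * L $$ (s, j))"
    using i by (intro sum.cong refl index_mult_mat_sum[OF c]) auto
  also have "\<dots> = (\<Sum>s\<le>n. K $$ (i, s) * (\<Sum>j\<le>n. L $$ (s, j)))"
    by (subst sum.swap) (simp add: sum_distrib_left)
  also have "\<dots> = 1" using K L i by (simp add: markov_kernel_def)
  finally show ?thesis .
qed

section \<open>Necessity: an invariant zigzag chain determines its kernels\<close>

context positive_pca
begin

lemma invariant_hzmc_determined:
  assumes law: "hzmc_law \<kappa> D U p m" and pos: "\<And>a b. a \<le> \<kappa> \<Longrightarrow> b \<le> \<kappa> \<Longrightarrow> (D * U) $$ (a, b) > 0"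
    and inv: "pca_invariant \<kappa> T m"
  shows "product_condition \<kappa> T \<and> D\<gamma> = D \<and> U\<gamma> = U \<and> D * U = U * D"
proof -
  have D: "markov_kernel \<kappa> D" and U: "markov_kernel \<kappa> U" and p: "invariant_prob \<kappa> (D * U) p"
    and m: "m \<in> space (prob_algebra (hz_space \<kappa>))"
    and law_cyl: "\<And>i0 n a b. \<forall>x. a x \<le> \<kappa> \<Longrightarrow> \<forall>x. b x \<le> \<kappa> \<Longrightarrow>
      measure m (cyl \<kappa> {i0..i0 + int n} {i0..i0 + int n} a b) = zigzag_weight D U p i0 n a b"
    using law by (simp_all add: hzmc_law_iff)
  have Dc: "D \<in> carrier_mat (\<kappa> + 1) (\<kappa> + 1)" and Uc: "U \<in> carrier_mat (\<kappa> + 1) (\<kappa> + 1)"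
    and row: "\<And>a. a \<le> \<kappa> \<Longrightarrow> (\<Sum>b\<le>\<kappa>. D $$ (a, b)) = 1" "\<And>a. a \<le> \<kappa> \<Longrightarrow> (\<Sum>b\<le>\<kappa>. U $$ (a, b)) = 1"
    using D U by (auto simp: markov_kernel_def)
  have DUc: "D * U \<in> carrier_mat (\<kappa> + 1) (\<kappa> + 1)" and UDc: "U * D \<in> carrier_mat (\<kappa> + 1) (\<kappa> + 1)"
    using Dc Uc by auto
  \<comment> \<open>q is the one-site law of the second line. It is not yet known to equal p, so it
    is kept separate.\<close>
  define q where "q a = (\<Sum>s\<le>\<kappa>. p $ s * D $$ (s, a))" for a
  have key: "p $ a * (D $$ (a, c) * U $$ (c, b)) = q a * (U * D) $$ (a, b) * T a b c"
    if le: "a \<le> \<kappa>" "b \<le> \<kappa>" "c \<le> \<kappa>" for a b c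
  proof -
    define x where "x i = (if i = 0 then a else b)" for i :: int
    \<comment> \<open>The second line at site 1 only completes the rectangular window on which the
      zigzag law is given; its value s is summed out by stochasticity of D.\<close>
    define y where "y s = (\<lambda>_ :: int. c)(1 := s)" for s :: nat
    have x: "\<forall>i. x i \<le> \<kappa>" using le by (simp add: x_def)
    have W: "{0, 1} = {0..0 + int 1}" by auto
    have UD: "(U * D) $$ (a, b) = (\<Sum>s\<le>\<kappa>. U $$ (a, s) * D $$ (s, b))"
      by (rule index_mult_mat_sum[OF Uc Dc le(1,2)])
    have "measure (pca_image \<kappa> T m) (cyl \<kappa> {0, 1} {0} x (\<lambda>_. c)) =
        measure m (cyl \<kappa> {} {0, 1} (\<lambda>_. 0) x) * T a b c"
      using x le by (subst measure_pca_image_cyl[OF T m]) (auto simp: x_def)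
    also have "measure m (cyl \<kappa> {} {0, 1} (\<lambda>_. 0) x) = q a * (U * D) $$ (a, b)"
      unfolding W using x by (subst hzmc_law_snd_marginal[OF law]) (auto simp: q_def UD x_def)
    finally have image: "measure m (cyl \<kappa> {0, 1} {0} x (\<lambda>_. c)) = q a * (U * D) $$ (a, b) * T a b c"
      using inv by (simp only: pca_invariant_def)
    have "measure m (cyl \<kappa> {0, 1} {0} x (\<lambda>_. c)) = (\<Sum>s\<le>\<kappa>. measure m (cyl \<kappa> {0, 1} {0, 1} x (y s)))"
      by (subst measure_cyl_split_insert_snd[OF m, of _ _ 1]) (auto simp: y_def insert_commute)
    also have "\<dots> = (\<Sum>s\<le>\<kappa>. p $ a * (D $$ (a, c) * U $$ (c, b)) * D $$ (b, s))"
    proof (intro sum.cong refl)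
      fix s assume "s \<in> {..\<kappa>}"
      then have "\<forall>i. y s i \<le> \<kappa>" using le by (simp add: y_def)
      moreover have "zigzag_weight D U p 0 1 x (y s) = p $ a * (D $$ (a, c) * U $$ (c, b)) * D $$ (b, s)"
        by (simp add: zigzag_weight_def x_def y_def)
      ultimately show "measure m (cyl \<kappa> {0, 1} {0, 1} x (y s)) = p $ a * (D $$ (a, c) * U $$ (c, b)) * D $$ (b, s)"
        unfolding W using law_cyl[OF x, of "y s" 0 1] by simp
    qed
    also have "\<dots> = p $ a * (D $$ (a, c) * U $$ (c, b))"
      using row(1)[OF le(2)] by (simp only: sum_distrib_left[symmetric] mult_1_right)
    finally show ?thesis unfolding image ..
  qed
  have q_eq: "p $ a * (D * U) $$ (a, b) = q a * (U * D) $$ (a, b)" if le: "a \<le> \<kappa>" "b \<le> \<kappa>" for a b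
  proof -
    have "p $ a * (D * U) $$ (a, b) = (\<Sum>c\<le>\<kappa>. p $ a * (D $$ (a, c) * U $$ (c, b)))"
      unfolding index_mult_mat_sum[OF Dc Uc le] by (rule sum_distrib_left)
    also have "\<dots> = (\<Sum>c\<le>\<kappa>. q a * (U * D) $$ (a, b) * T a b c)"
      using le by (intro sum.cong refl key) auto
    also have "\<dots> = q a * (U * D) $$ (a, b) * (\<Sum>c\<le>\<kappa>. T a b c)" by (rule sum_distrib_left[symmetric])
    finally show ?thesis using T_sum[OF le] by (simp only: mult_1_right)
  qed
  have p_eq: "p $ a = q a" if a: "a \<le> \<kappa>" for a
  proof -
    have "p $ a = p $ a * (\<Sum>b\<le>\<kappa>. (D * U) $$ (a, b))" using markov_kernel_mult_row_sum[OF D U a] by simp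
    also have "\<dots> = (\<Sum>b\<le>\<kappa>. q a * (U * D) $$ (a, b))"
      unfolding sum_distrib_left using a by (intro sum.cong refl q_eq) auto
    also have "\<dots> = q a * (\<Sum>b\<le>\<kappa>. (U * D) $$ (a, b))" by (rule sum_distrib_left[symmetric])
    finally show ?thesis using markov_kernel_mult_row_sum[OF U D a] by simp
  qed
  \<comment> \<open>Division by p is needed next, and p = p DU with DU entrywise positive rules out
    zero entries.\<close>
  have p_pos: "p $ a > 0" if a: "a \<le> \<kappa>" for a
  proof -
    note p_unfold = p[unfolded invariant_prob_iff_sum[OF DUc] prob_vec_def]
    have p': "\<forall>i\<le>\<kappa>. p $ i \<ge> 0" "(\<Sum>i\<le>\<kappa>. p $ i) = 1"
      using conjunct1[OF p_unfold] by blast+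
    have p_DU: "(\<Sum>i\<le>\<kappa>. p $ i * (D * U) $$ (i, a)) = p $ a"
      by (rule conjunct2[OF p_unfold, rule_format, OF a])
    have "\<exists>k\<in>{..\<kappa>}. p $ k \<noteq> 0"
      using p'(2) by (metis sum.neutral zero_neq_one)
    then obtain k where k: "k \<le> \<kappa>" "p $ k \<noteq> 0" by auto
    have "0 < (\<Sum>i\<le>\<kappa>. p $ i * (D * U) $$ (i, a))"
    proof (rule sum_pos2[of _ k])
      show "0 < p $ k * (D * U) $$ (k, a)" using k p'(1) pos[OF k(1) a] by (simp add: order_less_le del: index_mult_mat)
      show "0 \<le> p $ i * (D * U) $$ (i, a)" if "i \<in> {..\<kappa>}" for i
        using that p'(1) pos[of i a] a by (simp del: index_mult_mat)
    qed (use k in auto)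
    then show ?thesis unfolding p_DU .
  qed
  have "(D * U) $$ (a, b) = (U * D) $$ (a, b)" if "a \<le> \<kappa>" "b \<le> \<kappa>" for a b
    using q_eq[OF that] p_pos[OF that(1)] p_eq[OF that(1)] by (simp del: index_mult_mat)
  then have comm: "D * U = U * D" by (rule eq_mat_atMost[OF DUc UDc])
  have eq: "D $$ (a, c) * U $$ (c, b) = (D * U) $$ (a, b) * T a b c" if "a \<le> \<kappa>" "b \<le> \<kappa>" "c \<le> \<kappa>" for a b c
  proof -
    have "p $ a * (D $$ (a, c) * U $$ (c, b)) = p $ a * ((D * U) $$ (a, b) * T a b c)"
      using key[OF that] unfolding comm p_eq[OF that(1)] mult.assoc .
    then show ?thesis using p_pos[OF that(1)] by (simp only: mult_cancel_left) simp
  qed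
  have "product_condition \<kappa> T \<and> D\<gamma> = D \<and> U\<gamma> = U"
    by (rule kernels_determined[OF D U _ comm]) (rule pos eq; assumption)+
  then show ?thesis using comm by (elim conjE) (intro conjI)
qed

section \<open>Sufficiency: invariance of the zigzag chain built from \<gamma>\<close>

context
  assumes prod: "product_condition \<kappa> T" and comm: "D\<gamma> * U\<gamma> = U\<gamma> * D\<gamma>"
begin

lemma rho_invariant_D: "invariant_prob \<kappa> D\<gamma> \<rho>"
  by (rule invariant_prob_commuting[OF D_carrier markov_D U_carrier comm square_pos_DU[OF prod]
    rho_invariant_DU[OF prod] rho_pos])

lemma rho_invariant_U: "invariant_prob \<kappa> U\<gamma> \<rho>"
  by (rule invariant_prob_commuting[OF U_carrier markov_U[OF prod] D_carrier comm[symmetric]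
    square_pos_DU[OF prod, unfolded comm] rho_invariant_DU[OF prod, unfolded comm] rho_pos])

lemma rho_D: "j \<le> \<kappa> \<Longrightarrow> (\<Sum>i\<le>\<kappa>. \<rho> $ i * D\<gamma> $$ (i, j)) = \<rho> $ j"
  using rho_invariant_D unfolding invariant_prob_iff_sum[OF D_carrier] by blast

lemma rho_U: "j \<le> \<kappa> \<Longrightarrow> (\<Sum>i\<le>\<kappa>. \<rho> $ i * U\<gamma> $$ (i, j)) = \<rho> $ j"
  using rho_invariant_U unfolding invariant_prob_iff_sum[OF U_carrier] by blast

text \<open>The second line is a chain with kernel UD = DU, and each factor T_(a,b),c turns a
  transition (DU)_ab into D_ac U_cb. The image law thus has zigzag weights, and these determine the
  law.\<close>

lemma pca_invariant_hzmc:
  assumes law: "hzmc_law \<kappa> D\<gamma> U\<gamma> \<rho> m"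
  shows "pca_invariant \<kappa> T m"
proof -
  have m: "m \<in> space (prob_algebra (hz_space \<kappa>))" using law by (simp add: hzmc_law_iff)
  note m' = pca_image_prob_algebra[OF T m]
  have cyl_law: "measure (pca_image \<kappa> T m) (cyl \<kappa> {i0..i0 + int n} {i0..i0 + int n} a c) = zigzag_weight D\<gamma> U\<gamma> \<rho> i0 n a c"
    if a: "\<forall>x. a x \<le> \<kappa>" and c: "\<forall>x. c x \<le> \<kappa>" for i0 n a c
  proof -
    \<comment> \<open>Updating the last site of the window requires its right neighbour
      \<open>?e\<close>. The state there is introduced temporarily and summed out at the end through
      the extra factor of U.\<close>
    let ?J = "{i0..i0 + int n}" and ?I = "{i0..i0 + int (Suc n)}" and ?e = "i0 + int n + 1"
    have I: "insert ?e ?J = ?I" by auto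
    have J: "(\<Prod>x\<in>?J. f x) = (\<Prod>i<Suc n. f (i0 + int i))" for f :: "int \<Rightarrow> real"
      by (rule prod.reindex_bij_betw[symmetric], rule bij_betw_byWitness[of _ "\<lambda>x. nat (x - i0)"]) auto
    have summand: "measure (pca_image \<kappa> T m) (cyl \<kappa> ?I ?J (a(?e := s)) c) =
        zigzag_weight D\<gamma> U\<gamma> \<rho> i0 n a c * U\<gamma> $$ (c (i0 + int n), s)" if s: "s \<le> \<kappa>" for s
    proof -
      define y where "y = a(?e := s)"
      have y: "\<And>x. y x \<le> \<kappa>" using a s by (simp add: y_def)
      have c': "\<And>x. c x \<le> \<kappa>" using c by simp
      have "measure (pca_image \<kappa> T m) (cyl \<kappa> ?I ?J y c) =
          measure m (cyl \<kappa> {} ?I (\<lambda>_. 0) y) * (\<Prod>x\<in>?J. T (y x) (y (x + 1)) (c x))"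
        by (rule measure_pca_image_cyl[OF T m _ _ _ y c']) auto
      \<comment> \<open>Here both consequences of commutation enter: \<rho>D = \<rho> for the first
        site and UD = DU for the transitions.\<close>
      also have "measure m (cyl \<kappa> {} ?I (\<lambda>_. 0) y) =
          \<rho> $ y i0 * (\<Prod>i<Suc n. (D\<gamma> * U\<gamma>) $$ (y (i0 + int i), y (i0 + int i + 1)))"
        unfolding hzmc_law_snd_marginal[OF law y] comm rho_D[OF y]
        using y by (simp only: index_mult_mat_sum[OF U_carrier D_carrier])
      also have "\<rho> $ y i0 * (\<Prod>i<Suc n. (D\<gamma> * U\<gamma>) $$ (y (i0 + int i), y (i0 + int i + 1))) *
          (\<Prod>x\<in>?J. T (y x) (y (x + 1)) (c x)) =
          \<rho> $ y i0 * (\<Prod>i<Suc n. D\<gamma> $$ (y (i0 + int i), c (i0 + int i)) * U\<gamma> $$ (c (i0 + int i), y (i0 + int i + 1)))"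
        unfolding J using y c' by (simp only: D_times_U_eq_DU_T[OF prod] prod.distrib mult.assoc)
      also have "\<dots> = zigzag_weight D\<gamma> U\<gamma> \<rho> i0 n a c * U\<gamma> $$ (c (i0 + int n), s)"
        unfolding zigzag_weight_def prod.lessThan_Suc by (simp add: y_def)
      finally show ?thesis unfolding y_def .
    qed
    have "measure (pca_image \<kappa> T m) (cyl \<kappa> ?J ?J a c) =
        (\<Sum>s\<le>\<kappa>. measure (pca_image \<kappa> T m) (cyl \<kappa> (insert ?e ?J) ?J (a(?e := s)) c))"
      by (rule measure_cyl_split_insert_fst[OF m']) auto
    also have "\<dots> = (\<Sum>s\<le>\<kappa>. zigzag_weight D\<gamma> U\<gamma> \<rho> i0 n a c * U\<gamma> $$ (c (i0 + int n), s))"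
      unfolding I by (intro sum.cong refl summand) simp
    also have "\<dots> = zigzag_weight D\<gamma> U\<gamma> \<rho> i0 n a c"
      using markov_U[OF prod] c by (simp only: sum_distrib_left[symmetric]) (simp add: markov_kernel_def)
    finally show ?thesis .
  qed
  have "hzmc_law \<kappa> D\<gamma> U\<gamma> \<rho> (pca_image \<kappa> T m)"
    unfolding hzmc_law_iff
    by (intro conjI allI impI markov_D markov_U[OF prod] rho_invariant_DU[OF prod] m') (rule cyl_law; assumption)
  then have "pca_image \<kappa> T m = m" using law by (rule hzmc_law_unique)
  then show ?thesis using m by (simp add: pca_invariant_def)
qed

lemma ex1_hzmc_law: "\<exists>!m. hzmc_law \<kappa> D\<gamma> U\<gamma> \<rho> m"
proof -
  obtain m where m: "hzmc_law \<kappa> D\<gamma> U\<gamma> \<rho> m"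
    using hzmc_law_exists[OF markov_D markov_U[OF prod] rho_invariant_DU[OF prod] rho_pos rho_D rho_U] by auto
  then show ?thesis by (rule ex1I) (rule hzmc_law_unique[OF _ m])
qed

lemma invariant_probs:
  assumes "K \<in> {D\<gamma>, U\<gamma>, D\<gamma> * U\<gamma>, U\<gamma> * D\<gamma>}"
  shows "invariant_prob \<kappa> K p \<longleftrightarrow> p = \<rho>"
  using assms comm invariant_prob_unique[OF square_pos_D rho_invariant_D rho_pos]
    invariant_prob_unique[OF square_pos_U[OF prod] rho_invariant_U rho_pos]
    invariant_prob_unique[OF square_pos_DU[OF prod] rho_invariant_DU[OF prod] rho_pos]
  by auto

end

lemma admits_invariant_hzmc_iff:
  "admits_invariant_hzmc \<kappa> T \<longleftrightarrow> product_condition \<kappa> T \<and> D\<gamma> * U\<gamma> = U\<gamma> * D\<gamma>"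
proof
  assume "admits_invariant_hzmc \<kappa> T"
  then obtain D U p m where *: "hzmc_law \<kappa> D U p m" "\<forall>a\<le>\<kappa>. \<forall>b\<le>\<kappa>. (D * U) $$ (a, b) > 0" "pca_invariant \<kappa> T m"
    unfolding admits_invariant_hzmc_def by (elim exE conjE)
  have "product_condition \<kappa> T \<and> D\<gamma> = D \<and> U\<gamma> = U \<and> D * U = U * D"
    by (rule invariant_hzmc_determined[OF *(1) _ *(3)]) (use *(2) in blast)
  then show "product_condition \<kappa> T \<and> D\<gamma> * U\<gamma> = U\<gamma> * D\<gamma>" by simp
next
  assume **: "product_condition \<kappa> T \<and> D\<gamma> * U\<gamma> = U\<gamma> * D\<gamma>"
  obtain m where m: "hzmc_law \<kappa> D\<gamma> U\<gamma> \<rho> m"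
    using ex1_hzmc_law[OF conjunct1[OF **] conjunct2[OF **]] by (elim ex1E)
  have inv: "pca_invariant \<kappa> T m" by (rule pca_invariant_hzmc[OF conjunct1[OF **] conjunct2[OF **] m])
  have pos: "\<forall>a\<le>\<kappa>. \<forall>b\<le>\<kappa>. (D\<gamma> * U\<gamma>) $$ (a, b) > 0"
    by (intro allI impI DU_pos[OF conjunct1[OF **]])
  show "admits_invariant_hzmc \<kappa> T"
    unfolding admits_invariant_hzmc_def by (intro exI conjI) (rule m pos inv)+
qed

text \<open>A stochastic matrix on two states is determined by its diagonal, and DU and UD have the
  same diagonal.\<close>

lemma commute_two_states:
  assumes \<kappa>: "\<kappa> = 1" and prod: "product_condition \<kappa> T"
  shows "D\<gamma> * U\<gamma> = U\<gamma> * D\<gamma>"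
proof -
  define P where "P = D\<gamma> * U\<gamma>"
  define Q where "Q = U\<gamma> * D\<gamma>"
  have P: "P $$ (i, 0) + P $$ (i, 1) = 1" and Q: "Q $$ (i, 0) + Q $$ (i, 1) = 1" if "i \<le> \<kappa>" for i
    using markov_kernel_mult_row_sum[OF markov_D markov_U[OF prod] that]
      markov_kernel_mult_row_sum[OF markov_U[OF prod] markov_D that]
    by (simp_all add: P_def Q_def \<kappa> del: index_mult_mat)
  have diag: "P $$ (i, i) = Q $$ (i, i)" if "i \<le> \<kappa>" for i
    unfolding P_def Q_def by (rule DU_UD_diagonal[OF prod that])
  have le: "0 \<le> \<kappa>" "1 \<le> \<kappa>" by (simp_all add: \<kappa>)
  note r = P[OF le(1)] P[OF le(2)] Q[OF le(1)] Q[OF le(2)] diag[OF le(1)] diag[OF le(2)]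
  have "P = Q"
  proof (rule eq_mat_atMost)
    show "P \<in> carrier_mat (\<kappa> + 1) (\<kappa> + 1)" "Q \<in> carrier_mat (\<kappa> + 1) (\<kappa> + 1)"
      unfolding P_def Q_def using D_carrier U_carrier by (auto intro: mult_carrier_mat)
    fix i j assume "i \<le> \<kappa>" "j \<le> \<kappa>"
    then have "i = 0 \<or> i = 1" "j = 0 \<or> j = 1" by (auto simp: \<kappa>)
    then show "P $$ (i, j) = Q $$ (i, j)" using r by auto
  qed
  then show ?thesis by (simp add: P_def Q_def)
qed

text \<open>If one of a, b, c is 0 the right-hand side cancels to T_(a,b),c, so the case a = b = c =
  1 is the only condition left.\<close>

lemma product_condition_two_states:
  assumes \<kappa>: "\<kappa> = 1"
  shows "product_condition \<kappa> T \<longleftrightarrow>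
    T 0 0 0 * T 1 1 0 * T 1 0 1 * T 0 1 1 = T 1 1 1 * T 0 0 1 * T 0 1 0 * T 1 0 0"
proof -
  have pos: "T a b 0 > 0" "T 0 0 a > 0" if "a \<le> 1" "b \<le> 1" for a b
    using T0 T00 that by (simp_all add: \<kappa>)
  have nz: "T 0 0 0 \<noteq> 0" "T 0 1 0 \<noteq> 0" "T 1 0 0 \<noteq> 0" "T 1 1 0 \<noteq> 0" "T 0 0 1 \<noteq> 0"
    using pos(1)[of 0 0] pos(1)[of 0 1] pos(1)[of 1 0] pos(1)[of 1 1] pos(2)[of 1 0] by auto
  let ?R = "\<lambda>a b c. T 0 0 0 * T a b 0 * T a 0 c * T 0 b c / (T a 0 0 * T 0 b 0 * T 0 0 c)"
  have le1: "(\<forall>a\<le>1. F a) \<longleftrightarrow> F 0 \<and> F 1" for F :: "nat \<Rightarrow> bool"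
    by (auto simp: le_Suc_eq)
  have "product_condition \<kappa> T \<longleftrightarrow> T 1 1 1 = ?R 1 1 1"
    unfolding product_condition_def \<kappa> le1 using nz by simp
  also have "\<dots> \<longleftrightarrow> T 0 0 0 * T 1 1 0 * T 1 0 1 * T 0 1 1 = T 1 1 1 * T 0 0 1 * T 0 1 0 * T 1 0 0"
    using nz by (simp add: eq_divide_eq mult_ac) (metis mult.commute mult.assoc)
  finally show ?thesis .
qed

theorem invariant_hzmc_characterization:
  "(admits_invariant_hzmc \<kappa> T \<longleftrightarrow> product_condition \<kappa> T \<and> D\<gamma> * U\<gamma> = U\<gamma> * D\<gamma>)
    \<and> (product_condition \<kappa> T \<and> D\<gamma> * U\<gamma> = U\<gamma> * D\<gamma> \<longrightarrow>
         (\<exists>!m. hzmc_law \<kappa> D\<gamma> U\<gamma> (\<rho>) m)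
         \<and> (\<forall>p m. hzmc_law \<kappa> D\<gamma> U\<gamma> p m \<longrightarrow> pca_invariant \<kappa> T m)
         \<and> (\<forall>K\<in>{D\<gamma>, U\<gamma>, D\<gamma> * U\<gamma>, U\<gamma> * D\<gamma>}. \<forall>p. invariant_prob \<kappa> K p \<longleftrightarrow> p = \<rho>))
    \<and> (\<kappa> = 1 \<longrightarrow>
         (product_condition \<kappa> T \<longrightarrow> D\<gamma> * U\<gamma> = U\<gamma> * D\<gamma>)
         \<and> (admits_invariant_hzmc \<kappa> T \<longleftrightarrow> product_condition \<kappa> T)
         \<and> (product_condition \<kappa> T \<longleftrightarrow>
              T 0 0 0 * T 1 1 0 * T 1 0 1 * T 0 1 1 = T 1 1 1 * T 0 0 1 * T 0 1 0 * T 1 0 0))"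
proof -
  \<comment> \<open>The initial law p is arbitrary here, but the definition of a zigzag chain makes
    it invariant under DU, which forces p = \<rho>.\<close>
  have invariant: "pca_invariant \<kappa> T m"
    if *: "product_condition \<kappa> T" "D\<gamma> * U\<gamma> = U\<gamma> * D\<gamma>" and law: "hzmc_law \<kappa> D\<gamma> U\<gamma> p m" for p m
  proof -
    have "invariant_prob \<kappa> (D\<gamma> * U\<gamma>) p" using law by (simp add: hzmc_law_iff)
    then have "p = \<rho>" using invariant_probs[OF *, of "D\<gamma> * U\<gamma>" p] by simp
    then show ?thesis using pca_invariant_hzmc[OF *] law by simp
  qed
  have two: "(product_condition \<kappa> T \<longrightarrow> D\<gamma> * U\<gamma> = U\<gamma> * D\<gamma>)
      \<and> (admits_invariant_hzmc \<kappa> T \<longleftrightarrow> product_condition \<kappa> T)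
      \<and> (product_condition \<kappa> T \<longleftrightarrow>
           T 0 0 0 * T 1 1 0 * T 1 0 1 * T 0 1 1 = T 1 1 1 * T 0 0 1 * T 0 1 0 * T 1 0 0)" if "\<kappa> = 1"
  proof (intro conjI)
    show comm: "product_condition \<kappa> T \<longrightarrow> D\<gamma> * U\<gamma> = U\<gamma> * D\<gamma>"
      using commute_two_states[OF that] by blast
    show "admits_invariant_hzmc \<kappa> T \<longleftrightarrow> product_condition \<kappa> T"
      unfolding admits_invariant_hzmc_iff using comm by blast
  qed (rule product_condition_two_states[OF that])
  show ?thesis
    by (intro conjI impI two admits_invariant_hzmc_iff allI ballI)
      (elim conjE, rule ex1_hzmc_law invariant invariant_probs; assumption)+
qed

end

theorem theorem2p9:
  fixes \<kappa> :: nat and T :: "nat \<Rightarrow> nat \<Rightarrow> nat \<Rightarrow> real"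
    and \<gamma> \<rho> :: "real vec" and D U :: "real mat"
  assumes "\<kappa> \<ge> 1"
    and "transition_matrix \<kappa> T"
    and "\<And>a b. a \<le> \<kappa> \<Longrightarrow> b \<le> \<kappa> \<Longrightarrow> T a b 0 > 0"
    and "\<And>c. c \<le> \<kappa> \<Longrightarrow> T 0 0 c > 0"
  defines "\<gamma> \<equiv> gamma_vec \<kappa> T"
    and "D \<equiv> D_mat \<kappa> T \<gamma>"
    and "U \<equiv> U_mat \<kappa> T \<gamma>"
    and "\<rho> \<equiv> rho_of \<kappa> \<gamma> (mu_vec \<kappa> T)"
  shows "(admits_invariant_hzmc \<kappa> T \<longleftrightarrow> product_condition \<kappa> T \<and> D * U = U * D)
    \<and> (product_condition \<kappa> T \<and> D * U = U * D \<longrightarrow>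
         (\<exists>!m. hzmc_law \<kappa> D U \<rho> m)
         \<and> (\<forall>\<rho>' m. hzmc_law \<kappa> D U \<rho>' m \<longrightarrow> pca_invariant \<kappa> T m)
         \<and> (\<forall>K\<in>{D, U, D * U, U * D}. \<forall>p. invariant_prob \<kappa> K p \<longleftrightarrow> p = \<rho>))
    \<and> (\<kappa> = 1 \<longrightarrow>
         (product_condition \<kappa> T \<longrightarrow> D * U = U * D)
         \<and> (admits_invariant_hzmc \<kappa> T \<longleftrightarrow> product_condition \<kappa> T)
         \<and> (product_condition \<kappa> T \<longleftrightarrow>
              T 0 0 0 * T 1 1 0 * T 1 0 1 * T 0 1 1 = T 1 1 1 * T 0 0 1 * T 0 1 0 * T 1 0 0))"
  unfolding \<gamma>_def D_def U_def \<rho>_def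
  by (rule positive_pca.invariant_hzmc_characterization, rule positive_pca.intro) (fact assms(2-4))+

end
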